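(* Let $f:X\to X$ be a continuous map on a compact metric space $X$ such that $h_{\mathrm{top}}(f)<+\infty$ and let $\varphi:X\to\mathbb{R}$ be a continuous observable. Then $$\frac1t P_{\mathrm{top}}(f,t\varphi)=\max_{\nu\in\mathcal{P}_f(X)}\Big\{\frac1t\,\mathfrak{h}_\nu(f)+\int\varphi\,d\nu\Big\}\ \longrightarrow\ \max_{\nu\in\mathcal{P}_f(X)}\int\varphi\,d\nu\qquad(t\to+\infty).$$ Moreover, if for each $t>0$ one chooses an $f$-invariant probability measure $\nu_t\in\mathcal{P}_f(X)$ satisfying $P_{\mathrm{top}}(f,t\varphi)=\mathfrak{h}_{\nu_t}(f)+\int t\varphi\,d\nu_t$, then any weak$^*$ accumulation point $\nu_\infty\in\mathcal{P}_f(X)$ of $(\nu_t)_{t>0}$ as $t\to+\infty$ satisfies: (a) $\int\varphi\,d\nu_\infty=\max_{\mu\in\mathcal{P}_f(X)}\int\varphi\,d\mu$; (b) $\displaystyle\mathfrak{h}_{\nu_\infty}(f)=\max_{\nu\in\mathcal{M}_f(X,\varphi)}\mathfrak{h}_\nu(f)\ \geqslant\ \max_{\nu\in\mathcal{M}_f(X,\varphi)}h_\nu(f)$; (c) $\lim_{t\to+\infty}\mathfrak{h}_{\nu_t}(f)=\mathfrak{h}_{\nu_\infty}(f)$; where $\mathcal{M}_f(X,\varphi)$ stands for the set of $f$-invariant $\varphi$-maximizing probability measures obtained through zero-temperature limits.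
   Context: $C(X)$ is the space of continuous functions $X\to\mathbb{R}$. $\mathcal{P}_f(X)$ is the set of $f$-invariant Borel probability measures on $X$ with the weak$^*$ topology. $h_\mu(f)$ is the Kolmogorov–Sinai metric entropy of $\mu\in\mathcal{P}_f(X)$. For $n\in\mathbb{N}$ let $d_n(x,z)=\max_{0\leqslant j\leqslant n}d(f^j(x),f^j(z))$; a set $E\subset X$ is $(n,\varepsilon)$-separated if $d_n(x,z)\geqslant\varepsilon$ for all distinct $x,z\in E$. For $\psi\in C(X)$, with $S_n\psi=\psi+\psi\circ f+\cdots+\psi\circ f^n$, the topological pressure is $P_{\mathrm{top}}(f,\psi)=\lim_{\varepsilon\to0^+}\limsup_{n\to+\infty}\frac1n\log\sup_E\sum_{x\in E}e^{S_n\psi(x)}$, the supremum being over $(n,\varepsilon)$-separated sets $E$; $h_{\mathrm{top}}(f)=P_{\mathrm{top}}(f,0)$. For a Borel probability measure $\mu$ on $X$, $\mathfrak{h}_\mu(f)=\inf_{\psi\in C(X)}\{P_{\mathrm{top}}(f,\psi)-\int\psi\,d\mu\}$. A measure $\mu\in\mathcal{P}_f(X)$ is $\varphi$-maximizing if $\int\varphi\,d\mu=\max_{\nu\in\mathcal{P}_f(X)}\int\varphi\,d\nu$. It is obtained through a zero-temperature limit if it is a weak$^*$ accumulation point, as $t\to+\infty$, of some family $(\nu_t)_{t>0}$ in $\mathcal{P}_f(X)$ with $P_{\mathrm{top}}(f,t\varphi)=\mathfrak{h}_{\nu_t}(f)+\int t\varphi\,d\nu_t$ for each $t>0$.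
   Formalization: In (b), the maximum of the metric entropy h_ν(f) over M_f(X,φ) is replaced by a supremum, since it need not be attained (h_ν is not upper semicontinuous; there are counterexamples with φ = 0); the inequality with max follows whenever that maximum exists. *)

theory Defs
  imports "HOL-Probability.Probability"
begin

text \<open>
  The phase space is a whole type \<open>'a\<close> of class \<open>metric_space\<close>; its compactness is the hypothesis
  \<open>compact (UNIV :: 'a set)\<close>. Quantities that need not be finite are valued in \<open>ereal\<close>.
\<close>

definition is_maximum :: "'b::order \<Rightarrow> 'b set \<Rightarrow> bool" where
  "is_maximum m S \<longleftrightarrow> m \<in> S \<and> (\<forall>s\<in>S. s \<le> m)"


subsection \<open>Topological pressure\<close>

definition dyn_dist :: "('a::metric_space \<Rightarrow> 'a) \<Rightarrow> nat \<Rightarrow> 'a \<Rightarrow> 'a \<Rightarrow> real" where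
  "dyn_dist f n x z = Max ((\<lambda>j. dist ((f ^^ j) x) ((f ^^ j) z)) ` {0..n})"

definition separated :: "('a::metric_space \<Rightarrow> 'a) \<Rightarrow> nat \<Rightarrow> real \<Rightarrow> 'a set \<Rightarrow> bool" where
  "separated f n \<epsilon> E \<longleftrightarrow> (\<forall>x\<in>E. \<forall>z\<in>E. x \<noteq> z \<longrightarrow> \<epsilon> \<le> dyn_dist f n x z)"

text \<open>Birkhoff sums have \<open>n + 1\<close> terms, in accordance with \<open>dyn_dist\<close>.\<close>

definition birkhoff_sum :: "('a \<Rightarrow> 'a) \<Rightarrow> ('a \<Rightarrow> real) \<Rightarrow> nat \<Rightarrow> 'a \<Rightarrow> real" where
  "birkhoff_sum f \<psi> n x = (\<Sum>j\<in>{0..n}. \<psi> ((f ^^ j) x))"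

text \<open>
  The sum and the supremum are real-valued: for continuous \<open>f\<close> and \<open>\<psi>\<close> on a compact space and
  \<open>\<epsilon> > 0\<close>, the \<open>(n, \<epsilon>)\<close>-separated sets are finite with uniformly bounded cardinality, so that the
  conventions for infinite sums and unbounded suprema never play a role.
\<close>

definition partition_sum ::
  "('a::metric_space \<Rightarrow> 'a) \<Rightarrow> ('a \<Rightarrow> real) \<Rightarrow> nat \<Rightarrow> real \<Rightarrow> real" where
  "partition_sum f \<psi> n \<epsilon> =
     (SUP E\<in>{E. separated f n \<epsilon> E}. \<Sum>x\<in>E. exp (birkhoff_sum f \<psi> n x))"

definition P_top :: "('a::metric_space \<Rightarrow> 'a) \<Rightarrow> ('a \<Rightarrow> real) \<Rightarrow> ereal" where
  "P_top f \<psi> =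
     Lim (at_right 0) (\<lambda>\<epsilon>. limsup (\<lambda>n. ereal (1 / real n * ln (partition_sum f \<psi> n \<epsilon>))))"

definition h_top :: "('a::metric_space \<Rightarrow> 'a) \<Rightarrow> ereal" where
  "h_top f = P_top f (\<lambda>x. 0)"


subsection \<open>Invariant measures and the weak* topology\<close>

definition invariant_measures :: "('a::metric_space \<Rightarrow> 'a) \<Rightarrow> 'a measure set" where
  "invariant_measures f = {\<mu>. sets \<mu> = sets borel \<and> prob_space \<mu> \<and> distr \<mu> borel f = \<mu>}"

text \<open>
  The coarsest topology on the invariant measures that makes \<open>\<mu> \<mapsto> \<integral> \<psi> d\<mu>\<close> continuous for
  every continuous \<open>\<psi>\<close>.
\<close>

definition weak_star :: "('a::metric_space \<Rightarrow> 'a) \<Rightarrow> 'a measure topology" where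
  "weak_star f =
     pullback_topology (invariant_measures f)
       (\<lambda>\<mu>. \<lambda>\<psi>\<in>{\<psi>. continuous_on UNIV \<psi>}. \<integral>x. \<psi> x \<partial>\<mu>)
       (product_topology (\<lambda>\<psi>. euclideanreal) {\<psi>. continuous_on UNIV \<psi>})"

definition accumulation_point :: "'b topology \<Rightarrow> (real \<Rightarrow> 'b) \<Rightarrow> 'b \<Rightarrow> bool" where
  "accumulation_point T \<nu> l \<longleftrightarrow>
     l \<in> topspace T \<and> (\<forall>U. openin T U \<and> l \<in> U \<longrightarrow> (\<exists>\<^sub>F t in at_top. \<nu> t \<in> U))"


subsection \<open>Kolmogorov--Sinai entropy\<close>

definition partition_entropy :: "'a measure \<Rightarrow> 'a set set \<Rightarrow> real" where
  "partition_entropy \<mu> P = - (\<Sum>A\<in>P. measure \<mu> A * ln (measure \<mu> A))"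

text \<open>The join of the preimages of \<open>P\<close> under \<open>f ^^ j\<close> for \<open>j < n\<close>.\<close>

definition dyn_refinement :: "('a \<Rightarrow> 'a) \<Rightarrow> 'a set set \<Rightarrow> nat \<Rightarrow> 'a set set" where
  "dyn_refinement f P n = common_refinement ((\<lambda>j. (\<lambda>A. (f ^^ j) -` A) ` P - {{}}) ` {..<n})"

text \<open>The limit exists for every invariant \<open>\<mu>\<close>, by subadditivity.\<close>

definition entropy_wrt :: "'a measure \<Rightarrow> ('a \<Rightarrow> 'a) \<Rightarrow> 'a set set \<Rightarrow> real" where
  "entropy_wrt \<mu> f P = lim (\<lambda>n. 1 / real n * partition_entropy \<mu> (dyn_refinement f P n))"

definition KS_entropy :: "'a measure \<Rightarrow> ('a \<Rightarrow> 'a) \<Rightarrow> ereal" where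
  "KS_entropy \<mu> f =
     (SUP P\<in>{P. finite P \<and> partition_on (space \<mu>) P \<and> P \<subseteq> sets \<mu>}. ereal (entropy_wrt \<mu> f P))"


subsection \<open>Upper entropy map, equilibrium families and zero-temperature limits\<close>

definition upper_entropy :: "'a measure \<Rightarrow> ('a::metric_space \<Rightarrow> 'a) \<Rightarrow> ereal" where
  "upper_entropy \<mu> f =
     (INF \<psi>\<in>{\<psi>. continuous_on UNIV \<psi>}. P_top f \<psi> - ereal (\<integral>x. \<psi> x \<partial>\<mu>))"

definition maximizing :: "('a::metric_space \<Rightarrow> 'a) \<Rightarrow> ('a \<Rightarrow> real) \<Rightarrow> 'a measure \<Rightarrow> bool" where
  "maximizing f \<phi> \<mu> \<longleftrightarrow>
     \<mu> \<in> invariant_measures f \<and>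
     is_maximum (\<integral>x. \<phi> x \<partial>\<mu>) ((\<lambda>\<nu>. \<integral>x. \<phi> x \<partial>\<nu>) ` invariant_measures f)"

text \<open>Only the values of \<open>\<nu>\<close> at positive times matter.\<close>

definition equilibrium_family ::
  "('a::metric_space \<Rightarrow> 'a) \<Rightarrow> ('a \<Rightarrow> real) \<Rightarrow> (real \<Rightarrow> 'a measure) \<Rightarrow> bool" where
  "equilibrium_family f \<phi> \<nu> \<longleftrightarrow>
     (\<forall>t>0. \<nu> t \<in> invariant_measures f \<and>
        P_top f (\<lambda>x. t * \<phi> x) = upper_entropy (\<nu> t) f + ereal (\<integral>x. t * \<phi> x \<partial>(\<nu> t)))"

definition zero_temperature_measures ::
  "('a::metric_space \<Rightarrow> 'a) \<Rightarrow> ('a \<Rightarrow> real) \<Rightarrow> 'a measure set" where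
  "zero_temperature_measures f \<phi> =
     {\<mu>. maximizing f \<phi> \<mu> \<and>
         (\<exists>\<nu>. equilibrium_family f \<phi> \<nu> \<and> accumulation_point (weak_star f) \<nu> \<mu>)}"

end

theory Submission
  imports Defs
begin

text \<open>
  The upper entropy map is the concave conjugate of the pressure, so the whole statement is convex
  duality for the functional \<open>\<psi> \<mapsto> P_top f \<psi>\<close> on continuous functions, together with one analytic input
  linking it to the Kolmogorov--Sinai entropy.

  The pressure is convex, monotone, satisfies \<open>P (\<psi> + c) = P \<psi> + c\<close> and does not change when a
  coboundary \<open>\<eta> \<circ> f - \<eta>\<close> is added to the potential. A subgradient of such a functional is therefore
  a positive linear functional that maps \<open>1\<close> to \<open>1\<close> and annihilates coboundaries; by Riesz it is
  integration against an invariant probability measure \<open>\<nu>\<close>, and being a subgradient at \<open>\<psi>\<close> says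
  exactly that the infimum defining the upper entropy of \<open>\<nu>\<close> is attained at \<open>\<psi>\<close>
  (\<open>invariant_subgradient\<close>, \<open>equilibrium_state_exists\<close>). The functional
  \<open>\<psi> \<mapsto> sup \<integral> \<psi> d\<nu>\<close> over invariant \<open>\<nu>\<close> has the same four properties, so the same argument produces a
  \<open>\<phi>\<close>-maximizing measure (\<open>maximizing_measure_exists\<close>).

  The analytic input is the variational inequality \<open>h_\<nu>(f) + \<integral> \<psi> d\<nu> \<le> P_top f \<psi>\<close>
  (\<open>entropy_wrt_le_pressure\<close>), that is, \<open>KS_entropy \<le> upper_entropy\<close>. The idea is Misiurewicz's: the cells
  of a partition are approximated from inside by closed sets, which a small ball cannot confuse.
  An orbit is recorded in blocks, each block as a cell and a bit telling whether the orbit is in the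
  closed approximation of that cell, and the Gibbs inequality for suitable weights on the resulting words
  bounds their entropy by a partition sum. In particular the upper entropies of
  invariant measures lie between \<open>0\<close> and \<open>h_top f\<close>.

  The rest is elementary. Dividing \<open>P_top f (t \<phi>) = max (upper_entropy \<nu> f + t \<integral> \<phi> d\<nu>)\<close> by \<open>t\<close> removes the bounded
  entropy term in the limit. Comparing the equilibrium states at two parameters shows
  that the upper entropy of \<open>\<nu>\<^sub>t\<close> decreases in \<open>t\<close>, and comparing \<open>\<nu>\<^sub>t\<close> with a maximizing measure
  shows that it stays above the upper entropy of every maximizing measure. As an infimum of
  continuous functions the upper entropy is upper semicontinuous, so at an accumulation point it is
  also at least the limit; hence it equals the limit and is the largest value on maximizing measures.
\<close>

section \<open>Subgradients of convex functionals\<close>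

definition sublinear :: "('v::real_vector \<Rightarrow> real) \<Rightarrow> bool" where
  "sublinear q \<longleftrightarrow> (\<forall>x y. q (x + y) \<le> q x + q y) \<and> (\<forall>c>0. \<forall>x. q (c *\<^sub>R x) = c * q x)"

lemma sublinear_add: "sublinear q \<Longrightarrow> q (x + y) \<le> q x + q y"
  and sublinear_scale: "sublinear q \<Longrightarrow> c > 0 \<Longrightarrow> q (c *\<^sub>R x) = c * q x"
  by (auto simp: sublinear_def)

lemma sublinear_0:
  assumes "sublinear q" shows "q 0 = 0"
  using sublinear_scale[OF assms, of 2 0] by simp

lemma sublinear_minus:
  assumes "sublinear q" shows "- q (- x) \<le> q x"
  using sublinear_add[OF assms, of x "- x"] sublinear_0[OF assms] by simp

text \<open>
  The lower bound \<open>- p (- x)\<close>, common to all sublinear functionals below \<open>p\<close>, makes the pointwise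
  infimum finite; comparability of two members of the chain gives subadditivity.
\<close>

lemma sublinear_chain_Inf:
  assumes "C \<noteq> {}" and sub: "\<And>q. q \<in> C \<Longrightarrow> sublinear q"
    and chain: "\<And>q r. q \<in> C \<Longrightarrow> r \<in> C \<Longrightarrow> q \<le> r \<or> r \<le> q"
    and below: "\<And>q. q \<in> C \<Longrightarrow> q \<le> p"
  shows "sublinear (\<lambda>x. INF q\<in>C. q x)" "\<And>q x. q \<in> C \<Longrightarrow> (INF q\<in>C. q x) \<le> q x"
proof -
  have "- p (- x) \<le> q x" if "q \<in> C" for q x
    using sublinear_minus[OF sub[OF that], of x] le_funD[OF below[OF that], of "- x"] by linarith
  then have bdd: "bdd_below ((\<lambda>q. q x) ` C)" for x
    by (auto intro!: bdd_belowI[of _ "- p (- x)"])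
  show lower: "\<And>q x. q \<in> C \<Longrightarrow> (INF q\<in>C. q x) \<le> q x"
    by (rule cINF_lower[OF bdd])
  let ?I = "\<lambda>x. INF q\<in>C. q x"
  have add: "?I (x + y) \<le> ?I x + ?I y" for x y
  proof -
    have "?I (x + y) \<le> q x + r y" if q: "q \<in> C" and r: "r \<in> C" for q r
    proof -
      from chain[OF q r] obtain s where s: "s \<in> C" "s \<le> q" "s \<le> r"
        using q r by auto
      have "?I (x + y) \<le> s (x + y)"
        by (rule lower[OF s(1)])
      also have "\<dots> \<le> s x + s y"
        by (rule sublinear_add[OF sub[OF s(1)]])
      also have "\<dots> \<le> q x + r y"
        using s by (intro add_mono) (auto simp: le_fun_def)
      finally show ?thesis .
    qed
    then have "?I (x + y) - r y \<le> ?I x" if "r \<in> C" for r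
      using that \<open>C \<noteq> {}\<close> by (intro cINF_greatest) (auto simp: algebra_simps)
    then have "?I (x + y) - ?I x \<le> ?I y"
      using \<open>C \<noteq> {}\<close> by (intro cINF_greatest) (auto simp: algebra_simps)
    then show ?thesis by simp
  qed
  have le: "?I (c *\<^sub>R x) \<le> c * ?I x" if "c > 0" for c x
  proof -
    have "?I (c *\<^sub>R x) / c \<le> ?I x"
    proof (rule cINF_greatest[OF \<open>C \<noteq> {}\<close>])
      fix q assume "q \<in> C"
      with lower[OF this, of "c *\<^sub>R x"] sublinear_scale[OF sub[OF this] that]
      show "?I (c *\<^sub>R x) / c \<le> q x"
        using that by (simp add: field_simps)
    qed
    then show ?thesis using that by (simp add: field_simps)
  qed
  have "?I (c *\<^sub>R x) = c * ?I x" if "c > 0" for c x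
    using le[OF that, of x] le[of "inverse c" "c *\<^sub>R x"] that by (simp add: field_simps)
  with add show "sublinear ?I"
    by (simp add: sublinear_def)
qed

lemma sublinear_minimal:
  assumes "sublinear p"
  obtains l where "sublinear l" "l \<le> p" "\<And>q. sublinear q \<Longrightarrow> q \<le> l \<Longrightarrow> q = l"
proof -
  define A where "A = {q. sublinear q \<and> q \<le> p}"
  let ?R = "relation_of (\<lambda>a b. b \<le> a) A"
  have "\<exists>m\<in>A. \<forall>a\<in>A. a \<le> m \<longrightarrow> a = m"
  proof (rule predicate_Zorn)
    show "partial_order_on A ?R"
      by (auto simp: partial_order_on_def preorder_on_def refl_on_def trans_def antisym_def
          relation_of_def)
    fix C assume "C \<in> Chains ?R"
    then have C: "C \<subseteq> A" "\<And>q r. q \<in> C \<Longrightarrow> r \<in> C \<Longrightarrow> q \<le> r \<or> r \<le> q"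
      by (auto simp: Chains_def relation_of_def)
    show "\<exists>u\<in>A. \<forall>a\<in>C. u \<le> a"
    proof (cases "C = {}")
      case True
      with assms show ?thesis by (auto simp: A_def)
    next
      case False
      let ?I = "\<lambda>x. INF q\<in>C. q x"
      have sub: "\<And>q. q \<in> C \<Longrightarrow> sublinear q" and below: "\<And>q. q \<in> C \<Longrightarrow> q \<le> p"
        using C(1) by (auto simp: A_def)
      note I = sublinear_chain_Inf[OF False sub C(2) below]
      obtain q where "q \<in> C" using False by blast
      with I(2) below have "?I \<le> p"
        unfolding le_fun_def by (meson order_trans)
      with I show ?thesis
        by (intro bexI[of _ ?I]) (auto simp: A_def le_fun_def)
    qed
  qed
  then obtain m where m: "m \<in> A" "\<And>a. a \<in> A \<Longrightarrow> a \<le> m \<Longrightarrow> a = m"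
    by blast
  show thesis
  proof (rule that[of m])
    show "sublinear m" "m \<le> p" using m(1) by (auto simp: A_def)
    show "q = m" if "sublinear q" "q \<le> m" for q
      using m that by (auto simp: A_def)
  qed
qed

text \<open>
  The device that shows a minimal sublinear functional to be linear: \<open>r\<close> is sublinear and below \<open>q\<close>,
  and it improves on \<open>q\<close> unless \<open>q\<close> is additive in the direction \<open>y\<close>.
\<close>

lemma sublinear_translate:
  fixes y :: "'v::real_vector"
  assumes "sublinear q"
  defines "r \<equiv> \<lambda>x. INF t\<in>{0..}. q (x + t *\<^sub>R y) - t * q y"
  shows "sublinear r" "r x \<le> q x" "r x \<le> q (x + y) - q y"
proof -
  have r_eq: "r a = (INF t\<in>{0..}. q (a + t *\<^sub>R y) - t * q y)" for a
    by (simp add: r_def)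
  have tq: "q (t *\<^sub>R z) = t * q z" if "t \<ge> 0" for t z
    using that sublinear_scale[OF assms(1), of t z] sublinear_0[OF assms(1)]
    by (cases "t = 0") auto
  have "- q (- x) \<le> q (x + t *\<^sub>R y) - t * q y" if "t \<ge> 0" for t x
    using sublinear_add[OF assms(1), of "x + t *\<^sub>R y" "- x"] tq[OF that, of y] by simp
  then have bdd: "bdd_below ((\<lambda>t. q (x + t *\<^sub>R y) - t * q y) ` {0..})" for x
    by (auto intro!: bdd_belowI[of _ "- q (- x)"])
  have lower: "r x \<le> q (x + t *\<^sub>R y) - t * q y" if "t \<ge> 0" for x t
    unfolding r_def using that by (intro cINF_lower[OF bdd]) auto
  show "r x \<le> q x" "r x \<le> q (x + y) - q y"
    using lower[of 0 x] lower[of 1 x] by auto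
  have add: "r (a + b) \<le> r a + r b" for a b
  proof -
    have "r (a + b) \<le> (q (a + s *\<^sub>R y) - s * q y) + (q (b + t *\<^sub>R y) - t * q y)"
      if "s \<ge> 0" "t \<ge> 0" for s t
      using lower[of "s + t" "a + b"] that
        sublinear_add[OF assms(1), of "a + s *\<^sub>R y" "b + t *\<^sub>R y"]
      by (simp add: algebra_simps)
    then have "r (a + b) - (q (b + t *\<^sub>R y) - t * q y) \<le> r a" if "t \<ge> 0" for t
      unfolding r_eq[of a] using that by (intro cINF_greatest) (auto simp: algebra_simps)
    then have "r (a + b) - r a \<le> r b"
      unfolding r_eq[of b] by (intro cINF_greatest) (auto simp: algebra_simps)
    then show ?thesis by simp
  qed
  have le: "r (c *\<^sub>R a) \<le> c * r a" if "c > 0" for c a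
  proof -
    have "r (c *\<^sub>R a) / c \<le> r a"
      unfolding r_eq[of a]
    proof (rule cINF_greatest)
      fix t :: real assume "t \<in> {0..}"
      then have "r (c *\<^sub>R a) \<le> q (c *\<^sub>R a + (c * t) *\<^sub>R y) - (c * t) * q y"
        using that by (intro lower) auto
      also have "\<dots> = c * (q (a + t *\<^sub>R y) - t * q y)"
        using sublinear_scale[OF assms(1) that, of "a + t *\<^sub>R y"] by (simp add: algebra_simps)
      finally show "r (c *\<^sub>R a) / c \<le> q (a + t *\<^sub>R y) - t * q y"
        using that by (simp add: field_simps)
    qed simp
    then show ?thesis using that by (simp add: field_simps)
  qed
  have "r (c *\<^sub>R a) = c * r a" if "c > 0" for c a
    using le[OF that, of a] le[of "inverse c" "c *\<^sub>R a"] that by (simp add: field_simps)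
  with add show "sublinear r"
    by (simp add: sublinear_def)
qed

text \<open>
  Hahn--Banach: a minimal sublinear functional below \<open>p\<close> exists by
  Zorn's lemma, and minimality applied to \<open>sublinear_translate\<close> forces it to be additive.
\<close>

lemma sublinear_dominates_linear:
  assumes "sublinear p"
  obtains l where "linear l" "\<And>x. l x \<le> p x"
proof -
  obtain l where l: "sublinear l" "l \<le> p" and min: "\<And>q. sublinear q \<Longrightarrow> q \<le> l \<Longrightarrow> q = l"
    using sublinear_minimal[OF assms] by blast
  have "l x + l y \<le> l (x + y)" for x y
  proof -
    let ?r = "\<lambda>x. INF t\<in>{0..}. l (x + t *\<^sub>R y) - t * l y"
    have "?r = l"
      using sublinear_translate(1,2)[OF l(1)] by (intro min) (auto simp: le_fun_def)
    with sublinear_translate(3)[OF l(1), of x y] show ?thesis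
      by (simp add: fun_eq_iff[of ?r l] algebra_simps)
  qed
  with sublinear_add[OF l(1)] have add: "l (x + y) = l x + l y" for x y
    by (simp add: antisym)
  have neg: "l (- x) = - l x" for x
    using add[of x "- x"] sublinear_0[OF l(1)] by simp
  have "l (c *\<^sub>R x) = c * l x" for c x
  proof (cases c "0::real" rule: linorder_cases)
    case less
    then have "l ((- c) *\<^sub>R x) = (- c) * l x"
      by (intro sublinear_scale[OF l(1)]) simp
    with neg[of "c *\<^sub>R x"] show ?thesis by simp
  qed (use sublinear_0[OF l(1)] sublinear_scale[OF l(1)] in auto)
  with add l(2) show thesis
    by (intro that[of l] linearI) (auto simp: le_fun_def)
qed

text \<open>
  The one-sided directional derivative of \<open>Q\<close> at \<open>x\<close> is sublinear, and any linear functional below it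
  is a subgradient, because by convexity difference quotients decrease to that derivative.
\<close>

lemma convex_on_subgradient:
  fixes Q :: "'v::real_vector \<Rightarrow> real"
  assumes "convex_on UNIV Q"
  obtains l where "linear l" "\<And>v. Q x + l v \<le> Q (x + v)"
proof -
  define D where "D = (\<lambda>v. Q (x + v) - Q x)"
  define p where "p v = (INF t\<in>{0<..}. D (t *\<^sub>R v) / t)" for v
  have conv: "D (a *\<^sub>R v + b *\<^sub>R w) \<le> a * D v + b * D w" if "a \<ge> 0" "b \<ge> 0" "a + b = 1" for a b v w
  proof -
    have "x + (a *\<^sub>R v + b *\<^sub>R w) = a *\<^sub>R (x + v) + b *\<^sub>R (x + w)"
      using that(3) by (simp add: algebra_simps flip: scaleR_add_left)
    moreover have "Q (a *\<^sub>R (x + v) + b *\<^sub>R (x + w)) \<le> a * Q (x + v) + b * Q (x + w)"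
      using assms that by (auto simp: convex_on_def)
    moreover have "a * Q x + b * Q x = Q x"
      using that(3) by (simp flip: distrib_right)
    ultimately show ?thesis
      unfolding D_def by (simp add: algebra_simps)
  qed
  have D0: "D 0 = 0" by (simp add: D_def)
  have "- D (- v) \<le> D (t *\<^sub>R v) / t" if "t > 0" for t v
  proof -
    have "0 \<le> (1 / (1 + t)) * D (t *\<^sub>R v) + (t / (1 + t)) * D (- v)"
      using conv[of "1 / (1 + t)" "t / (1 + t)" "t *\<^sub>R v" "- v"] that D0
      by (simp add: add_divide_distrib[symmetric])
    also have "\<dots> = (D (t *\<^sub>R v) + t * D (- v)) / (1 + t)"
      by (simp add: add_divide_distrib)
    finally show ?thesis
      using that by (simp add: field_simps zero_le_divide_iff)
  qed
  then have bdd: "bdd_below ((\<lambda>t. D (t *\<^sub>R v) / t) ` {0<..})" for v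
    by (auto intro!: bdd_belowI[of _ "- D (- v)"])
  have lower: "p v \<le> D (t *\<^sub>R v) / t" if "t > 0" for t v
    unfolding p_def using that by (intro cINF_lower[OF bdd]) auto
  have add: "p (v + w) \<le> p v + p w" for v w
  proof -
    have "p (v + w) \<le> D (s *\<^sub>R v) / s + D (t *\<^sub>R w) / t" if st: "s > 0" "t > 0" for s t
    proof -
      \<comment> \<open>The harmonic combination of the two step sizes makes both difference quotients appear.\<close>
      let ?u = "s * t / (s + t)"
      have u: "?u > 0" using st by simp
      have ratio: "(t / (s + t) * a + s / (s + t) * b) / ?u = a / s + b / t" for a b
      proof -
        have "t / (s + t) * a + s / (s + t) * b = (t * a + s * b) / (s + t)"
          by (simp add: add_divide_distrib)
        then show ?thesis
          using st by (simp add: field_simps)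
      qed
      have "p (v + w) \<le> D (?u *\<^sub>R (v + w)) / ?u"
        by (rule lower[OF u])
      also have "?u *\<^sub>R (v + w) = (t / (s + t)) *\<^sub>R (s *\<^sub>R v) + (s / (s + t)) *\<^sub>R (t *\<^sub>R w)"
        by (simp add: algebra_simps)
      also have "D \<dots> / ?u \<le> ((t / (s + t)) * D (s *\<^sub>R v) + (s / (s + t)) * D (t *\<^sub>R w)) / ?u"
        using st u by (intro divide_right_mono conv) (simp_all add: add.commute flip: add_divide_distrib)
      also have "\<dots> = D (s *\<^sub>R v) / s + D (t *\<^sub>R w) / t"
        using ratio .
      finally show ?thesis .
    qed
    then have "p (v + w) - D (t *\<^sub>R w) / t \<le> p v" if "t > 0" for t
      unfolding p_def[of v] using that by (intro cINF_greatest) (auto simp: algebra_simps)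
    then have "p (v + w) - p v \<le> p w"
      unfolding p_def[of w] by (intro cINF_greatest) (auto simp: algebra_simps)
    then show ?thesis by simp
  qed
  have le: "p (c *\<^sub>R v) \<le> c * p v" if "c > 0" for c v
  proof -
    have "p (c *\<^sub>R v) / c \<le> p v"
      unfolding p_def[of v]
    proof (rule cINF_greatest)
      fix t :: real assume "t \<in> {0<..}"
      with that lower[of "t / c" "c *\<^sub>R v"]
      show "p (c *\<^sub>R v) / c \<le> D (t *\<^sub>R v) / t"
        by (simp add: field_simps)
    qed simp
    then show ?thesis using that by (simp add: field_simps)
  qed
  have "p (c *\<^sub>R v) = c * p v" if "c > 0" for c v
    using le[OF that, of v] le[of "inverse c" "c *\<^sub>R v"] that by (simp add: field_simps)
  with add have "sublinear p"
    by (simp add: sublinear_def)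
  then obtain l where l: "linear l" "\<And>v. l v \<le> p v"
    using sublinear_dominates_linear by blast
  have "Q x + l v \<le> Q (x + v)" for v
    using l(2)[of v] lower[of 1 v] by (simp add: D_def)
  with l(1) show thesis by (rule that)
qed

section \<open>The Riesz representation theorem on a compact metric space\<close>

lemma bounded_continuous_compact_UNIV:
  fixes g :: "'a::metric_space \<Rightarrow> real"
  assumes "compact (UNIV :: 'a set)" "continuous_on UNIV g"
  obtains B where "B > 0" "\<And>x. \<bar>g x\<bar> \<le> B"
proof -
  have "bounded (range g)"
    by (intro compact_imp_bounded compact_continuous_image assms)
  then show thesis
    using that by (auto simp: bounded_pos)
qed

text \<open>
  The layer-cake decomposition: \<open>y\<close> is the sum of its parts in the horizontal layers \<open>[k, k + 1]\<close>.
  The next lemma says that the number of layers that \<open>y\<close> reaches exceeds \<open>y\<close> by at most 1.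
\<close>

lemma sum_clamp_layers:
  fixes y :: real
  assumes "0 \<le> y"
  shows "(\<Sum>k<n. max 0 (min 1 (y - real k))) = min y (real n)"
  using assms by (induction n) auto

lemma sum_indicator_layers:
  fixes y :: real
  assumes "0 \<le> y"
  shows "(\<Sum>k<n. if real k < y then 1 else 0 :: real) \<le> min (y + 1) (real n)"
  using assms by (induction n) auto

text \<open>
  A state on the continuous functions of a compact metric space. It is a map on all functions with laws
  for the continuous ones, so that it can be applied directly to lambda terms.
\<close>

locale positive_functional =
  fixes L :: "('a::metric_space \<Rightarrow> real) \<Rightarrow> real"
  assumes compact_space: "compact (UNIV :: 'a set)"
    and add: "\<And>g h. continuous_on UNIV g \<Longrightarrow> continuous_on UNIV h \<Longrightarrow>
      L (\<lambda>x. g x + h x) = L g + L h"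
    and scale: "\<And>c g. continuous_on UNIV g \<Longrightarrow> L (\<lambda>x. c * g x) = c * L g"
    and mono: "\<And>g h. continuous_on UNIV g \<Longrightarrow> continuous_on UNIV h \<Longrightarrow> (\<And>x. g x \<le> h x) \<Longrightarrow>
      L g \<le> L h"
    and one: "L (\<lambda>x. 1) = 1"
begin

lemma L_const: "L (\<lambda>x. c) = c"
  using scale[of "\<lambda>x. 1" c] one by simp

lemma L_nonneg: "continuous_on UNIV g \<Longrightarrow> (\<And>x. 0 \<le> g x) \<Longrightarrow> 0 \<le> L g"
  using mono[of "\<lambda>x. 0" g] L_const[of 0] by simp

lemma L_sum:
  assumes "finite I" "\<And>i. i \<in> I \<Longrightarrow> continuous_on UNIV (g i)"
  shows "L (\<lambda>x. \<Sum>i\<in>I. g i x) = (\<Sum>i\<in>I. L (g i))"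
  using assms
proof (induction I rule: finite_induct)
  case (insert i I)
  then have "L (\<lambda>x. g i x + (\<Sum>i\<in>I. g i x)) = L (g i) + L (\<lambda>x. \<Sum>i\<in>I. g i x)"
    by (intro add continuous_on_sum) auto
  with insert show ?case by simp
qed (simp add: L_const)

definition below :: "'a set \<Rightarrow> ('a \<Rightarrow> real) set" where
  "below U = {g. continuous_on UNIV g \<and> (\<forall>x. 0 \<le> g x \<and> g x \<le> indicator U x)}"

definition open_content :: "'a set \<Rightarrow> ennreal" where
  "open_content U = (SUP g\<in>below U. ennreal (L g))"

definition outer :: "'a set \<Rightarrow> ennreal" where
  "outer A = (INF U\<in>{U. open U \<and> A \<subseteq> U}. open_content U)"

lemma belowD:
  assumes "g \<in> below U"
  shows "continuous_on UNIV g" "0 \<le> g x" "g x \<le> 1" "x \<notin> U \<Longrightarrow> g x = 0"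
proof -
  have "0 \<le> g x" "g x \<le> indicator U x"
    using assms by (auto simp: below_def)
  then show "0 \<le> g x" "g x \<le> 1" "x \<notin> U \<Longrightarrow> g x = 0"
    by (cases "x \<in> U"; simp)+
qed (use assms in \<open>auto simp: below_def\<close>)

lemma belowI:
  assumes "continuous_on UNIV g" "\<And>x. 0 \<le> g x" "\<And>x. g x \<le> 1" "\<And>x. x \<notin> U \<Longrightarrow> g x = 0"
  shows "g \<in> below U"
  using assms by (auto simp: below_def indicator_def)

lemma zero_in_below: "(\<lambda>x. 0) \<in> below U"
  by (intro belowI) auto

lemma below_nonempty: "below U \<noteq> {}"
  using zero_in_below by blast

lemma content_upper: "g \<in> below U \<Longrightarrow> ennreal (L g) \<le> open_content U"
  unfolding open_content_def by (rule SUP_upper)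

lemma content_mono: "U \<subseteq> V \<Longrightarrow> open_content U \<le> open_content V"
  unfolding open_content_def by (intro SUP_subset_mono subsetI belowI) (auto dest: belowD)

lemma content_empty: "open_content {} = 0"
proof -
  have "L g = 0" if "g \<in> below {}" for g
  proof -
    have "g = (\<lambda>x. 0)" using belowD(4)[OF that] by auto
    then show ?thesis by (simp add: L_const)
  qed
  then show ?thesis
    unfolding open_content_def by (simp add: below_nonempty)
qed

lemma content_UNIV: "open_content UNIV = 1"
proof (rule antisym)
  show "open_content UNIV \<le> 1"
    unfolding open_content_def
  proof (rule SUP_least)
    fix g assume g: "g \<in> below UNIV"
    have "L g \<le> L (\<lambda>x. 1)"
      by (intro mono belowD[OF g]) auto
    then show "ennreal (L g) \<le> 1"
      by (simp add: one)
  qed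
  show "1 \<le> open_content UNIV"
    using content_upper[OF belowI, of "\<lambda>x. 1" UNIV] by (simp add: one)
qed

text \<open>
  Functions in \<open>below U\<close> need not have their support inside \<open>U\<close>. Subtracting \<open>e\<close> and truncating at 0
  costs at most \<open>e\<close> under \<open>L\<close> and moves the support into a compact subset of \<open>U\<close>.
\<close>

lemma shrink_support:
  assumes g: "g \<in> below U" and "e > 0"
  defines "h \<equiv> \<lambda>x. max 0 (g x - e)"
  shows "h \<in> below U" "L g \<le> L h + e" "compact {x. e \<le> g x}" "{x. e \<le> g x} \<subseteq> U"
proof -
  note cont = belowD(1)[OF g]
  have conth: "continuous_on UNIV h"
    unfolding h_def by (intro continuous_intros cont)
  have le: "0 \<le> g x \<and> g x \<le> 1 \<and> (x \<notin> U \<longrightarrow> g x = 0)" for x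
    using belowD(2-4)[OF g, of x] by auto
  show "h \<in> below U"
  proof (rule belowI[OF conth])
    fix x
    show "0 \<le> h x" "h x \<le> 1" "x \<notin> U \<Longrightarrow> h x = 0"
      using le[of x] \<open>e > 0\<close> by (auto simp: h_def)
  qed
  have "L g \<le> L (\<lambda>x. h x + e)"
    by (intro mono continuous_intros conth cont) (simp add: h_def)
  also have "\<dots> = L h + e"
    by (subst add) (auto simp: L_const conth)
  finally show "L g \<le> L h + e" .
  have "closed {x. e \<le> g x}"
    by (intro closed_Collect_le continuous_intros cont)
  then show "compact {x. e \<le> g x}"
    using closed_Int_compact[OF _ compact_space] by simp
  show "{x. e \<le> g x} \<subseteq> U"
    using le \<open>e > 0\<close> by force
qed

text \<open>
  A function supported in a compact subset of the union is split by a partition of unity, made of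
  distances to the complements, into finitely many functions below the individual \<open>U i\<close>.
\<close>

lemma content_UN_le:
  fixes U :: "nat \<Rightarrow> 'a set"
  assumes U: "\<And>i. open (U i)"
  shows "open_content (\<Union>i. U i) \<le> (\<Sum>i. open_content (U i))"
  unfolding open_content_def[of "\<Union>i. U i"]
proof (rule SUP_least)
  fix g assume g: "g \<in> below (\<Union>i. U i)"
  show "ennreal (L g) \<le> (\<Sum>i. open_content (U i))"
  proof (rule ennreal_le_epsilon)
    fix e :: real assume "e > 0"
    define K where "K = {x. e \<le> g x}"
    define h where "h = (\<lambda>x. max 0 (g x - e))"
    note shrink = shrink_support[OF g \<open>e > 0\<close>, folded K_def h_def]
    obtain I where I: "finite I" "K \<subseteq> (\<Union>i\<in>I. U i)"
      using compactE_image[OF shrink(3), of UNIV U] U shrink(4) by auto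
    \<comment> \<open>\<open>infdist x {}\<close> is 0 by convention, which is the wrong value for \<open>U i = UNIV\<close>.\<close>
    define d where "d i x = (if U i = UNIV then 1 else infdist x (- U i))" for i x
    have d_cont: "continuous_on UNIV (d i)" for i
      by (cases "U i = UNIV") (auto simp: d_def intro!: continuous_intros)
    have d_nonneg: "0 \<le> d i x" for i x
      by (auto simp: d_def infdist_nonneg)
    have d_zero: "d i x = 0 \<longleftrightarrow> x \<notin> U i" for i x
    proof (cases "U i = UNIV")
      case False
      then have "x \<in> - U i \<longleftrightarrow> infdist x (- U i) = 0"
        using U by (intro in_closed_iff_infdist_zero) auto
      with False show ?thesis by (simp add: d_def)
    qed (simp add: d_def)
    define D where "D x = (\<Sum>i\<in>I. d i x)" for x
    have D_cont: "continuous_on UNIV D"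
      unfolding D_def by (intro continuous_on_sum d_cont)
    have D_pos: "0 < D x" if xK: "x \<in> K" for x
    proof -
      obtain i where "i \<in> I" "x \<in> U i" using I xK by blast
      then show ?thesis
        unfolding D_def using d_zero[of i x] d_nonneg[of i x]
        by (intro sum_pos2[OF I(1), of i]) (auto simp: d_nonneg less_le)
    qed
    obtain \<delta> where \<delta>: "\<delta> > 0" "\<And>x. x \<in> K \<Longrightarrow> \<delta> \<le> D x"
    proof (cases "K = {}")
      case False
      obtain x where "x \<in> K" "\<And>y. y \<in> K \<Longrightarrow> D x \<le> D y"
        using continuous_attains_inf[OF shrink(3) False, of D] D_cont
          continuous_on_subset by blast
      with D_pos that show ?thesis by blast
    qed (use that[of 1] in auto)
    define p where "p i x = h x * (d i x / max (D x) \<delta>)" for i x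
    have p_cont: "continuous_on UNIV (p i)" for i
      unfolding p_def using \<delta>(1) belowD(1)[OF shrink(1)]
      by (intro continuous_intros D_cont d_cont) (auto simp: max_def)
    have d_le_D: "d i x \<le> D x" if "i \<in> I" for i x
      unfolding D_def by (rule member_le_sum) (use that d_nonneg I in auto)
    have p_below: "p i \<in> below (U i)" if "i \<in> I" for i
    proof (rule belowI[OF p_cont])
      fix x
      have "0 \<le> d i x / max (D x) \<delta>" "d i x / max (D x) \<delta> \<le> 1"
        using d_nonneg[of i x] d_le_D[OF that, of x] \<delta>(1) by (auto simp: divide_le_eq max_def)
      then show "0 \<le> p i x" "p i x \<le> 1"
        unfolding p_def using belowD(2,3)[OF shrink(1), of x]
        by (blast intro: mult_le_one mult_nonneg_nonneg)+
      show "p i x = 0" if "x \<notin> U i"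
        using d_zero[of i x] that by (simp add: p_def)
    qed
    have sum_p: "(\<Sum>i\<in>I. p i x) = h x" for x
    proof (cases "x \<in> K")
      case True
      then have "max (D x) \<delta> = D x" "D x > 0" using \<delta> D_pos by (auto simp: max_def dest: antisym)
      then show ?thesis
        unfolding p_def by (simp add: sum_distrib_left[symmetric] sum_divide_distrib[symmetric] D_def[symmetric])
    next
      case False
      then have "h x = 0" by (simp add: K_def h_def)
      then show ?thesis by (simp add: p_def)
    qed
    have "L h = (\<Sum>i\<in>I. L (p i))"
      using L_sum[OF I(1), of p] p_cont sum_p by simp
    with shrink(2) have "ennreal (L g) \<le> ennreal ((\<Sum>i\<in>I. L (p i)) + e)"
      by (simp add: ennreal_leI)
    also have "\<dots> = (\<Sum>i\<in>I. ennreal (L (p i))) + e"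
    proof -
      have "0 \<le> L (p i)" if "i \<in> I" for i
        by (intro L_nonneg p_cont belowD(2)[OF p_below[OF that]])
      then show ?thesis
        using \<open>e > 0\<close> by (subst ennreal_plus) (auto intro: sum_nonneg)
    qed
    also have "\<dots> \<le> (\<Sum>i\<in>I. open_content (U i)) + e"
      by (intro add_mono sum_mono content_upper p_below) auto
    also have "\<dots> \<le> (\<Sum>i. open_content (U i)) + e"
      by (intro add_mono sum_le_suminf I) auto
    finally show "ennreal (L g) \<le> (\<Sum>i. open_content (U i)) + e" .
  qed
qed

lemma outer_open: "open U \<Longrightarrow> outer U = open_content U"
  unfolding outer_def by (intro antisym INF_lower INF_greatest) (auto intro: content_mono)

lemma outer_le: "open U \<Longrightarrow> A \<subseteq> U \<Longrightarrow> outer A \<le> open_content U"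
  unfolding outer_def by (rule INF_lower) auto

lemma outer_mono: "A \<subseteq> B \<Longrightarrow> outer A \<le> outer B"
  unfolding outer_def by (rule INF_superset_mono) auto

text \<open>
  Countable subadditivity is inherited from open sets: each \<open>A n\<close> is covered by an open set whose content
  exceeds its outer measure by at most \<open>e / 2 ^ (n + 1)\<close>.
\<close>

lemma outer_measure_space_outer: "outer_measure_space (Pow UNIV) outer"
proof -
  have "countably_subadditive (Pow UNIV) outer"
    unfolding countably_subadditive_def
  proof safe
    fix A :: "nat \<Rightarrow> 'a set"
    show "outer (\<Union>i. A i) \<le> (\<Sum>i. outer (A i))"
    proof (rule ennreal_le_epsilon)
      fix e :: real assume e: "e > 0" "(\<Sum>i. outer (A i)) < top"
      then have "outer (A n) < outer (A n) + ennreal (e * (1/2)^Suc n)" for n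
        by (auto simp add: less_top dest!: ennreal_suminf_lessD)
      then have "\<exists>U. open U \<and> A n \<subseteq> U \<and> open_content U < outer (A n) + ennreal (e * (1/2)^Suc n)" for n
        unfolding outer_def INF_less_iff by auto
      then obtain U where U: "\<And>n. open (U n)" "\<And>n. A n \<subseteq> U n"
        "\<And>n. open_content (U n) < outer (A n) + ennreal (e * (1/2)^Suc n)"
        by metis
      have "outer (\<Union>i. A i) \<le> open_content (\<Union>i. U i)"
        using U by (intro outer_le) auto
      also have "\<dots> \<le> (\<Sum>i. open_content (U i))"
        by (rule content_UN_le[OF U(1)])
      also have "\<dots> \<le> (\<Sum>n. outer (A n) + ennreal (e * (1/2) ^ Suc n))"
        using U(3) by (intro suminf_le) (auto intro: less_imp_le)
      also have "\<dots> = (\<Sum>n. outer (A n)) + (\<Sum>n. ennreal e * ennreal ((1/2) ^ Suc n))"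
        using \<open>0 < e\<close> by (subst suminf_add[symmetric])
          (auto simp del: ennreal_suminf_cmult simp add: ennreal_mult[symmetric])
      also have "\<dots> = (\<Sum>n. outer (A n)) + e"
        unfolding ennreal_suminf_cmult
        by (subst suminf_ennreal_eq[OF zero_le_power power_half_series]) auto
      finally show "outer (\<Union>i. A i) \<le> (\<Sum>n. outer (A n)) + e" .
    qed
  qed
  moreover have "outer {} = 0"
    by (simp add: outer_open content_empty)
  ultimately show ?thesis
    by (auto simp: outer_measure_space_def positive_def increasing_def outer_mono)
qed

text \<open>
  Caratheodory's condition for the open set \<open>U\<close>, tested on an open set \<open>V\<close>: a function below \<open>V \<inter> U\<close>,
  shrunk into a compact set \<open>K\<close>, can be added to any function below \<open>V - K\<close> and remains below \<open>V\<close>.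
\<close>

lemma content_split:
  assumes "open U" "open V"
  shows "open_content (V \<inter> U) + outer (V - U) \<le> open_content V"
proof -
  have "ennreal (L g) + outer (V - U) \<le> open_content V" if g: "g \<in> below (V \<inter> U)" for g
  proof (rule ennreal_le_epsilon)
    fix e :: real assume e: "e > 0"
    define K where "K = {x. e \<le> g x}"
    define g' where "g' = (\<lambda>x. max 0 (g x - e))"
    note shrink = shrink_support[OF g e, folded K_def g'_def]
    have g'_zero: "g' x = 0" if "x \<notin> K" for x
      using that by (simp add: K_def g'_def)
    define W where "W = V - K"
    have "open W"
      unfolding W_def by (intro open_Diff assms compact_imp_closed shrink)
    then have "outer (V - U) \<le> open_content W"
      using shrink(4) by (intro outer_le) (auto simp: W_def)
    then have "ennreal (L g) + outer (V - U) \<le> ennreal (L g) + open_content W"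
      by (intro add_mono) auto
    also have "\<dots> = (SUP h\<in>below W. ennreal (L g) + ennreal (L h))"
      unfolding open_content_def by (rule ennreal_SUP_add_right[OF below_nonempty])
    also have "\<dots> \<le> open_content V + e"
    proof (rule SUP_least)
      fix h assume h: "h \<in> below W"
      have sum: "(\<lambda>x. g' x + h x) \<in> below V"
      proof (rule belowI)
        show "continuous_on UNIV (\<lambda>x. g' x + h x)"
          by (intro continuous_intros belowD(1)[OF h] belowD(1)[OF shrink(1)])
        fix x
        show "0 \<le> g' x + h x"
          using belowD(2)[OF h, of x] belowD(2)[OF shrink(1), of x] by simp
        show "g' x + h x \<le> 1"
          using belowD(3,4)[OF h, of x] belowD(3)[OF shrink(1), of x] g'_zero[of x]
          by (cases "x \<in> K") (auto simp: W_def)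
        show "g' x + h x = 0" if "x \<notin> V"
          using belowD(4)[OF h, of x] belowD(4)[OF shrink(1), of x] that by (simp add: W_def)
      qed
      have nonneg: "0 \<le> L g" "0 \<le> L h" "0 \<le> L g'"
        using belowD[OF g] belowD[OF h] belowD[OF shrink(1)] by (auto intro!: L_nonneg)
      have "L g + L h \<le> L (\<lambda>x. g' x + h x) + e"
        using shrink(2) add[OF belowD(1)[OF shrink(1)] belowD(1)[OF h]] by simp
      then have "ennreal (L g + L h) \<le> ennreal (L (\<lambda>x. g' x + h x) + e)"
        by (rule ennreal_leI)
      also have "\<dots> = ennreal (L (\<lambda>x. g' x + h x)) + ennreal e"
        using nonneg e add[OF belowD(1)[OF shrink(1)] belowD(1)[OF h]]
        by (intro ennreal_plus) auto
      also have "\<dots> \<le> open_content V + e"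
        by (intro add_mono content_upper sum) auto
      finally show "ennreal (L g) + ennreal (L h) \<le> open_content V + e"
        using nonneg by (simp add: ennreal_plus)
    qed
    finally show "ennreal (L g) + outer (V - U) \<le> open_content V + e" .
  qed
  then have "(SUP g\<in>below (V \<inter> U). ennreal (L g) + outer (V - U)) \<le> open_content V"
    by (rule SUP_least)
  then show ?thesis
    unfolding open_content_def[of "V \<inter> U"] by (subst ennreal_SUP_add_left[symmetric, OF below_nonempty])
qed

lemma open_in_lambda_system:
  assumes "open U"
  shows "U \<in> lambda_system UNIV (Pow UNIV) outer"
proof -
  interpret algebra "UNIV :: 'a set" "Pow UNIV" by (rule algebra_Pow)
  have oms: "countably_subadditive (Pow UNIV) outer" "positive (Pow UNIV) outer"
    using outer_measure_space_outer by (auto simp: outer_measure_space_def)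
  have "outer (A \<inter> U) + outer (A - U) = outer A" for A
  proof (rule antisym)
    show "outer (A \<inter> U) + outer (A - U) \<le> outer A"
      unfolding outer_def[of A]
    proof (rule INF_greatest, safe)
      fix V assume V: "open V" "A \<subseteq> V"
      have "outer (A \<inter> U) + outer (A - U) \<le> open_content (V \<inter> U) + outer (V - U)"
        using V assms by (intro add_mono outer_le outer_mono) auto
      also have "\<dots> \<le> open_content V"
        by (rule content_split[OF assms V(1)])
      finally show "outer (A \<inter> U) + outer (A - U) \<le> open_content V" .
    qed
    have "outer ((A \<inter> U) \<union> (A - U)) \<le> outer (A \<inter> U) + outer (A - U)"
      using countably_subadditive_subadditive[OF oms(2,1)]
      by (intro subadditiveD) auto
    moreover have "(A \<inter> U) \<union> (A - U) = A" by auto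
    ultimately show "outer A \<le> outer (A \<inter> U) + outer (A - U)" by simp
  qed
  then show ?thesis
    unfolding lambda_system_eq by blast
qed

lemma representing_measure:
  obtains M :: "'a measure" where "sets M = sets borel" "prob_space M"
    "\<And>U. open U \<Longrightarrow> emeasure M U = open_content U"
proof -
  interpret sigma_algebra "UNIV :: 'a set" "Pow UNIV" by (rule sigma_algebra_Pow)
  let ?\<Lambda> = "lambda_system UNIV (Pow UNIV) outer"
  have ms: "measure_space UNIV ?\<Lambda> outer"
    by (rule caratheodory_lemma[OF outer_measure_space_outer])
  then have "sigma_algebra UNIV ?\<Lambda>"
    unfolding measure_space_def by blast
  then have "sigma_sets UNIV {S. open S} \<subseteq> ?\<Lambda>"
    by (rule sigma_algebra.sigma_sets_subset) (use open_in_lambda_system in blast)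
  then have "sets (borel :: 'a measure) \<subseteq> ?\<Lambda>"
    unfolding borel_def by (subst sets_measure_of) auto
  moreover have sa: "sigma_algebra UNIV (sets (borel :: 'a measure))"
    using sets.sigma_algebra_axioms[of "borel :: 'a measure"] by simp
  ultimately have ms': "measure_space UNIV (sets (borel :: 'a measure)) outer"
    using measure_down[OF ms] by blast
  define M where "M = measure_of UNIV (sets (borel :: 'a measure)) outer"
  have sets_M: "sets M = sets borel"
    unfolding M_def using sets.sigma_sets_eq[of "borel :: 'a measure"] by simp
  have em: "emeasure M A = outer A" if "A \<in> sets borel" for A
    unfolding M_def using ms' that by (intro emeasure_measure_of_sigma[OF sa]) (auto simp: measure_space_def)
  have space_M: "space M = UNIV"
    using sets_eq_imp_space_eq[OF sets_M] by simp
  have "prob_space M"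
    by (rule prob_spaceI) (simp add: space_M em outer_open content_UNIV)
  with sets_M em show thesis
    by (intro that) (auto simp: outer_open)
qed

text \<open>
  The content of the superlevel sets of \<open>g\<close> dominates \<open>L\<close> on the layers of \<open>g\<close>, which gives
  \<open>L g \<le> \<integral> g\<close>; replacing \<open>g\<close> by \<open>- g\<close> turns the inequality into an equality.
\<close>

lemma riesz_representation:
  obtains M :: "'a measure" where "sets M = sets borel" "prob_space M"
    "\<And>g. continuous_on UNIV g \<Longrightarrow> (\<integral>x. g x \<partial>M) = L g"
proof -
  obtain M :: "'a measure" where sets_M: "sets M = sets borel" and "prob_space M"
    and M_open: "\<And>U. open U \<Longrightarrow> emeasure M U = open_content U"
    using representing_measure by blast
  interpret prob_space M by fact
  have meas: "g \<in> borel_measurable M" if "continuous_on UNIV g" for g :: "'a \<Rightarrow> real"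
    using borel_measurable_continuous_onI[OF that] sets_M measurable_cong_sets by blast
  have int: "integrable M g" if cont: "continuous_on UNIV g" for g :: "'a \<Rightarrow> real"
  proof -
    obtain B where "\<And>x. \<bar>g x\<bar> \<le> B"
      using bounded_continuous_compact_UNIV[OF compact_space cont] by metis
    then show ?thesis
      by (intro integrable_const_bound[of _ B] meas cont) auto
  qed
  have unit: "L g \<le> (\<integral>x. g x \<partial>M)"
    if cont: "continuous_on UNIV g" and g01: "\<And>x. 0 \<le> g x \<and> g x \<le> 1" for g
  proof (rule field_le_epsilon)
    fix e :: real assume "e > 0"
    obtain n where n: "n > 0" "1 / real n < e"
      using \<open>e > 0\<close> reals_Archimedean[of e] by (auto simp: inverse_eq_divide intro: that[of "Suc _"])
    define p where "p k x = max 0 (min 1 (real n * g x - real k))" for k x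
    define A where "A k = {x. real k < real n * g x}" for k
    have p_cont: "continuous_on UNIV (p k)" for k
      unfolding p_def by (intro continuous_intros cont)
    have A_open: "open (A k)" for k
      unfolding A_def by (intro open_Collect_less continuous_intros cont)
    have A_sets: "A k \<in> sets M" for k
      using A_open sets_M by auto
    have L_p: "L (p k) \<le> measure M (A k)" for k
    proof -
      have "p k \<in> below (A k)"
        by (rule belowI[OF p_cont]) (auto simp: p_def A_def)
      then have "ennreal (L (p k)) \<le> ennreal (measure M (A k))"
        using content_upper M_open[OF A_open, of k] by (simp add: emeasure_eq_measure)
      then show ?thesis by simp
    qed
    have "(\<Sum>k<n. p k x) = real n * g x" for x
      using sum_clamp_layers[of "real n * g x" n] g01[of x]
      by (simp add: p_def min_def mult_left_le)
    then have "real n * L g = (\<Sum>k<n. L (p k))"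
      using L_sum[of "{..<n}" p] p_cont scale[OF cont, of "real n"] by simp
    also have "\<dots> \<le> (\<Sum>k<n. measure M (A k))"
      by (intro sum_mono L_p)
    also have "\<dots> = (\<Sum>k<n. \<integral>x. indicator (A k) x \<partial>M)"
      using A_sets by simp
    also have "\<dots> = (\<integral>x. (\<Sum>k<n. indicator (A k) x) \<partial>M)"
      using A_sets by (intro Bochner_Integration.integral_sum[symmetric]) (auto simp: emeasure_eq_measure)
    also have "\<dots> \<le> (\<integral>x. real n * g x + 1 \<partial>M)"
    proof (rule integral_mono)
      show "(\<Sum>k<n. indicator (A k) x) \<le> real n * g x + 1" for x
        using sum_indicator_layers[of "real n * g x" n] g01[of x]
        by (simp add: A_def indicator_def of_bool_def)
    qed (use A_sets int[OF cont] in \<open>auto simp: emeasure_eq_measure\<close>)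
    also have "\<dots> = real n * (\<integral>x. g x \<partial>M) + 1"
      using int[OF cont] by (simp add: prob_space)
    finally have "L g \<le> (\<integral>x. g x \<partial>M) + 1 / real n"
      using n by (simp add: field_simps)
    with n show "L g \<le> (\<integral>x. g x \<partial>M) + e" by simp
  qed
  have le: "L g \<le> (\<integral>x. g x \<partial>M)" if cont: "continuous_on UNIV g" for g
  proof -
    obtain B where B: "B > 0" "\<And>x. \<bar>g x\<bar> \<le> B"
      using bounded_continuous_compact_UNIV[OF compact_space cont] by metis
    let ?h = "\<lambda>x. 1 / (2 * B) * g x + 1 / 2"
    have "0 \<le> ?h x \<and> ?h x \<le> 1" for x
      using B(1) abs_le_D1[OF B(2)[of x]] abs_le_D2[OF B(2)[of x]] by (simp add: field_simps)
    then have "L ?h \<le> (\<integral>x. ?h x \<partial>M)"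
      by (intro unit continuous_intros cont) auto
    moreover have "L ?h = 1 / (2 * B) * L g + 1 / 2"
    proof -
      have "L ?h = L (\<lambda>x. 1 / (2 * B) * g x) + L (\<lambda>x. 1 / 2)"
        by (intro add continuous_intros cont)
      then show ?thesis
        by (simp only: scale[OF cont] L_const)
    qed
    moreover have "(\<integral>x. ?h x \<partial>M) = 1 / (2 * B) * (\<integral>x. g x \<partial>M) + 1 / 2"
      using int[OF cont] by (simp add: prob_space)
    ultimately show ?thesis
      using B(1) by (simp add: field_simps)
  qed
  have "(\<integral>x. g x \<partial>M) = L g" if cont: "continuous_on UNIV g" for g
  proof (rule antisym)
    have "L (\<lambda>x. - g x) \<le> (\<integral>x. - g x \<partial>M)"
      by (intro le continuous_intros cont)
    with scale[OF cont, of "-1"] show "(\<integral>x. g x \<partial>M) \<le> L g" by simp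
  qed (rule le[OF cont])
  with sets_M \<open>prob_space M\<close> show thesis by (rule that)
qed

end

section \<open>Topological pressure as a functional of the potential\<close>

lemma le_dyn_dist_iff: "e \<le> dyn_dist f n x z \<longleftrightarrow> (\<exists>j\<le>n. e \<le> dist ((f ^^ j) x) ((f ^^ j) z))"
  unfolding dyn_dist_def by (subst Max_ge_iff) auto

lemma separated_empty: "separated f n e {}"
  and separated_singleton: "separated f n e {x}"
  by (auto simp: separated_def)

locale compact_system =
  fixes f :: "'a::metric_space \<Rightarrow> 'a"
  assumes compact_space: "compact (UNIV :: 'a set)"
    and cont_f: "continuous_on UNIV f"
begin

lemma cont_iterate: "continuous_on UNIV (f ^^ n)"
  by (induction n) (auto intro!: continuous_on_compose2[OF cont_f] simp: continuous_on_id)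

lemma cont_comp_iterate:
  assumes "continuous_on UNIV g" shows "continuous_on S (\<lambda>x. g ((f ^^ j) x))"
  using continuous_on_compose2[OF assms cont_iterate] continuous_on_subset by blast

lemma cont_birkhoff_sum:
  assumes "continuous_on UNIV \<psi>" shows "continuous_on UNIV (birkhoff_sum f \<psi> n)"
  unfolding birkhoff_sum_def by (intro continuous_on_sum cont_comp_iterate assms)

lemma bounded_cont:
  fixes g :: "'a \<Rightarrow> real"
  assumes "continuous_on UNIV g"
  obtains B where "B > 0" "\<And>x. \<bar>g x\<bar> \<le> B"
  using bounded_continuous_compact_UNIV[OF compact_space assms] by blast

text \<open>
  Two points of a separated set cannot lie in the same member of a finite cover by Bowen balls of
  half the radius. This is what makes the real-valued supremum in \<open>partition_sum\<close> meaningful.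
\<close>

lemma separated_card_bound:
  assumes "e > 0"
  obtains N where "\<And>E. separated f n e E \<Longrightarrow> finite E \<and> card E \<le> N"
proof -
  define B where "B x = (\<Inter>j\<in>{..n}. {z. dist ((f ^^ j) x) ((f ^^ j) z) < e / 2})" for x
  have opn: "open (B x)" for x
    unfolding B_def by (intro open_INT ballI open_Collect_less continuous_intros cont_iterate) auto
  have self: "x \<in> B x" for x
    using assms by (simp add: B_def)
  have cover: "UNIV \<subseteq> (\<Union>x\<in>UNIV. B x)"
    using self by auto
  obtain C where C: "finite C" "UNIV \<subseteq> (\<Union>x\<in>C. B x)"
    using compactE_image[OF compact_space opn cover] .
  then have "\<forall>x. \<exists>y. y \<in> C \<and> x \<in> B y"
    by auto
  then obtain c where c: "\<And>x. c x \<in> C" "\<And>x. x \<in> B (c x)"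
    by metis
  have "finite E \<and> card E \<le> card C" if E: "separated f n e E" for E
  proof -
    have "inj_on c E"
    proof (rule inj_onI, rule ccontr)
      fix x z assume xz: "x \<in> E" "z \<in> E" "c x = c z" "x \<noteq> z"
      then obtain j where j: "j \<le> n" "e \<le> dist ((f ^^ j) x) ((f ^^ j) z)"
        using E by (auto simp: separated_def le_dyn_dist_iff)
      have "dist ((f ^^ j) (c x)) ((f ^^ j) x) < e / 2" "dist ((f ^^ j) (c x)) ((f ^^ j) z) < e / 2"
        using c(2)[of x] c(2)[of z] j(1) xz(3) by (auto simp: B_def)
      with j(2) show False
        using dist_triangle_half_r by force
    qed
    then show ?thesis
      using C(1) c(1) by (metis card_inj_on_le image_subsetI inj_on_finite)
  qed
  then show thesis by (rule that)
qed

lemma separated_sum_bdd: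
  assumes "continuous_on UNIV \<psi>" "e > 0"
  shows "bdd_above ((\<lambda>E. \<Sum>x\<in>E. exp (birkhoff_sum f \<psi> n x)) ` {E. separated f n e E})"
proof -
  obtain B where B: "\<And>x. \<bar>birkhoff_sum f \<psi> n x\<bar> \<le> B"
    using bounded_cont[OF cont_birkhoff_sum[OF assms(1)]] by metis
  obtain N where N: "\<And>E. separated f n e E \<Longrightarrow> finite E \<and> card E \<le> N"
    using separated_card_bound[OF assms(2)] by metis
  show ?thesis
  proof (rule bdd_aboveI2, clarify)
    fix E assume "separated f n e E"
    then have "card E \<le> N" using N by blast
    have "(\<Sum>x\<in>E. exp (birkhoff_sum f \<psi> n x)) \<le> (\<Sum>x\<in>E. exp B)"
      using order_trans[OF abs_ge_self B] by (intro sum_mono) simp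
    also have "\<dots> \<le> real N * exp B"
      using \<open>card E \<le> N\<close> by simp
    finally show "(\<Sum>x\<in>E. exp (birkhoff_sum f \<psi> n x)) \<le> real N * exp B" .
  qed
qed

lemma partition_sum_upper:
  assumes "continuous_on UNIV \<psi>" "e > 0" "separated f n e E"
  shows "(\<Sum>x\<in>E. exp (birkhoff_sum f \<psi> n x)) \<le> partition_sum f \<psi> n e"
  unfolding partition_sum_def
  by (rule cSUP_upper) (use assms separated_sum_bdd in auto)

lemma partition_sum_least:
  assumes "\<And>E. separated f n e E \<Longrightarrow> (\<Sum>x\<in>E. exp (birkhoff_sum f \<psi> n x)) \<le> c"
  shows "partition_sum f \<psi> n e \<le> c"
  unfolding partition_sum_def
  by (rule cSUP_least) (auto intro: assms exI[of _ "{}"] separated_empty)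

lemma exp_le_partition_sum:
  assumes "continuous_on UNIV \<psi>" "e > 0"
  shows "exp (birkhoff_sum f \<psi> n x) \<le> partition_sum f \<psi> n e"
  using partition_sum_upper[OF assms separated_singleton[of f n e x]] by simp

lemma partition_sum_pos:
  assumes "continuous_on UNIV \<psi>" "e > 0"
  shows "0 < partition_sum f \<psi> n e"
  using exp_le_partition_sum[OF assms, of n undefined] exp_gt_zero less_le_trans by blast

lemma partition_sum_antimono:
  assumes "continuous_on UNIV \<psi>" "0 < e" "e \<le> e'"
  shows "partition_sum f \<psi> n e' \<le> partition_sum f \<psi> n e"
proof (rule partition_sum_least)
  fix E assume "separated f n e' E"
  with assms(3) have "separated f n e E"
    by (force simp: separated_def)
  then show "(\<Sum>x\<in>E. exp (birkhoff_sum f \<psi> n x)) \<le> partition_sum f \<psi> n e"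
    by (intro partition_sum_upper assms)
qed

text \<open>
  Partition sums grow as the scale \<open>e\<close> decreases, so the limit at \<open>0\<close> exists and is a supremum.
\<close>

lemma P_top_eq_SUP:
  assumes "continuous_on UNIV \<psi>"
  shows "P_top f \<psi> = (SUP e\<in>{0<..}. limsup (\<lambda>n. ereal (1 / real n * ln (partition_sum f \<psi> n e))))"
    (is "_ = (SUP e\<in>_. ?g e)")
proof -
  have anti: "?g e' \<le> ?g e" if "0 < e" "e \<le> e'" for e e'
    using that partition_sum_antimono[OF assms that] partition_sum_pos[OF assms]
    by (intro Limsup_mono always_eventually allI) (auto intro!: divide_right_mono)
  have "(?g \<longlongrightarrow> (SUP e\<in>{0<..}. ?g e)) (at_right 0)"
  proof (rule order_tendstoI)
    fix a assume "a < (SUP e\<in>{0<..}. ?g e)"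
    then obtain e where e: "e > 0" "a < ?g e"
      by (auto simp: less_SUP_iff)
    have "a < ?g e'" if "0 < e'" "e' < e" for e'
      using less_le_trans[OF e(2) anti[of e' e]] that by simp
    then show "\<forall>\<^sub>F x in at_right 0. a < ?g x"
      using e(1) unfolding eventually_at_right_field by blast
  next
    fix a assume "(SUP e\<in>{0<..}. ?g e) < a"
    then have "?g e < a" if "e > 0" for e
      using that by (intro le_less_trans[OF SUP_upper[of e "{0<..}" ?g]]) auto
    then show "\<forall>\<^sub>F x in at_right 0. ?g x < a"
      unfolding eventually_at_right_field using zero_less_one by blast
  qed
  then show ?thesis
    unfolding P_top_def by (intro tendsto_Lim) auto
qed

text \<open>
  Upper bounds for the pressure as eventual linear bounds on \<open>ln\<close> of the partition sums. An
  inequality between pressures becomes an inequality between partition sums in this way.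
\<close>

lemma P_top_le_iff:
  assumes "continuous_on UNIV \<psi>"
  shows "P_top f \<psi> \<le> ereal c \<longleftrightarrow>
    (\<forall>e>0. \<forall>d>0. \<forall>\<^sub>F n in sequentially. ln (partition_sum f \<psi> n e) \<le> real n * (c + d))"
proof -
  let ?l = "\<lambda>e n. ln (partition_sum f \<psi> n e)"
  have "limsup (\<lambda>n. ereal (1 / real n * ?l e n)) \<le> ereal c \<longleftrightarrow>
      (\<forall>d>0. \<forall>\<^sub>F n in sequentially. ?l e n \<le> real n * (c + d))" for e
  proof
    assume le: "limsup (\<lambda>n. ereal (1 / real n * ?l e n)) \<le> ereal c"
    show "\<forall>d>0. \<forall>\<^sub>F n in sequentially. ?l e n \<le> real n * (c + d)"
    proof (intro allI impI)
      fix d :: real assume "d > 0"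
      then have "\<forall>\<^sub>F n in sequentially. ereal (1 / real n * ?l e n) < ereal (c + d)"
        using le[unfolded Limsup_le_iff, rule_format, of "ereal (c + d)"] by simp
      then show "\<forall>\<^sub>F n in sequentially. ?l e n \<le> real n * (c + d)"
        using eventually_gt_at_top[of 0] by eventually_elim (simp add: field_simps)
    qed
  next
    assume ev: "\<forall>d>0. \<forall>\<^sub>F n in sequentially. ?l e n \<le> real n * (c + d)"
    show "limsup (\<lambda>n. ereal (1 / real n * ?l e n)) \<le> ereal c"
      unfolding Limsup_le_iff
    proof (intro allI impI)
      fix y assume "ereal c < y"
      then obtain r where r: "ereal c < ereal r" "ereal r < y"
        using ereal_dense2 by blast
      then have "\<forall>\<^sub>F n in sequentially. ?l e n \<le> real n * (c + (r - c))"
        using ev by (intro ev[rule_format]) auto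
      then show "\<forall>\<^sub>F n in sequentially. ereal (1 / real n * ?l e n) < y"
        using eventually_gt_at_top[of 0]
      proof eventually_elim
        case (elim n)
        then have "ereal (1 / real n * ?l e n) \<le> ereal r"
          by (simp add: field_simps)
        with r(2) show ?case by (rule le_less_trans[rotated])
      qed
    qed
  qed
  then show ?thesis
    unfolding P_top_eq_SUP[OF assms] SUP_le_iff by auto
qed

text \<open>
  The common source of monotonicity, translation equivariance, coboundary invariance and
  finiteness: an error \<open>a n\<close> in the Birkhoff sums moves the pressure by at most \<open>lim a n / n\<close>.
\<close>

lemma P_top_shift:
  assumes "continuous_on UNIV \<psi>" "continuous_on UNIV \<psi>'"
    and le: "\<And>n x. birkhoff_sum f \<psi>' n x \<le> birkhoff_sum f \<psi> n x + a n"
    and lim: "(\<lambda>n. a n / real n) \<longlonglongrightarrow> d"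
    and P: "P_top f \<psi> \<le> ereal c"
  shows "P_top f \<psi>' \<le> ereal (c + d)"
  unfolding P_top_le_iff[OF assms(2)]
proof (intro allI impI)
  fix e r :: real assume e: "e > 0" and r: "r > 0"
  have Z: "ln (partition_sum f \<psi>' n e) \<le> ln (partition_sum f \<psi> n e) + a n" for n
  proof -
    have "partition_sum f \<psi>' n e \<le> partition_sum f \<psi> n e * exp (a n)"
    proof (rule partition_sum_least)
      fix E assume E: "separated f n e E"
      have "(\<Sum>x\<in>E. exp (birkhoff_sum f \<psi>' n x)) \<le> (\<Sum>x\<in>E. exp (birkhoff_sum f \<psi> n x) * exp (a n))"
        using le by (intro sum_mono) (simp flip: exp_add)
      also have "\<dots> = (\<Sum>x\<in>E. exp (birkhoff_sum f \<psi> n x)) * exp (a n)"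
        by (simp add: sum_distrib_right)
      also have "\<dots> \<le> partition_sum f \<psi> n e * exp (a n)"
        by (intro mult_right_mono partition_sum_upper assms(1) e E) simp
      finally show "(\<Sum>x\<in>E. exp (birkhoff_sum f \<psi>' n x)) \<le> partition_sum f \<psi> n e * exp (a n)" .
    qed
    then have "ln (partition_sum f \<psi>' n e) \<le> ln (partition_sum f \<psi> n e * exp (a n))"
      using partition_sum_pos[OF assms(2) e] partition_sum_pos[OF assms(1) e] by (subst ln_le_cancel_iff) auto
    also have "\<dots> = ln (partition_sum f \<psi> n e) + a n"
      using partition_sum_pos[OF assms(1) e, of n] by (simp add: ln_mult_pos)
    finally show ?thesis .
  qed
  have "\<forall>\<^sub>F n in sequentially. ln (partition_sum f \<psi> n e) \<le> real n * (c + r / 2)"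
    using P e r unfolding P_top_le_iff[OF assms(1)] by simp
  moreover have "\<forall>\<^sub>F n in sequentially. a n / real n < d + r / 2"
    using order_tendstoD(2)[OF lim, of "d + r / 2"] r by simp
  ultimately show "\<forall>\<^sub>F n in sequentially. ln (partition_sum f \<psi>' n e) \<le> real n * (c + d + r)"
    using eventually_gt_at_top[of 0]
  proof eventually_elim
    case (elim n)
    then have "a n \<le> real n * (d + r / 2)"
      by (simp add: field_simps)
    with elim(1) Z[of n] show ?case
      by (simp add: algebra_simps)
  qed
qed

lemma P_top_mono:
  assumes "continuous_on UNIV \<psi>" "continuous_on UNIV \<psi>'" "\<And>x. \<psi>' x \<le> \<psi> x"
    and "P_top f \<psi> \<le> ereal c"
  shows "P_top f \<psi>' \<le> ereal c"
  using P_top_shift[OF assms(1,2), of "\<lambda>n. 0" 0 c] assms(3,4)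
  by (simp add: birkhoff_sum_def sum_mono)

lemma P_top_add_const:
  assumes "continuous_on UNIV \<psi>" "P_top f \<psi> \<le> ereal c"
  shows "P_top f (\<lambda>x. \<psi> x + d) \<le> ereal (c + d)"
proof (rule P_top_shift[OF assms(1) _ _ _ assms(2), where a = "\<lambda>n. real (n + 1) * d"])
  show "continuous_on UNIV (\<lambda>x. \<psi> x + d)"
    by (intro continuous_intros assms)
  show "birkhoff_sum f (\<lambda>x. \<psi> x + d) n x \<le> birkhoff_sum f \<psi> n x + real (n + 1) * d" for n x
    by (simp add: birkhoff_sum_def sum.distrib algebra_simps)
  have "(\<lambda>n. d + d / real n) \<longlonglongrightarrow> d + 0"
    by (intro tendsto_intros lim_const_over_n)
  moreover have "\<forall>\<^sub>F n in sequentially. d + d / real n = real (n + 1) * d / real n"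
    using eventually_gt_at_top[of "0::nat"] by eventually_elim (simp add: field_simps)
  ultimately show "(\<lambda>n. real (n + 1) * d / real n) \<longlonglongrightarrow> d"
    using Lim_transform_eventually by fastforce
qed

lemma P_top_coboundary:
  assumes "continuous_on UNIV \<psi>" "continuous_on UNIV \<eta>" "P_top f \<psi> \<le> ereal c"
  shows "P_top f (\<lambda>x. \<psi> x + (\<eta> (f x) - \<eta> x)) \<le> ereal c"
proof -
  obtain B where B: "\<And>x. \<bar>\<eta> x\<bar> \<le> B"
    using bounded_cont[OF assms(2)] by metis
  have telescope: "(\<Sum>j\<in>{0..n}. \<eta> (f ((f ^^ j) x)) - \<eta> ((f ^^ j) x)) = \<eta> ((f ^^ Suc n) x) - \<eta> x" for n x
    by (induction n) auto
  have "P_top f (\<lambda>x. \<psi> x + (\<eta> (f x) - \<eta> x)) \<le> ereal (c + 0)"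
  proof (rule P_top_shift[OF assms(1) _ _ lim_const_over_n assms(3)])
    show "continuous_on UNIV (\<lambda>x. \<psi> x + (\<eta> (f x) - \<eta> x))"
      using cont_comp_iterate[OF assms(2), of UNIV 1] by (auto intro!: continuous_intros assms)
    fix n x
    have "birkhoff_sum f (\<lambda>x. \<psi> x + (\<eta> (f x) - \<eta> x)) n x
        = birkhoff_sum f \<psi> n x + (\<eta> ((f ^^ Suc n) x) - \<eta> x)"
      unfolding birkhoff_sum_def sum.distrib telescope ..
    also have "\<dots> \<le> birkhoff_sum f \<psi> n x + 2 * B"
      using B[of "(f ^^ Suc n) x"] B[of x] by linarith
    finally show "birkhoff_sum f (\<lambda>x. \<psi> x + (\<eta> (f x) - \<eta> x)) n x \<le> birkhoff_sum f \<psi> n x + 2 * B" .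
  qed
  then show ?thesis by simp
qed

text \<open>
  Hoelder's inequality for partition sums, obtained by normalising both sums to 1 and applying
  convexity of the exponential termwise.
\<close>

lemma ln_partition_sum_convex:
  assumes "continuous_on UNIV \<psi>" "continuous_on UNIV \<psi>'" "e > 0"
    and u: "0 \<le> u" "u \<le> 1"
  shows "ln (partition_sum f (\<lambda>x. u * \<psi> x + (1 - u) * \<psi>' x) n e)
    \<le> u * ln (partition_sum f \<psi> n e) + (1 - u) * ln (partition_sum f \<psi>' n e)"
proof -
  let ?\<rho> = "\<lambda>x. u * \<psi> x + (1 - u) * \<psi>' x"
  define Z Z' where "Z = partition_sum f \<psi> n e" "Z' = partition_sum f \<psi>' n e"
  have pos: "Z > 0" "Z' > 0"
    unfolding Z_Z'_def using assms by (auto intro: partition_sum_pos)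
  have cont: "continuous_on UNIV ?\<rho>"
    by (intro continuous_intros assms)
  define c where "c = u * ln Z + (1 - u) * ln Z'"
  have "partition_sum f ?\<rho> n e \<le> exp c"
  proof (rule partition_sum_least)
    fix E assume E: "separated f n e E"
    have "exp (birkhoff_sum f ?\<rho> n x) \<le>
        exp c * (u * (exp (birkhoff_sum f \<psi> n x) / Z) + (1 - u) * (exp (birkhoff_sum f \<psi>' n x) / Z'))" for x
    proof -
      let ?s = "birkhoff_sum f \<psi> n x - ln Z" and ?s' = "birkhoff_sum f \<psi>' n x - ln Z'"
      have "birkhoff_sum f ?\<rho> n x = u * birkhoff_sum f \<psi> n x + (1 - u) * birkhoff_sum f \<psi>' n x"
        by (simp add: birkhoff_sum_def sum.distrib sum_distrib_left)
      then have "birkhoff_sum f ?\<rho> n x = c + (u * ?s + (1 - u) * ?s')"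
        by (simp add: c_def algebra_simps)
      then have "exp (birkhoff_sum f ?\<rho> n x) = exp c * exp (u * ?s + (1 - u) * ?s')"
        by (simp only: exp_add)
      also have "exp (u * ?s + (1 - u) * ?s') \<le> u * exp ?s + (1 - u) * exp ?s'"
        using convex_onD[OF convex_on_exp[of 1, simplified], of "1 - u" ?s ?s'] u by simp
      finally show ?thesis
        using pos by (simp add: exp_diff)
    qed
    then have "(\<Sum>x\<in>E. exp (birkhoff_sum f ?\<rho> n x)) \<le> (\<Sum>x\<in>E. exp c *
        (u * (exp (birkhoff_sum f \<psi> n x) / Z) + (1 - u) * (exp (birkhoff_sum f \<psi>' n x) / Z')))"
      by (intro sum_mono)
    also have "\<dots> = exp c * (u * ((\<Sum>x\<in>E. exp (birkhoff_sum f \<psi> n x)) / Z)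
        + (1 - u) * ((\<Sum>x\<in>E. exp (birkhoff_sum f \<psi>' n x)) / Z'))"
      by (simp only: sum_distrib_left[symmetric] sum.distrib sum_divide_distrib[symmetric])
    also have "\<dots> \<le> exp c * (u * 1 + (1 - u) * 1)"
    proof -
      have "(\<Sum>x\<in>E. exp (birkhoff_sum f \<psi> n x)) / Z \<le> 1" "(\<Sum>x\<in>E. exp (birkhoff_sum f \<psi>' n x)) / Z' \<le> 1"
        using pos partition_sum_upper[OF assms(1,3) E] partition_sum_upper[OF assms(2,3) E]
        by (auto simp: Z_Z'_def)
      with u show ?thesis
        by (intro mult_left_mono add_mono) auto
    qed
    finally show "(\<Sum>x\<in>E. exp (birkhoff_sum f ?\<rho> n x)) \<le> exp c" by simp
  qed
  then have "ln (partition_sum f ?\<rho> n e) \<le> c"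
    using partition_sum_pos[OF cont \<open>e > 0\<close>, of n] by (metis exp_le_cancel_iff exp_ln)
  then show ?thesis
    by (simp add: c_def Z_Z'_def)
qed

lemma P_top_convex:
  assumes "continuous_on UNIV \<psi>" "continuous_on UNIV \<psi>'"
    and u: "0 \<le> u" "u \<le> 1"
    and P: "P_top f \<psi> \<le> ereal c" "P_top f \<psi>' \<le> ereal c'"
  shows "P_top f (\<lambda>x. u * \<psi> x + (1 - u) * \<psi>' x) \<le> ereal (u * c + (1 - u) * c')"
proof -
  let ?\<rho> = "\<lambda>x. u * \<psi> x + (1 - u) * \<psi>' x"
  have cont: "continuous_on UNIV ?\<rho>"
    by (intro continuous_intros assms)
  show ?thesis
    unfolding P_top_le_iff[OF cont]
  proof (intro allI impI)
    fix e r :: real assume e: "e > 0" and r: "r > 0"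
    have "\<forall>\<^sub>F n in sequentially. ln (partition_sum f \<psi> n e) \<le> real n * (c + r)"
      "\<forall>\<^sub>F n in sequentially. ln (partition_sum f \<psi>' n e) \<le> real n * (c' + r)"
      using P e r unfolding P_top_le_iff[OF assms(1)] P_top_le_iff[OF assms(2)] by auto
    then show "\<forall>\<^sub>F n in sequentially. ln (partition_sum f ?\<rho> n e) \<le> real n * (u * c + (1 - u) * c' + r)"
    proof eventually_elim
      case (elim n)
      have "ln (partition_sum f ?\<rho> n e)
          \<le> u * ln (partition_sum f \<psi> n e) + (1 - u) * ln (partition_sum f \<psi>' n e)"
        by (intro ln_partition_sum_convex assms e)
      also have "\<dots> \<le> u * (real n * (c + r)) + (1 - u) * (real n * (c' + r))"
        using u elim by (intro add_mono mult_left_mono) auto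
      also have "\<dots> = real n * (u * c + (1 - u) * c' + r)"
        by (simp add: algebra_simps)
      finally show ?case .
    qed
  qed
qed

lemma h_top_nonneg: "0 \<le> h_top f"
proof -
  have "1 \<le> partition_sum f (\<lambda>x. 0) n 1" for n
    using exp_le_partition_sum[of "\<lambda>x. 0" 1 n undefined] by (simp add: birkhoff_sum_def)
  then have "0 \<le> limsup (\<lambda>n. ereal (1 / real n * ln (partition_sum f (\<lambda>x. 0) n 1)))"
    by (intro le_Limsup always_eventually) (auto simp: ln_ge_zero)
  also have "\<dots> \<le> h_top f"
    unfolding h_top_def P_top_eq_SUP[OF continuous_on_const] by (rule SUP_upper) simp
  finally show ?thesis .
qed

text \<open>
  The pressures of \<open>\<psi>\<close> and of \<open>0\<close> differ by at most a bound for \<open>\<psi>\<close>, and \<open>h_top f\<close> is neither negative nor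
  infinite.
\<close>

lemma P_top_finite:
  assumes "h_top f < \<infinity>" "continuous_on UNIV \<psi>"
  shows "\<bar>P_top f \<psi>\<bar> \<noteq> \<infinity>"
proof -
  obtain B where B: "\<And>x. \<bar>\<psi> x\<bar> \<le> B"
    using bounded_cont[OF assms(2)] by metis
  obtain H where H: "h_top f = ereal H"
    using assms(1) h_top_nonneg by (cases "h_top f") auto
  have "P_top f (\<lambda>x. 0 + B) \<le> ereal (H + B)"
    by (rule P_top_add_const) (use H in \<open>simp_all add: h_top_def\<close>)
  then have "P_top f \<psi> \<le> ereal (H + B)"
    using order_trans[OF abs_ge_self B] by (intro P_top_mono[OF _ assms(2), of "\<lambda>x. 0 + B"]) simp_all
  moreover have "P_top f \<psi> \<noteq> - \<infinity>"
  proof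
    assume "P_top f \<psi> = - \<infinity>"
    then have "P_top f (\<lambda>x. \<psi> x + B) \<le> ereal (- B - 1 + B)"
      by (intro P_top_add_const[OF assms(2)]) simp
    moreover have "0 \<le> \<psi> x + B" for x
      using B[of x] by linarith
    ultimately have "P_top f (\<lambda>x. 0) \<le> ereal (- 1)"
      by (intro P_top_mono[of "\<lambda>x. \<psi> x + B" "\<lambda>x. 0"] continuous_intros assms(2)) simp_all
    then have "(0::ereal) \<le> ereal (- 1)"
      using h_top_nonneg unfolding h_top_def by (rule order_trans[rotated])
    then show False by simp
  qed
  ultimately show ?thesis by auto
qed

end

section \<open>Entropy of observations with finitely many values\<close>

definition fiber :: "'a measure \<Rightarrow> ('a \<Rightarrow> 'b) \<Rightarrow> 'b \<Rightarrow> 'a set" where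
  "fiber M X v = X -` {v} \<inter> space M"

text \<open>
  The Shannon entropy of the partition of the space into the fibers of \<open>X\<close>, written as the integral
  of the information function, so that entropies can be compared pointwise.
\<close>

definition observation_entropy :: "'a measure \<Rightarrow> ('a \<Rightarrow> 'b) \<Rightarrow> real" where
  "observation_entropy M X = (\<integral>x. - ln (measure M (fiber M X (X x))) \<partial>M)"

lemma fiber_sets: "simple_function M X \<Longrightarrow> fiber M X v \<in> sets M"
  unfolding fiber_def by (rule simple_functionD)

lemma fiber_const: "v \<in> space M \<Longrightarrow> v \<in> fiber M X (X v)"
  by (simp add: fiber_def)

lemma simple_function_fiberwise:
  assumes "simple_function M X'" "\<And>x y. x \<in> space M \<Longrightarrow> y \<in> space M \<Longrightarrow> X' x = X' y \<Longrightarrow> X x = X y"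
  shows "simple_function M X"
proof -
  define h where "h v = X (SOME x. x \<in> space M \<and> X' x = v)" for v
  have "X x = (h \<circ> X') x" if "x \<in> space M" for x
  proof -
    have "\<exists>y. y \<in> space M \<and> X' y = X' x" using that by blast
    then have "(SOME y. y \<in> space M \<and> X' y = X' x) \<in> space M \<and> X' (SOME y. y \<in> space M \<and> X' y = X' x) = X' x"
      by (rule someI_ex)
    then show ?thesis
      using assms(2)[OF _ that] unfolding h_def comp_def by metis
  qed
  moreover have "simple_function M (h \<circ> X')"
    by (rule simple_function_compose[OF assms(1)])
  ultimately show ?thesis
    using simple_function_cong[of M X "h \<circ> X'"] by blast
qed

context prob_space
begin

lemma simple_function_integral:
  fixes g :: "'b \<Rightarrow> real"
  assumes X: "simple_function M X"
  shows "integrable M (\<lambda>x. g (X x))"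
    and "(\<integral>x. g (X x) \<partial>M) = (\<Sum>v\<in>X ` space M. g v * prob (fiber M X v))"
proof -
  have fin: "finite (X ` space M)" using simple_functionD(1)[OF X] .
  have eq: "g (X x) = (\<Sum>v\<in>X ` space M. g v * indicator (fiber M X v) x)" if "x \<in> space M" for x
  proof -
    have "(\<Sum>v\<in>X ` space M. g v * indicator (fiber M X v) x) = (\<Sum>v\<in>X ` space M. if v = X x then g v else 0)"
      using that by (intro sum.cong) (auto simp: fiber_def indicator_def)
    also have "\<dots> = g (X x)"
      using that fin by (simp add: sum.delta)
    finally show ?thesis by simp
  qed
  have int: "integrable M (\<lambda>x. g v * indicator (fiber M X v) x)" for v
    by (intro integrable_mult_right integrable_real_indicator fiber_sets X) (simp add: emeasure_eq_measure)
  have "integrable M (\<lambda>x. \<Sum>v\<in>X ` space M. g v * indicator (fiber M X v) x)"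
    by (intro Bochner_Integration.integrable_sum int)
  then show "integrable M (\<lambda>x. g (X x))"
    using Bochner_Integration.integrable_cong[of M M "\<lambda>x. g (X x)"] eq by simp
  have "(\<integral>x. g (X x) \<partial>M) = (\<integral>x. (\<Sum>v\<in>X ` space M. g v * indicator (fiber M X v) x) \<partial>M)"
    using eq by (intro Bochner_Integration.integral_cong) auto
  also have "\<dots> = (\<Sum>v\<in>X ` space M. \<integral>x. g v * indicator (fiber M X v) x \<partial>M)"
    by (intro Bochner_Integration.integral_sum int)
  also have "\<dots> = (\<Sum>v\<in>X ` space M. g v * prob (fiber M X v))"
    using fiber_sets[OF X] by simp
  finally show "(\<integral>x. g (X x) \<partial>M) = (\<Sum>v\<in>X ` space M. g v * prob (fiber M X v))" .
qed

lemma sum_fiber_prob: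
  assumes "simple_function M X" shows "(\<Sum>v\<in>X ` space M. prob (fiber M X v)) = 1"
  using simple_function_integral(2)[OF assms, of "\<lambda>_. 1"] by (simp add: prob_space)

lemma AE_fiber_pos:
  assumes X: "simple_function M X"
  shows "AE x in M. 0 < prob (fiber M X (X x))"
proof -
  let ?N = "\<Union>v\<in>{v\<in>X ` space M. prob (fiber M X v) = 0}. fiber M X v"
  have "?N \<in> null_sets M"
    using simple_functionD(1)[OF X] fiber_sets[OF X]
    by (intro null_sets_UN' countable_finite) (auto simp: null_sets_def emeasure_eq_measure)
  then show ?thesis
  proof (rule AE_I', safe)
    fix x assume "x \<in> space M" "\<not> 0 < prob (fiber M X (X x))"
    then show "x \<in> ?N"
      by (auto simp: zero_less_measure_iff measure_le_0_iff fiber_const)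
  qed
qed

text \<open>
  A finer observation has smaller fibers, hence pointwise larger information.
\<close>

lemma observation_entropy_mono:
  assumes X': "simple_function M X'"
    and fine: "\<And>x y. x \<in> space M \<Longrightarrow> y \<in> space M \<Longrightarrow> X' x = X' y \<Longrightarrow> X x = X y"
  shows "observation_entropy M X \<le> observation_entropy M X'"
  unfolding observation_entropy_def
proof (rule integral_mono_AE)
  have X: "simple_function M X"
    by (rule simple_function_fiberwise[OF X' fine])
  show "integrable M (\<lambda>x. - ln (prob (fiber M X (X x))))"
    by (rule simple_function_integral(1)[OF X, of "\<lambda>v. - ln (prob (fiber M X v))"])
  show "integrable M (\<lambda>x. - ln (prob (fiber M X' (X' x))))"
    by (rule simple_function_integral(1)[OF X', of "\<lambda>v. - ln (prob (fiber M X' v))"])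
  show "AE x in M. - ln (prob (fiber M X (X x))) \<le> - ln (prob (fiber M X' (X' x)))"
    using AE_fiber_pos[OF X']
  proof (rule AE_mp, intro AE_I2 impI)
    fix x assume x: "x \<in> space M" "0 < prob (fiber M X' (X' x))"
    have "prob (fiber M X' (X' x)) \<le> prob (fiber M X (X x))"
      using fine[OF _ x(1)] by (intro finite_measure_mono fiber_sets X) (auto simp: fiber_def)
    with x(2) show "- ln (prob (fiber M X (X x))) \<le> - ln (prob (fiber M X' (X' x)))"
      by simp
  qed
qed

lemma observation_entropy_nonneg: "0 \<le> observation_entropy M X"
  unfolding observation_entropy_def
proof (rule Bochner_Integration.integral_nonneg)
  fix x
  show "0 \<le> - ln (prob (fiber M X (X x)))"
  proof (cases "prob (fiber M X (X x)) = 0")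
    case False
    then have "0 < prob (fiber M X (X x))"
      by (simp add: zero_less_measure_iff)
    then show ?thesis
      using prob_le_1 by (simp add: ln_le_zero_iff)
  qed simp
qed

text \<open>
  Relative entropy is nonnegative, by \<open>ln z \<le> z - 1\<close>. All entropy estimates in the sequel come
  from this lemma by a suitable choice of the weights \<open>q\<close>.
\<close>

lemma gibbs_inequality:
  assumes X: "simple_function M X"
    and q: "\<And>v. v \<in> X ` space M \<Longrightarrow> 0 \<le> q v"
    and pos: "\<And>v. v \<in> X ` space M \<Longrightarrow> 0 < prob (fiber M X v) \<Longrightarrow> 0 < q v"
    and sum: "(\<Sum>v\<in>X ` space M. q v) \<le> 1"
  shows "observation_entropy M X \<le> (\<integral>x. - ln (q (X x)) \<partial>M)"
proof -
  let ?p = "\<lambda>v. prob (fiber M X v)"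
  note int = simple_function_integral[OF X]
  have "observation_entropy M X \<le> (\<integral>x. - ln (q (X x)) + (q (X x) / ?p (X x) - 1) \<partial>M)"
    unfolding observation_entropy_def
  proof (rule integral_mono_AE)
    show "integrable M (\<lambda>x. - ln (?p (X x)))"
      by (rule int(1)[of "\<lambda>v. - ln (?p v)"])
    show "integrable M (\<lambda>x. - ln (q (X x)) + (q (X x) / ?p (X x) - 1))"
      by (rule int(1)[of "\<lambda>v. - ln (q v) + (q v / ?p v - 1)"])
    show "AE x in M. - ln (?p (X x)) \<le> - ln (q (X x)) + (q (X x) / ?p (X x) - 1)"
      using AE_fiber_pos[OF X]
    proof (rule AE_mp, intro AE_I2 impI)
      fix x assume x: "x \<in> space M" "0 < ?p (X x)"
      then have qx: "0 < q (X x)" using pos by blast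
      have "ln (q (X x) / ?p (X x)) \<le> q (X x) / ?p (X x) - 1"
        using x qx by (intro ln_le_minus_one) simp
      then show "- ln (?p (X x)) \<le> - ln (q (X x)) + (q (X x) / ?p (X x) - 1)"
        using x qx by (simp add: ln_div)
    qed
  qed
  also have "\<dots> = (\<integral>x. - ln (q (X x)) \<partial>M) + (\<integral>x. q (X x) / ?p (X x) - 1 \<partial>M)"
    by (rule Bochner_Integration.integral_add[OF int(1)[of "\<lambda>v. - ln (q v)"] int(1)[of "\<lambda>v. q v / ?p v - 1"]])
  also have "(\<integral>x. q (X x) / ?p (X x) - 1 \<partial>M) = (\<integral>x. q (X x) / ?p (X x) \<partial>M) - 1"
    using int(1)[of "\<lambda>v. q v / ?p v"] by (simp add: prob_space)
  also have "(\<integral>x. q (X x) / ?p (X x) \<partial>M) = (\<Sum>v\<in>X ` space M. q v / ?p v * ?p v)"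
    by (rule int(2)[of "\<lambda>v. q v / ?p v"])
  also have "\<dots> \<le> (\<Sum>v\<in>X ` space M. q v)"
    using q by (intro sum_mono) auto
  finally show ?thesis using sum by simp
qed

text \<open>
  The Gibbs inequality for the product of the two marginal distributions.
\<close>

lemma observation_entropy_Pair:
  assumes X: "simple_function M X" and Y: "simple_function M Y"
  shows "observation_entropy M (\<lambda>x. (X x, Y x)) \<le> observation_entropy M X + observation_entropy M Y"
proof -
  let ?p = "\<lambda>v. prob (fiber M X v)" and ?r = "\<lambda>v. prob (fiber M Y v)"
  let ?XY = "\<lambda>x. (X x, Y x)"
  have XY: "simple_function M ?XY"
    by (rule simple_function_Pair[OF X Y])
  have le: "prob (fiber M ?XY (v, w)) \<le> ?p v" "prob (fiber M ?XY (v, w)) \<le> ?r w" for v w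
    by (intro finite_measure_mono fiber_sets X Y; auto simp: fiber_def)+
  have "observation_entropy M ?XY \<le> (\<integral>x. - ln ((\<lambda>(v, w). ?p v * ?r w) (?XY x)) \<partial>M)"
  proof (rule gibbs_inequality[OF XY])
    show "0 < (\<lambda>(v, w). ?p v * ?r w) u" if "0 < prob (fiber M ?XY u)" for u
      using le[of "fst u" "snd u"] that by (cases u) (auto intro!: mult_pos_pos dest: less_le_trans)
    have "(\<Sum>u\<in>?XY ` space M. (\<lambda>(v, w). ?p v * ?r w) u)
        \<le> (\<Sum>u\<in>(X ` space M) \<times> (Y ` space M). (\<lambda>(v, w). ?p v * ?r w) u)"
      using simple_functionD(1)[OF X] simple_functionD(1)[OF Y] by (intro sum_mono2) auto
    also have "\<dots> = (\<Sum>v\<in>X ` space M. ?p v) * (\<Sum>w\<in>Y ` space M. ?r w)"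
      by (simp add: sum_product sum.cartesian_product)
    also have "\<dots> = 1"
      by (simp add: sum_fiber_prob X Y)
    finally show "(\<Sum>u\<in>?XY ` space M. (\<lambda>(v, w). ?p v * ?r w) u) \<le> 1" .
  qed auto
  also have "\<dots> = (\<integral>x. - ln (?p (X x)) + - ln (?r (Y x)) \<partial>M)"
  proof (rule integral_cong_AE)
    show "AE x in M. - ln ((\<lambda>(v, w). ?p v * ?r w) (?XY x)) = - ln (?p (X x)) + - ln (?r (Y x))"
      using AE_fiber_pos[OF X] AE_fiber_pos[OF Y] by eventually_elim (simp add: ln_mult)
    show "(\<lambda>x. - ln ((\<lambda>(v, w). ?p v * ?r w) (?XY x))) \<in> borel_measurable M"
      by (rule borel_measurable_integrable[OF simple_function_integral(1)[OF XY, of "\<lambda>u. - ln ((\<lambda>(v, w). ?p v * ?r w) u)"]])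
    show "(\<lambda>x. - ln (?p (X x)) + - ln (?r (Y x))) \<in> borel_measurable M"
      using borel_measurable_integrable[OF simple_function_integral(1)[OF XY,
          of "\<lambda>u. - ln (?p (fst u)) + - ln (?r (snd u))"]] by simp
  qed
  also have "\<dots> = observation_entropy M X + observation_entropy M Y"
    unfolding observation_entropy_def
    by (rule Bochner_Integration.integral_add[OF simple_function_integral(1)[OF X, of "\<lambda>v. - ln (?p v)"]
          simple_function_integral(1)[OF Y, of "\<lambda>v. - ln (?r v)"]])
  finally show ?thesis .
qed

lemma observation_entropy_invariant:
  assumes X: "simple_function M X" and T: "T \<in> measurable M M" "distr M M T = M"
  shows "simple_function M (\<lambda>x. X (T x))"
    and "observation_entropy M (\<lambda>x. X (T x)) = observation_entropy M X"
proof -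
  have fib: "fiber M (\<lambda>x. X (T x)) v = T -` fiber M X v \<inter> space M" for v
    using measurable_space[OF T(1)] by (auto simp: fiber_def)
  have sub: "(\<lambda>x. X (T x)) ` space M \<subseteq> X ` space M"
    using measurable_space[OF T(1)] by auto
  show "simple_function M (\<lambda>x. X (T x))"
    unfolding simple_function_def
  proof (intro conjI ballI)
    show "finite ((\<lambda>x. X (T x)) ` space M)"
      using finite_subset[OF sub] simple_functionD(1)[OF X] by blast
    show "(\<lambda>x. X (T x)) -` {v} \<inter> space M \<in> sets M" for v
      using measurable_sets[OF T(1) fiber_sets[OF X]] fib[of v] by (simp add: fiber_def)
  qed
  have "prob (fiber M (\<lambda>x. X (T x)) v) = measure (distr M M T) (fiber M X v)" for v
    unfolding fib by (rule measure_distr[OF T(1) fiber_sets[OF X], symmetric])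
  then have p: "prob (fiber M (\<lambda>x. X (T x)) v) = prob (fiber M X v)" for v
    by (simp add: T(2))
  have "observation_entropy M X = (\<integral>x. - ln (prob (fiber M X (X x))) \<partial>distr M M T)"
    by (simp add: T(2) observation_entropy_def)
  also have "\<dots> = (\<integral>x. - ln (prob (fiber M X (X (T x)))) \<partial>M)"
    by (rule integral_distr[OF T(1) borel_measurable_integrable[OF simple_function_integral(1)[OF X,
        of "\<lambda>v. - ln (prob (fiber M X v))"]]])
  finally show "observation_entropy M (\<lambda>x. X (T x)) = observation_entropy M X"
    by (simp add: observation_entropy_def p)
qed

lemma partition_entropy_fibers:
  assumes X: "simple_function M X"
  shows "partition_entropy M (fiber M X ` X ` space M) = observation_entropy M X"
proof -
  have "inj_on (fiber M X) (X ` space M)"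
    by (rule inj_onI) (auto simp: fiber_def)
  then show ?thesis
    unfolding partition_entropy_def observation_entropy_def
    using simple_function_integral(2)[OF X, of "\<lambda>v. - ln (prob (fiber M X v))"]
    by (simp add: sum.reindex sum_negf mult.commute)
qed

end

text \<open>
  Fekete's lemma. It guarantees that the \<open>lim\<close> in \<open>entropy_wrt\<close> is a genuine limit.
\<close>

lemma fekete_convergent:
  fixes a :: "nat \<Rightarrow> real"
  assumes sub: "\<And>m n. a (m + n) \<le> a m + a n" and nonneg: "\<And>n. 0 \<le> a n"
  shows "convergent (\<lambda>n. a n / real n)"
proof -
  define l where "l = (INF n\<in>{1..}. a n / real n)"
  have bdd: "bdd_below ((\<lambda>n. a n / real n) ` {1..})"
    using nonneg by (intro bdd_belowI2[of _ 0]) auto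
  have mult: "a (q * k + r) \<le> real q * a k + a r" for q k r
  proof (induction q)
    case (Suc q)
    have "a (Suc q * k + r) \<le> a k + a (q * k + r)"
      using sub[of k "q * k + r"] by (simp add: algebra_simps)
    with Suc show ?case by (simp add: algebra_simps)
  qed simp
  have "(\<lambda>n. a n / real n) \<longlonglongrightarrow> l"
  proof (rule order_tendstoI)
    fix y assume "y < l"
    have "l \<le> a n / real n" if "n \<ge> 1" for n
      unfolding l_def using that by (intro cINF_lower[OF bdd]) auto
    with \<open>y < l\<close> show "\<forall>\<^sub>F n in sequentially. y < a n / real n"
      by (intro eventually_sequentiallyI[of 1]) (auto intro: less_le_trans)
  next
    fix y assume "l < y"
    then obtain k where k: "k \<ge> 1" "a k / real k < y"
      unfolding l_def using bdd by (auto simp: cINF_less_iff)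
    define C where "C = (\<Sum>r<k. a r)"
    have bound: "a n / real n \<le> a k / real k + C / real n" if "n \<ge> 1" for n
    proof -
      have r: "a (n mod k) \<le> C"
        unfolding C_def using k nonneg by (intro member_le_sum) auto
      have "a n \<le> real (n div k) * a k + a (n mod k)"
        using mult[of "n div k" k "n mod k"] by simp
      also have "\<dots> \<le> (real n / real k) * a k + C"
        using r nonneg[of k] of_nat_div_le_of_nat[of n k] by (intro add_mono mult_right_mono) auto
      finally show ?thesis
        using that k by (simp add: field_simps)
    qed
    have "(\<lambda>n. a k / real k + C / real n) \<longlonglongrightarrow> a k / real k + 0"
      by (intro tendsto_intros lim_const_over_n)
    then have "\<forall>\<^sub>F n in sequentially. a k / real k + C / real n < y"
      using k(2) by (intro order_tendstoD(2)[where y = "a k / real k + 0"]) auto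
    with eventually_ge_at_top[of 1] show "\<forall>\<^sub>F n in sequentially. a n / real n < y"
      by eventually_elim (rule le_less_trans[OF bound])
  qed
  then show ?thesis by (rule convergentI)
qed

section \<open>Approximation of Borel sets by closed sets\<close>

text \<open>
  Approximation from both sides, so that the property is stable under complements.
\<close>

definition closed_regular :: "'a::metric_space measure \<Rightarrow> 'a set \<Rightarrow> bool" where
  "closed_regular M A \<longleftrightarrow> (\<forall>e>0. \<exists>K U. closed K \<and> open U \<and> K \<subseteq> A \<and> A \<subseteq> U \<and> measure M (U - K) < e)"

lemma closed_regularE:
  assumes "closed_regular M A" "e > 0"
  obtains K U where "closed K" "open U" "K \<subseteq> A" "A \<subseteq> U" "measure M (U - K) < e"
proof -
  from assms have "\<exists>K U. closed K \<and> open U \<and> K \<subseteq> A \<and> A \<subseteq> U \<and> measure M (U - K) < e"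
    unfolding closed_regular_def by simp
  then show thesis by (elim exE conjE) (rule that)
qed

lemma closed_regular_closed:
  fixes M :: "'a::metric_space measure"
  assumes fin: "finite_measure M" and sets_M: "sets M = sets borel" and "closed A"
  shows "closed_regular M A"
  unfolding closed_regular_def
proof (intro allI impI)
  interpret finite_measure M by fact
  fix e :: real assume "e > 0"
  show "\<exists>K U. closed K \<and> open U \<and> K \<subseteq> A \<and> A \<subseteq> U \<and> measure M (U - K) < e"
  proof (cases "A = {}")
    case True
    with \<open>e > 0\<close> show ?thesis by (intro exI[of _ "{}"]) auto
  next
    case False
    define U where "U n = {x. infdist x A < 1 / real (Suc n)}" for n
    have U_open: "open (U n)" for n
      unfolding U_def by (intro open_Collect_less continuous_intros)
    have "(\<Inter>n. U n) = A"
    proof safe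
      fix x assume "x \<in> (\<Inter>n. U n)"
      then have lt: "infdist x A < inverse (real (Suc n))" for n
        by (auto simp: U_def inverse_eq_divide)
      have "infdist x A = 0"
      proof (rule ccontr)
        assume "infdist x A \<noteq> 0"
        then have "infdist x A > 0" using infdist_nonneg[of x A] by simp
        then obtain n where "inverse (real (Suc n)) < infdist x A"
          using reals_Archimedean by blast
        with lt[of n] show False by simp
      qed
      then show "x \<in> A"
        using in_closed_iff_infdist_zero[OF \<open>closed A\<close> False] by simp
    next
      fix x n assume "x \<in> A" then show "x \<in> U n" by (simp add: U_def)
    qed
    then have empty: "(\<Inter>n. U n - A) = {}" by blast
    have "(\<lambda>n. measure M (U n - A)) \<longlonglongrightarrow> measure M (\<Inter>n. U n - A)"
    proof (rule finite_Lim_measure_decseq)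
      show "range (\<lambda>n. U n - A) \<subseteq> sets M"
        using U_open \<open>closed A\<close> by (auto simp: sets_M)
      have "1 / real (Suc n) \<le> 1 / real (Suc m)" if "m \<le> n" for m n
        using that by (simp add: frac_le)
      then show "decseq (\<lambda>n. U n - A)"
        unfolding decseq_def U_def by (fastforce intro: less_le_trans)
    qed
    then have "(\<lambda>n. measure M (U n - A)) \<longlonglongrightarrow> 0"
      unfolding empty by simp
    then have "\<forall>\<^sub>F n in sequentially. measure M (U n - A) < e"
      using \<open>e > 0\<close> by (rule order_tendstoD(2))
    then obtain n where "measure M (U n - A) < e"
      by (auto simp: eventually_sequentially)
    moreover have "A \<subseteq> U n" by (auto simp: U_def)
    ultimately show ?thesis
      using \<open>closed A\<close> U_open by blast
  qed
qed

text \<open>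
  Closed sets are approximated by their open neighbourhoods, and the sets with such approximations form a
  sigma-algebra.
\<close>

lemma closed_regular_sets:
  fixes M :: "'a::metric_space measure"
  assumes fin: "finite_measure M" and sets_M: "sets M = sets borel" and A: "A \<in> sets M"
  shows "closed_regular M A"
proof -
  interpret finite_measure M by fact
  have "A \<in> sigma_sets UNIV {A. closed A}"
    using A unfolding sets_M borel_eq_closed by simp
  then show ?thesis
  proof induction
    case (Basic A)
    then show ?case by (simp add: closed_regular_closed[OF fin sets_M])
  next
    case Empty
    show ?case by (simp add: closed_regular_closed[OF fin sets_M])
  next
    case (Compl A)
    show ?case
      unfolding closed_regular_def
    proof (intro allI impI)
      fix e :: real assume "e > 0"
      obtain K U where "closed K" "open U" "K \<subseteq> A" "A \<subseteq> U" "measure M (U - K) < e"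
        by (rule closed_regularE[OF Compl.IH \<open>e > 0\<close>])
      moreover have "- K - - U = U - K" by auto
      ultimately show "\<exists>K U. closed K \<and> open U \<and> K \<subseteq> UNIV - A \<and> UNIV - A \<subseteq> U \<and> measure M (U - K) < e"
        by (intro exI[of _ "- U"] exI[of _ "- K"]) auto
    qed
  next
    case (Union A)
    show ?case
      unfolding closed_regular_def
    proof (intro allI impI)
      fix e :: real assume "e > 0"
      define d where "d i = e / 2 * (1 / 2) ^ Suc i" for i
      have d_pos: "d i > 0" for i using \<open>e > 0\<close> by (simp add: d_def)
      have "\<exists>K U. closed K \<and> open U \<and> K \<subseteq> A i \<and> A i \<subseteq> U \<and> measure M (U - K) < d i" for i
        by (rule closed_regularE[OF Union.IH[of i] d_pos[of i]]) blast
      then obtain K U where KU: "\<And>i. closed (K i)" "\<And>i. open (U i)" "\<And>i. K i \<subseteq> A i"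
        "\<And>i. A i \<subseteq> U i" "\<And>i. measure M (U i - K i) < d i"
        by metis
      have KU_sets: "K i \<in> sets M" "U i \<in> sets M" for i
        using KU(1,2)[of i] by (auto simp: sets_M)
      let ?U = "\<Union>i. U i" and ?K = "\<Union>i. K i"
      have "(\<lambda>i. e / 2 * (1 / 2) ^ Suc i) sums (e / 2 * 1)"
        by (rule sums_mult[OF power_half_series])
      then have d_sums: "d sums (e / 2)"
        unfolding d_def by simp
      have summ: "summable (\<lambda>i. measure M (U i - K i))"
        using KU(5) by (intro summable_comparison_test_ev[OF _ sums_summable[OF d_sums]] always_eventually)
          (auto intro: less_imp_le)
      have "measure M (?U - ?K) \<le> measure M (\<Union>i. U i - K i)"
        using KU_sets by (intro finite_measure_mono) auto
      also have "\<dots> \<le> (\<Sum>i. measure M (U i - K i))"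
        using KU_sets summ by (intro finite_measure_subadditive_countably) auto
      also have "\<dots> \<le> (\<Sum>i. d i)"
        using KU(5) by (intro suminf_le summ sums_summable[OF d_sums]) (auto intro: less_imp_le)
      also have "\<dots> = e / 2" using d_sums by (simp add: sums_iff)
      finally have half: "measure M (?U - ?K) \<le> e / 2" .
      \<comment> \<open>A countable union of closed sets need not be closed, so it is cut off after finitely many.\<close>
      define F where "F n = (\<Union>i\<le>n. K i)" for n
      have F_sets: "F n \<in> sets M" for n
        unfolding F_def using KU_sets by auto
      have "(\<lambda>n. measure M (?U - F n)) \<longlonglongrightarrow> measure M (\<Inter>n. ?U - F n)"
      proof (rule finite_Lim_measure_decseq)
        show "range (\<lambda>n. ?U - F n) \<subseteq> sets M"
          using F_sets KU_sets by auto
        show "decseq (\<lambda>n. ?U - F n)"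
          unfolding decseq_def F_def by (fastforce intro: order_trans)
      qed
      moreover have "(\<Inter>n. ?U - F n) = ?U - ?K"
        by (auto simp: F_def)
      moreover have "measure M (?U - ?K) < e"
        using half \<open>e > 0\<close> by simp
      ultimately have "\<forall>\<^sub>F n in sequentially. measure M (?U - F n) < e"
        by (intro order_tendstoD(2)) auto
      then obtain n where "measure M (?U - F n) < e"
        by (auto simp: eventually_sequentially)
      moreover have "closed (F n)" "F n \<subseteq> (\<Union>i. A i)"
        unfolding F_def using KU(1,3) by (auto intro!: closed_UN)
      moreover have "open ?U" "(\<Union>i. A i) \<subseteq> ?U"
        using KU(2,4) by auto
      ultimately show "\<exists>K U. closed K \<and> open U \<and> K \<subseteq> (\<Union>i. A i) \<and> (\<Union>i. A i) \<subseteq> U \<and> measure M (U - K) < e"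
        by blast
    qed
  qed
qed

lemma closed_inner_approximation:
  fixes M :: "'a::metric_space measure"
  assumes fin: "finite_measure M" and "sets M = sets borel" "A \<in> sets M" "e > 0"
  obtains K where "closed K" "K \<subseteq> A" "measure M (A - K) < e"
proof -
  interpret finite_measure M by fact
  obtain K U where KU: "closed K" "open U" "K \<subseteq> A" "A \<subseteq> U" "measure M (U - K) < e"
    by (rule closed_regularE[OF closed_regular_sets[OF assms(1-3)] assms(4)])
  then have "measure M (A - K) \<le> measure M (U - K)"
    by (intro finite_measure_mono) (auto simp: assms(2))
  with KU show thesis by (intro that[of K]) auto
qed

section \<open>Invariant measures as subgradients\<close>

text \<open>
  The functions \<open>max 0 (1 - n \<cdot> infdist x K)\<close> decrease to the indicator of a closed set \<open>K\<close>, and closed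
  sets form an intersection-stable generator of the Borel sets.
\<close>

lemma prob_measure_eqI_continuous:
  fixes M N :: "'a::metric_space measure"
  assumes M: "sets M = sets borel" "prob_space M" and N: "sets N = sets borel" "prob_space N"
    and eq: "\<And>g. continuous_on UNIV g \<Longrightarrow> bounded (range g) \<Longrightarrow> (\<integral>x. g x \<partial>M) = (\<integral>x. g x \<partial>N :: real)"
  shows "M = N"
proof -
  interpret M: prob_space M by fact
  interpret N: prob_space N by fact
  have lim: "(\<lambda>n. \<integral>x. max 0 (1 - real n * infdist x K) \<partial>M') \<longlonglongrightarrow> measure M' K"
    if M': "sets M' = sets borel" "prob_space M'" and K: "closed K" "K \<noteq> {}" for M' :: "'a measure" and K
  proof -
    interpret M': prob_space M' by fact
    have meas: "g \<in> borel_measurable M'" if "continuous_on UNIV g" for g :: "'a \<Rightarrow> real"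
      using borel_measurable_continuous_onI[OF that] M'(1) measurable_cong_sets by blast
    have "(\<lambda>n. \<integral>x. max 0 (1 - real n * infdist x K) \<partial>M') \<longlonglongrightarrow> (\<integral>x. indicator K x \<partial>M')"
    proof (rule integral_dominated_convergence[where w = "\<lambda>x. 1"])
      show "(indicator K :: 'a \<Rightarrow> real) \<in> borel_measurable M'"
        using K by (intro borel_measurable_indicator) (simp add: M'(1))
      show "(\<lambda>x. max 0 (1 - real n * infdist x K)) \<in> borel_measurable M'" for n
        by (intro meas continuous_intros)
      show "AE x in M'. (\<lambda>n. max 0 (1 - real n * infdist x K)) \<longlonglongrightarrow> indicator K x"
      proof (rule AE_I2)
        fix x
        show "(\<lambda>n. max 0 (1 - real n * infdist x K)) \<longlonglongrightarrow> indicator K x"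
        proof (cases "x \<in> K")
          case False
          then have "infdist x K > 0"
            using in_closed_iff_infdist_zero[OF K] infdist_nonneg[of x K] by (simp add: less_le)
          then obtain m where m: "1 \<le> real m * infdist x K"
            using reals_Archimedean3[of "infdist x K"] by (auto intro: less_imp_le)
          have "max 0 (1 - real n * infdist x K) = 0" if "n \<ge> m" for n
            using m that mult_right_mono[of "real m" "real n" "infdist x K"] infdist_nonneg[of x K] by simp
          then have "\<forall>\<^sub>F n in sequentially. max 0 (1 - real n * infdist x K) = 0"
            by (auto simp: eventually_sequentially)
          with False show ?thesis
            by (simp add: tendsto_eventually)
        qed simp
      qed
      show "AE x in M'. norm (max 0 (1 - real n * infdist x K)) \<le> 1" for n
        by (intro AE_I2) (auto simp: max_def intro!: mult_nonneg_nonneg infdist_nonneg)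
    qed (use M'.integrable_const in auto)
    also have "(\<integral>x. indicator K x \<partial>M') = measure M' K"
      using K by (simp add: M'(1))
    finally show ?thesis .
  qed
  show ?thesis
  proof (rule measure_eqI_generator_eq[where \<Omega> = UNIV and E = "{K. closed K}" and A = "\<lambda>_. UNIV"])
    show "Int_stable {K :: 'a set. closed K}"
      by (auto simp: Int_stable_def)
    show "sets M = sigma_sets UNIV {K. closed K}" "sets N = sigma_sets UNIV {K. closed K}"
      unfolding M(1) N(1) borel_eq_closed by auto
    show "emeasure M K = emeasure N K" if "K \<in> {K. closed K}" for K
    proof (cases "K = {}")
      case False
      have "bounded (range (\<lambda>x. max 0 (1 - real n * infdist x K)))" for n
        using infdist_nonneg[of _ K] by (intro boundedI[of _ 1]) (auto simp: max_def)
      then have "(\<integral>x. max 0 (1 - real n * infdist x K) \<partial>M) = (\<integral>x. max 0 (1 - real n * infdist x K) \<partial>N)" for n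
        by (intro eq continuous_intros)
      then have "measure M K = measure N K"
        using lim[OF M, of K] lim[OF N, of K] that False LIMSEQ_unique by auto
      then show ?thesis
        by (simp add: M.emeasure_eq_measure N.emeasure_eq_measure)
    qed simp
    show "emeasure M UNIV \<noteq> \<infinity>" by (simp add: M.emeasure_eq_measure)
  qed auto
qed

context compact_system
begin

lemma invariant_measuresD:
  assumes "\<nu> \<in> invariant_measures f"
  shows "sets \<nu> = sets borel" "space \<nu> = UNIV" "prob_space \<nu>" "f \<in> measurable \<nu> \<nu>" "distr \<nu> \<nu> f = \<nu>"
proof -
  show sets: "sets \<nu> = sets borel" and "prob_space \<nu>"
    using assms by (auto simp: invariant_measures_def)
  show "space \<nu> = UNIV"
    using sets_eq_imp_space_eq[OF sets] by simp
  show "f \<in> measurable \<nu> \<nu>"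
    using borel_measurable_continuous_onI[OF cont_f] measurable_cong_sets[OF sets sets] by simp
  have "distr \<nu> \<nu> f = distr \<nu> borel f"
    by (rule distr_cong) (auto simp: sets)
  then show "distr \<nu> \<nu> f = \<nu>"
    using assms by (simp add: invariant_measures_def)
qed

lemma integrable_continuous:
  fixes g :: "'a \<Rightarrow> real"
  assumes sets: "sets \<nu> = sets borel" and "prob_space \<nu>" and cont: "continuous_on UNIV g"
  shows "integrable \<nu> g"
proof -
  interpret prob_space \<nu> by fact
  obtain B where "\<And>x. \<bar>g x\<bar> \<le> B"
    using bounded_cont[OF cont] by metis
  moreover have "g \<in> borel_measurable \<nu>"
    using borel_measurable_continuous_onI[OF cont] sets measurable_cong_sets by blast
  ultimately show ?thesis
    by (intro integrable_const_bound[of _ B]) auto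
qed

lemma integrable_invariant:
  fixes g :: "'a \<Rightarrow> real"
  assumes "\<nu> \<in> invariant_measures f" "continuous_on UNIV g"
  shows "integrable \<nu> g"
  by (rule integrable_continuous[OF invariant_measuresD(1,3)[OF assms(1)] assms(2)])

text \<open>
  Each of the four hypotheses on \<open>Q\<close> becomes a property of a subgradient \<open>L\<close>: convexity makes it
  exist, monotonicity makes it positive, the behaviour under constants gives \<open>L 1 = 1\<close>, and
  insensitivity to coboundaries makes the representing measure invariant. The Hahn--Banach argument
  takes place in the vector space of bounded continuous functions.
\<close>

theorem invariant_subgradient:
  fixes Q :: "('a \<Rightarrow> real) \<Rightarrow> real"
  assumes mono: "\<And>g h. continuous_on UNIV g \<Longrightarrow> continuous_on UNIV h \<Longrightarrow> (\<And>x. g x \<le> h x) \<Longrightarrow> Q g \<le> Q h"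
    and add_const: "\<And>g c. continuous_on UNIV g \<Longrightarrow> Q (\<lambda>x. g x + c) \<le> Q g + c"
    and convex: "\<And>g h u. continuous_on UNIV g \<Longrightarrow> continuous_on UNIV h \<Longrightarrow> 0 \<le> u \<Longrightarrow> u \<le> 1 \<Longrightarrow>
      Q (\<lambda>x. u * g x + (1 - u) * h x) \<le> u * Q g + (1 - u) * Q h"
    and coboundary: "\<And>g h. continuous_on UNIV g \<Longrightarrow> continuous_on UNIV h \<Longrightarrow>
      Q (\<lambda>x. g x + (h (f x) - h x)) \<le> Q g"
    and \<psi>: "continuous_on UNIV \<psi>"
  obtains \<nu> where "\<nu> \<in> invariant_measures f"
    "\<And>g. continuous_on UNIV g \<Longrightarrow> Q \<psi> + (\<integral>x. g x \<partial>\<nu>) \<le> Q (\<lambda>x. \<psi> x + g x)"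
proof -
  have in_bcontfun: "g \<in> bcontfun" if "continuous_on UNIV g" for g :: "'a \<Rightarrow> real"
    using that compact_imp_bounded[OF compact_continuous_image[OF that compact_space]]
    by (simp add: bcontfun_def)
  have apply_inv: "apply_bcontfun (Bcontfun g) = g" if "continuous_on UNIV g" for g :: "'a \<Rightarrow> real"
    by (rule Bcontfun_inverse[OF in_bcontfun[OF that]])
  let ?Q = "\<lambda>g. Q (apply_bcontfun g)"
  have "convex_on UNIV ?Q"
  proof (rule convex_onI)
    fix t :: real and g h :: "'a \<Rightarrow>\<^sub>C real" assume "0 < t" "t < 1"
    then have "Q (\<lambda>x. (1 - t) * g x + (1 - (1 - t)) * h x) \<le> (1 - t) * Q g + (1 - (1 - t)) * Q h"
      by (intro convex) auto
    moreover have "apply_bcontfun ((1 - t) *\<^sub>R g + t *\<^sub>R h) = (\<lambda>x. (1 - t) * g x + (1 - (1 - t)) * h x)"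
      by (auto simp: fun_eq_iff)
    ultimately show "?Q ((1 - t) *\<^sub>R g + t *\<^sub>R h) \<le> (1 - t) * ?Q g + t * ?Q h" by simp
  qed simp
  then obtain l where l: "linear l" "\<And>g. ?Q (Bcontfun \<psi>) + l g \<le> ?Q (Bcontfun \<psi> + g)"
    using convex_on_subgradient[of ?Q "Bcontfun \<psi>"] by blast
  define L where "L g = l (Bcontfun g)" for g
  have sub: "Q \<psi> + L g \<le> Q (\<lambda>x. \<psi> x + g x)" if "continuous_on UNIV g" for g
  proof -
    have "apply_bcontfun (Bcontfun \<psi> + Bcontfun g) = (\<lambda>x. \<psi> x + g x)"
      by (simp add: fun_eq_iff apply_inv that \<psi>)
    with l(2)[of "Bcontfun g"] show ?thesis
      by (simp add: L_def apply_inv \<psi>)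
  qed
  have add: "L (\<lambda>x. g x + h x) = L g + L h" if "continuous_on UNIV g" "continuous_on UNIV h" for g h
  proof -
    have "Bcontfun (\<lambda>x. g x + h x) = Bcontfun g + Bcontfun h"
      by (rule bcontfun_eqI) (simp add: apply_inv that continuous_on_add)
    then show ?thesis
      by (simp add: L_def linear_add[OF l(1)])
  qed
  have scale: "L (\<lambda>x. c * g x) = c * L g" if "continuous_on UNIV g" for c g
  proof -
    have "Bcontfun (\<lambda>x. c * g x) = c *\<^sub>R Bcontfun g"
      by (rule bcontfun_eqI) (simp add: apply_inv that continuous_on_mult)
    then show ?thesis
      by (simp add: L_def linear_cmul[OF l(1)])
  qed
  have L_le: "L g \<le> 0" if "continuous_on UNIV g" "Q (\<lambda>x. \<psi> x + g x) \<le> Q \<psi>" for g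
    using sub[OF that(1)] that(2) by simp
  have L_diff: "L (\<lambda>x. g x - h x) = L g - L h" if "continuous_on UNIV g" "continuous_on UNIV h" for g h
    using add[OF that(1), of "\<lambda>x. - 1 * h x"] scale[OF that(2), of "-1"] that
    by (simp add: continuous_on_minus)
  interpret L: positive_functional L
  proof
    show "compact (UNIV :: 'a set)" by (rule compact_space)
    show "L g \<le> L h" if "continuous_on UNIV g" "continuous_on UNIV h" "\<And>x. g x \<le> h x" for g h
    proof -
      have "Q (\<lambda>x. \<psi> x + (g x - h x)) \<le> Q \<psi>"
        using that by (intro mono continuous_intros \<psi>) (auto simp: algebra_simps)
      then have "L (\<lambda>x. g x - h x) \<le> 0"
        using that by (intro L_le continuous_intros)
      with that show ?thesis by (simp add: L_diff)
    qed
    have "L (\<lambda>x. c) \<le> c" for c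
      using sub[of "\<lambda>x. c"] add_const[OF \<psi>, of c] by simp
    from this[of 1] this[of "-1"] scale[of "\<lambda>x. 1" "-1"] show "L (\<lambda>x. 1) = 1" by simp
  qed (fact add scale)+
  obtain \<nu> :: "'a measure" where \<nu>: "sets \<nu> = sets borel" "prob_space \<nu>"
    and int: "\<And>g. continuous_on UNIV g \<Longrightarrow> (\<integral>x. g x \<partial>\<nu>) = L g"
    using L.riesz_representation by blast
  have meas_f: "f \<in> measurable \<nu> borel"
    using borel_measurable_continuous_onI[OF cont_f] \<nu>(1) measurable_cong_sets by blast
  have "distr \<nu> borel f = \<nu>"
  proof (rule prob_measure_eqI_continuous)
    show "prob_space (distr \<nu> borel f)"
      by (rule prob_space.prob_space_distr[OF \<nu>(2) meas_f])
    fix h :: "'a \<Rightarrow> real" assume h: "continuous_on UNIV h"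
    have hf: "continuous_on UNIV (\<lambda>x. h (f x))"
      using cont_comp_iterate[OF h, of UNIV 1] by simp
    have le: "L (\<lambda>x. h (f x)) \<le> L h" if h: "continuous_on UNIV h" for h
    proof -
      have hf: "continuous_on UNIV (\<lambda>x. h (f x))"
        using cont_comp_iterate[OF h, of UNIV 1] by simp
      have "L (\<lambda>x. h (f x) - h x) \<le> 0"
        by (intro L_le coboundary \<psi> h hf continuous_intros)
      with h hf show ?thesis by (simp add: L_diff)
    qed
    have "L (\<lambda>x. h (f x)) = L h"
      using le[OF h] le[of "\<lambda>x. - 1 * h x"] scale[OF h, of "-1"] scale[OF hf, of "-1"] h
      by (simp add: continuous_on_minus)
    then show "(\<integral>x. h x \<partial>distr \<nu> borel f) = (\<integral>x. h x \<partial>\<nu>)"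
      using integral_distr[OF meas_f borel_measurable_continuous_onI[OF h]] int[OF h] int[OF hf] by simp
  qed (auto simp: \<nu>)
  with \<nu> have "\<nu> \<in> invariant_measures f"
    by (simp add: invariant_measures_def)
  with sub int show thesis
    by (intro that) auto
qed

end

section \<open>Itineraries and the entropy of a partition\<close>

text \<open>
  The sequence of the first \<open>n\<close> observations along the orbit, as an extensional function, so
  that the words over a given alphabet form the set \<open>\<Pi>\<^sub>E\<close>.
\<close>

definition itinerary :: "('a \<Rightarrow> 'a) \<Rightarrow> ('a \<Rightarrow> 'b) \<Rightarrow> nat \<Rightarrow> 'a \<Rightarrow> nat \<Rightarrow> 'b" where
  "itinerary f c n x = (\<lambda>j\<in>{..<n}. c ((f ^^ j) x))"

lemma itinerary_eq_iff: "itinerary f c n x = itinerary f c n y \<longleftrightarrow> (\<forall>j<n. c ((f ^^ j) x) = c ((f ^^ j) y))"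
  by (auto simp: itinerary_def fun_eq_iff restrict_def)

definition cell :: "'a set set \<Rightarrow> 'a \<Rightarrow> 'a set" where
  "cell P x = (THE A. A \<in> P \<and> x \<in> A)"

lemma cell_eqI:
  assumes "partition_on S P" "A \<in> P" "x \<in> A"
  shows "cell P x = A"
  unfolding cell_def
proof (rule the_equality)
  fix B assume "B \<in> P \<and> x \<in> B"
  with assms show "B = A"
    by (metis disjointD disjoint_iff partition_onD2)
qed (use assms in simp)

lemma cell_mem:
  assumes "partition_on S P" "x \<in> S"
  shows "cell P x \<in> P" "x \<in> cell P x"
proof -
  obtain A where "A \<in> P" "x \<in> A"
    using assms by (auto simp: partition_on_def)
  with cell_eqI[OF assms(1) this] show "cell P x \<in> P" "x \<in> cell P x" by auto
qed

text \<open>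
  Points lie in the same cell of the dynamical refinement iff they have the same itinerary, which
  turns the entropy of partitions into the entropy of observations.
\<close>

lemma dyn_refinement_eq:
  assumes P: "partition_on UNIV P"
  shows "dyn_refinement f P n = (\<lambda>x. {y. itinerary f (cell P) n y = itinerary f (cell P) n x}) ` UNIV"
    (is "_ = ?C ` UNIV")
proof -
  define Q where "Q j = (\<lambda>A. (f ^^ j) -` A) ` P - {{}}" for j
  have Q_cell: "A \<in> Q j \<longleftrightarrow> A = (f ^^ j) -` cell P ((f ^^ j) x)" if "x \<in> A" for A j x
  proof
    assume "A \<in> Q j"
    then obtain B where "B \<in> P" "A = (f ^^ j) -` B" by (auto simp: Q_def)
    with that cell_eqI[OF P, of B "(f ^^ j) x"] show "A = (f ^^ j) -` cell P ((f ^^ j) x)" by simp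
  next
    assume "A = (f ^^ j) -` cell P ((f ^^ j) x)"
    with that cell_mem[OF P, of "(f ^^ j) x"] show "A \<in> Q j" by (auto simp: Q_def)
  qed
  have C_eq: "?C x = (\<Inter>j\<in>{..<n}. (f ^^ j) -` cell P ((f ^^ j) x))" for x
  proof -
    have "cell P u = cell P v \<longleftrightarrow> u \<in> cell P v" for u v
      using cell_mem[OF P, of u] cell_mem[OF P, of v] cell_eqI[OF P, of "cell P v" u] by auto
    then show ?thesis by (auto simp: itinerary_eq_iff)
  qed
  have "dyn_refinement f P n = (\<Union>g \<in> (\<Pi> A\<in>Q ` {..<n}. A). {\<Inter> (g ` Q ` {..<n})}) - {{}}"
    unfolding dyn_refinement_def common_refinement Q_def ..
  also have "\<dots> = ?C ` UNIV"
  proof (intro equalityI subsetI)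
    fix A assume "A \<in> (\<Union>g \<in> (\<Pi> A\<in>Q ` {..<n}. A). {\<Inter> (g ` Q ` {..<n})}) - {{}}"
    then obtain g x where g: "g \<in> (\<Pi> A\<in>Q ` {..<n}. A)" "A = \<Inter> (g ` Q ` {..<n})" "x \<in> A"
      by blast
    have "g (Q j) = (f ^^ j) -` cell P ((f ^^ j) x)" if "j < n" for j
      using g that Q_cell[of x "g (Q j)" j] by auto
    then have "A = ?C x"
      unfolding C_eq g(2) by auto
    then show "A \<in> ?C ` UNIV" by blast
  next
    fix A assume "A \<in> ?C ` UNIV"
    then obtain x where x: "A = ?C x" by blast
    define g where "g R = (THE B. B \<in> R \<and> x \<in> B)" for R :: "'a set set"
    have g_Q: "g (Q j) = (f ^^ j) -` cell P ((f ^^ j) x)" for j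
      unfolding g_def
    proof (rule the_equality)
      show "(f ^^ j) -` cell P ((f ^^ j) x) \<in> Q j \<and> x \<in> (f ^^ j) -` cell P ((f ^^ j) x)"
        using Q_cell[of x _ j] cell_mem[OF P, of "(f ^^ j) x"] by auto
    qed (use Q_cell in blast)
    have "g (Q j) \<in> Q j" for j
      using Q_cell[of x "g (Q j)" j] g_Q[of j] cell_mem[OF P, of "(f ^^ j) x"] by simp
    then have "g \<in> (\<Pi> A\<in>Q ` {..<n}. A)" by auto
    moreover have "A = \<Inter> (g ` Q ` {..<n})"
      unfolding x C_eq by (simp add: g_Q)
    moreover have "x \<in> A" by (simp add: x)
    ultimately show "A \<in> (\<Union>g \<in> (\<Pi> A\<in>Q ` {..<n}. A). {\<Inter> (g ` Q ` {..<n})}) - {{}}"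
      by blast
  qed
  finally show ?thesis .
qed

context compact_system
begin

lemma funpow_invariant:
  assumes "\<nu> \<in> invariant_measures f"
  shows "(f ^^ j) \<in> measurable \<nu> \<nu>" "distr \<nu> \<nu> (f ^^ j) = \<nu>"
proof (induction j)
  case 0
  show "(f ^^ 0) \<in> measurable \<nu> \<nu>" "distr \<nu> \<nu> (f ^^ 0) = \<nu>"
    by (simp_all add: id_def)
next
  case (Suc j)
  note f = invariant_measuresD(4,5)[OF assms]
  show "(f ^^ Suc j) \<in> measurable \<nu> \<nu>"
    using measurable_comp[OF Suc(1) f(1)] by simp
  have "distr \<nu> \<nu> (f ^^ Suc j) = distr (distr \<nu> \<nu> (f ^^ j)) \<nu> f"
    using distr_distr[OF f(1) Suc(1)] by simp
  then show "distr \<nu> \<nu> (f ^^ Suc j) = \<nu>"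
    by (simp add: Suc f)
qed

lemma integral_funpow:
  fixes g :: "'a \<Rightarrow> real"
  assumes "\<nu> \<in> invariant_measures f" "g \<in> borel_measurable \<nu>"
  shows "(\<integral>x. g ((f ^^ j) x) \<partial>\<nu>) = (\<integral>x. g x \<partial>\<nu>)"
  using integral_distr[OF funpow_invariant(1)[OF assms(1)] assms(2), of j] funpow_invariant(2)[OF assms(1), of j]
  by simp

lemma simple_function_itinerary:
  assumes "\<nu> \<in> invariant_measures f" "simple_function \<nu> c"
  shows "simple_function \<nu> (itinerary f c n)"
proof (induction n)
  case 0
  have "itinerary f c 0 = (\<lambda>x. \<lambda>j. undefined)"
    by (auto simp: itinerary_def fun_eq_iff)
  then show ?case by simp
next
  case (Suc n)
  interpret prob_space \<nu> by (rule invariant_measuresD(3)[OF assms(1)])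
  have "simple_function \<nu> (\<lambda>x. (itinerary f c n x, c ((f ^^ n) x)))"
    by (rule simple_function_Pair[OF Suc
        observation_entropy_invariant(1)[OF assms(2) funpow_invariant[OF assms(1)]]])
  then show ?case
    by (rule simple_function_fiberwise) (auto simp: itinerary_eq_iff less_Suc_eq)
qed

lemma observation_entropy_itinerary_add:
  assumes \<nu>: "\<nu> \<in> invariant_measures f" and c: "simple_function \<nu> c"
  shows "observation_entropy \<nu> (itinerary f c (m + n))
    \<le> observation_entropy \<nu> (itinerary f c m) + observation_entropy \<nu> (itinerary f c n)"
proof -
  interpret prob_space \<nu> by (rule invariant_measuresD(3)[OF \<nu>])
  note sf = simple_function_itinerary[OF \<nu> c]
  note shift = observation_entropy_invariant[OF sf funpow_invariant[OF \<nu>], of n m]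
  let ?Z = "\<lambda>x. (itinerary f c m x, itinerary f c n ((f ^^ m) x))"
  have "observation_entropy \<nu> (itinerary f c (m + n)) \<le> observation_entropy \<nu> ?Z"
  proof (rule observation_entropy_mono[OF simple_function_Pair[OF sf shift(1)]])
    fix x y assume eq: "?Z x = ?Z y"
    have "c ((f ^^ j) x) = c ((f ^^ j) y)" if "j < m + n" for j
    proof (cases "j < m")
      case False
      then have "j - m < n" "(f ^^ j) z = (f ^^ (j - m)) ((f ^^ m) z)" for z
        using that funpow_add[of "j - m" m f] by simp_all
      with eq show ?thesis by (simp add: itinerary_eq_iff)
    qed (use eq in \<open>simp add: itinerary_eq_iff\<close>)
    then show "itinerary f c (m + n) x = itinerary f c (m + n) y"
      by (simp add: itinerary_eq_iff)
  qed
  also have "\<dots> \<le> observation_entropy \<nu> (itinerary f c m) + observation_entropy \<nu> (\<lambda>x. itinerary f c n ((f ^^ m) x))"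
    by (rule observation_entropy_Pair[OF sf shift(1)])
  finally show ?thesis by (simp add: shift(2))
qed

lemma simple_function_cell:
  assumes \<nu>: "\<nu> \<in> invariant_measures f"
    and P: "finite P" "partition_on UNIV P" "P \<subseteq> sets \<nu>"
  shows "simple_function \<nu> (cell P)"
  unfolding simple_function_def
proof (intro conjI ballI)
  have "cell P ` space \<nu> \<subseteq> P"
    using cell_mem[OF P(2)] by auto
  then show "finite (cell P ` space \<nu>)"
    using P(1) finite_subset by blast
  fix A assume "A \<in> cell P ` space \<nu>"
  then have "A \<in> P" using cell_mem[OF P(2)] by auto
  have "cell P -` {A} \<inter> space \<nu> = A"
    using cell_mem[OF P(2)] cell_eqI[OF P(2) \<open>A \<in> P\<close>] invariant_measuresD(2)[OF \<nu>] by auto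
  with \<open>A \<in> P\<close> P(3) show "cell P -` {A} \<inter> space \<nu> \<in> sets \<nu>" by auto
qed

lemma entropy_wrt_limit:
  assumes \<nu>: "\<nu> \<in> invariant_measures f"
    and P: "finite P" "partition_on UNIV P" "P \<subseteq> sets \<nu>"
  shows "(\<lambda>n. observation_entropy \<nu> (itinerary f (cell P) n) / real n) \<longlonglongrightarrow> entropy_wrt \<nu> f P"
proof -
  interpret prob_space \<nu> by (rule invariant_measuresD(3)[OF \<nu>])
  note c = simple_function_cell[OF \<nu> P]
  note space = invariant_measuresD(2)[OF \<nu>]
  have "partition_entropy \<nu> (dyn_refinement f P n) = observation_entropy \<nu> (itinerary f (cell P) n)" for n
  proof -
    let ?X = "itinerary f (cell P) n"
    have "dyn_refinement f P n = fiber \<nu> ?X ` ?X ` space \<nu>"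
      unfolding dyn_refinement_eq[OF P(2)] by (auto simp: fiber_def space image_image vimage_def)
    then show ?thesis
      using partition_entropy_fibers[OF simple_function_itinerary[OF \<nu> c]] by simp
  qed
  moreover have "convergent (\<lambda>n. observation_entropy \<nu> (itinerary f (cell P) n) / real n)"
    by (intro fekete_convergent observation_entropy_itinerary_add observation_entropy_nonneg \<nu> c)
  ultimately show ?thesis
    unfolding entropy_wrt_def by (simp add: convergent_LIMSEQ_iff)
qed

end

section \<open>The variational inequality\<close>

text \<open>
  Below the Lebesgue number of the cover by the sets \<open>- (\<Union>w\<noteq>v. K w)\<close>, a ball meets at most
  one member of a disjoint family of closed sets.
\<close>

lemma closed_family_ball:
  fixes K :: "'b \<Rightarrow> 'a::metric_space set"
  assumes "compact (UNIV :: 'a set)" "finite V" "V \<noteq> {}"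
    and closed: "\<And>v. v \<in> V \<Longrightarrow> closed (K v)"
    and disjoint: "\<And>v w. v \<in> V \<Longrightarrow> w \<in> V \<Longrightarrow> v \<noteq> w \<Longrightarrow> K v \<inter> K w = {}"
  obtains e u where "e > 0" "\<And>y. u y \<in> V" "\<And>x y v. v \<in> V \<Longrightarrow> x \<in> K v \<Longrightarrow> dist y x < e \<Longrightarrow> v = u y"
proof -
  define U where "U v = - (\<Union>w\<in>V - {v}. K w)" for v
  have "x \<in> (\<Union>v\<in>V. U v)" for x
  proof (cases "\<exists>v\<in>V. x \<in> K v")
    case True
    then obtain v where "v \<in> V" "x \<in> K v" by blast
    with disjoint have "x \<in> U v" by (auto simp: U_def)
    with \<open>v \<in> V\<close> show ?thesis by blast
  qed (use \<open>V \<noteq> {}\<close> in \<open>auto simp: U_def\<close>)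
  then have cover: "UNIV \<subseteq> \<Union> (U ` V)" by blast
  have U_open: "open G" if G: "G \<in> U ` V" for G
  proof -
    obtain v where "v \<in> V" and v: "G = U v" using G by blast
    have "closed (\<Union>w\<in>V - {v}. K w)"
      using closed \<open>finite V\<close> by (intro closed_UN) auto
    then show ?thesis unfolding v U_def by (rule open_Compl)
  qed
  obtain e where e: "e > 0" "\<And>y. y \<in> UNIV \<Longrightarrow> \<exists>G\<in>U ` V. ball y e \<subseteq> G"
    using Heine_Borel_lemma[OF assms(1) cover U_open] by metis
  then have "\<forall>y. \<exists>v. v \<in> V \<and> ball y e \<subseteq> U v" by blast
  then obtain u where u: "\<And>y. u y \<in> V" "\<And>y. ball y e \<subseteq> U (u y)" by metis
  have "v = u y" if "v \<in> V" "x \<in> K v" "dist y x < e" for x y v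
  proof (rule ccontr)
    assume "v \<noteq> u y"
    with that have "x \<notin> U (u y)" by (auto simp: U_def)
    moreover have "x \<in> U (u y)"
      using u(2)[of y] that(3) by (auto simp: subset_eq)
    ultimately show False by simp
  qed
  with e(1) u(1) show thesis by (rule that)
qed

text \<open>
  Words with letters restricted position by position: their product weights sum to at most the
  product of the letter sums.
\<close>

lemma weighted_word_sum:
  fixes w :: "'b \<Rightarrow> real"
  assumes "D \<subseteq> (\<Pi>\<^sub>E i\<in>{..<n}. B i)" "\<And>s. 0 \<le> w s"
    and B: "\<And>i. i < n \<Longrightarrow> finite (B i)" "\<And>i. i < n \<Longrightarrow> (\<Sum>s\<in>B i. w s) \<le> c"
  shows "(\<Sum>d\<in>D. \<Prod>i<n. w (d i)) \<le> c ^ n"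
proof -
  have "(\<Sum>d\<in>D. \<Prod>i<n. w (d i)) \<le> (\<Sum>d\<in>(\<Pi>\<^sub>E i\<in>{..<n}. B i). \<Prod>i<n. w (d i))"
    using assms by (intro sum_mono2 finite_PiE prod_nonneg) auto
  also have "\<dots> = (\<Prod>i<n. \<Sum>s\<in>B i. w s)"
    using B(1) by (intro prod_sum_PiE[symmetric]) auto
  also have "\<dots> \<le> (\<Prod>i<n. c)"
    using assms by (intro prod_mono) (auto intro: sum_nonneg)
  finally show ?thesis by simp
qed

context compact_system
begin

lemma compact_system_funpow: "compact_system (f ^^ N)"
  by unfold_locales (rule compact_space, rule cont_iterate)

lemma invariant_funpow: "\<nu> \<in> invariant_measures f \<Longrightarrow> \<nu> \<in> invariant_measures (f ^^ N)"
proof -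
  assume \<nu>: "\<nu> \<in> invariant_measures f"
  have "distr \<nu> borel (f ^^ N) = distr \<nu> \<nu> (f ^^ N)"
    by (rule distr_cong) (auto simp: invariant_measuresD(1)[OF \<nu>])
  then show ?thesis
    using invariant_measuresD[OF \<nu>] funpow_invariant(2)[OF \<nu>, of N]
    by (simp add: invariant_measures_def)
qed

lemma uniformly_continuous_observable:
  fixes \<psi> :: "'a \<Rightarrow> real"
  assumes "continuous_on UNIV \<psi>" "d > 0"
  obtains e where "e > 0" "\<And>x y. dist x y < e \<Longrightarrow> \<psi> x \<le> \<psi> y + d"
proof -
  have "uniformly_continuous_on UNIV \<psi>"
    by (rule compact_uniformly_continuous[OF assms(1) compact_space])
  then obtain e where "e > 0" "\<And>x y. dist y x < e \<Longrightarrow> dist (\<psi> y) (\<psi> x) < d"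
    using assms(2) unfolding uniformly_continuous_on_def by (metis UNIV_I)
  then show thesis
    by (intro that[of e]) (force simp: dist_real_def)+
qed

text \<open>
  A separated set of largest cardinality is also spanning.
\<close>

lemma maximal_separated:
  assumes "e > 0"
  obtains E where "separated f n e E" "\<And>x. \<exists>y\<in>E. dyn_dist f n x y < e"
proof -
  obtain b where b: "\<And>E. separated f n e E \<Longrightarrow> finite E \<and> card E \<le> b"
    using separated_card_bound[OF assms] by metis
  have "\<exists>E. separated f n e E \<and> (\<forall>E'. separated f n e E' \<longrightarrow> card E' \<le> card E)"
    using ex_has_greatest_nat[of "separated f n e" "{}" card "Suc b"] separated_empty[of f n e] b
    by (simp add: less_Suc_eq_le)
  then obtain E where E: "separated f n e E" "\<And>E'. separated f n e E' \<Longrightarrow> card E' \<le> card E"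
    by (elim exE conjE) simp
  have sym: "dyn_dist f n x y = dyn_dist f n y x" for x y
    by (simp add: dyn_dist_def dist_commute)
  have "\<exists>y\<in>E. dyn_dist f n x y < e" for x
  proof (rule ccontr)
    assume "\<not> ?thesis"
    then have far: "e \<le> dyn_dist f n x y" if "y \<in> E" for y
      using that by (auto simp: not_less)
    have "x \<notin> E"
    proof
      assume "x \<in> E"
      from far[OF this] assms show False by (simp add: le_dyn_dist_iff)
    qed
    moreover have "separated f n e (insert x E)"
      using E(1) far sym by (auto simp: separated_def)
    ultimately show False
      using E(2)[of "insert x E"] b[OF E(1)] by simp
  qed
  with E(1) show thesis by (rule that)
qed

lemma birkhoff_sum_le_of_close:
  assumes close: "\<And>x y. dist x y < e \<Longrightarrow> \<psi> x \<le> \<psi> y + d" and "dyn_dist f n x y < e"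
  shows "birkhoff_sum f \<psi> n x \<le> birkhoff_sum f \<psi> n y + real (n + 1) * d"
proof -
  have "dist ((f ^^ j) x) ((f ^^ j) y) < e" if "j \<le> n" for j
    using assms(2) that le_dyn_dist_iff[of e f n x y] by (meson not_le)
  then have "birkhoff_sum f \<psi> n x \<le> (\<Sum>j\<in>{0..n}. \<psi> ((f ^^ j) y) + d)"
    unfolding birkhoff_sum_def by (intro sum_mono close) auto
  then show ?thesis
    by (simp add: birkhoff_sum_def sum.distrib algebra_simps)
qed

lemma integral_birkhoff_sum:
  assumes "\<nu> \<in> invariant_measures f" "continuous_on UNIV \<psi>"
  shows "(\<integral>x. birkhoff_sum f \<psi> n x \<partial>\<nu>) = real (n + 1) * (\<integral>x. \<psi> x \<partial>\<nu>)"
proof -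
  have "(\<integral>x. birkhoff_sum f \<psi> n x \<partial>\<nu>) = (\<Sum>j\<in>{0..n}. \<integral>x. \<psi> ((f ^^ j) x) \<partial>\<nu>)"
    unfolding birkhoff_sum_def
    by (intro Bochner_Integration.integral_sum integrable_invariant[OF assms(1)] cont_comp_iterate assms(2))
  also have "\<dots> = (\<Sum>j\<in>{0..n}. \<integral>x. \<psi> x \<partial>\<nu>)"
    by (simp add: integral_funpow[OF assms(1) borel_measurable_integrable[OF integrable_invariant[OF assms]]])
  finally show ?thesis by simp
qed

text \<open>
  The Gibbs inequality for the words \<open>v\<close> of length \<open>n\<close> that \<open>D\<close> produces along \<open>f ^^ N\<close>. A
  word gets the product of the weights \<open>w\<close> of its letters times \<open>exp (S y)\<close>, where \<open>S\<close> is the Birkhoff sum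
  and \<open>y\<close> a point of a maximal separated set whose orbit follows an orbit with that word. All
  orbits close to that of one \<open>y\<close> have letters from the sets \<open>B\<close>, whose weight is at most 2, so the
  words assigned to \<open>y\<close> have total weight at most \<open>2 ^ n\<close>; this is the term \<open>n ln 2\<close>.
\<close>

lemma entropy_le_partition_sum:
  fixes D :: "'a \<Rightarrow> 'b" and w :: "'b \<Rightarrow> real"
  assumes \<nu>: "\<nu> \<in> invariant_measures f" and \<psi>: "continuous_on UNIV \<psi>"
    and D: "simple_function \<nu> D"
    and w: "\<And>s. 0 < w s"
    and e: "e > 0" and close: "\<And>x y. dist x y < e \<Longrightarrow> \<psi> x \<le> \<psi> y + d"
    and B: "\<And>y. finite (B y)" "\<And>y. (\<Sum>s\<in>B y. w s) \<le> 2" "\<And>x y. dist x y < e \<Longrightarrow> D x \<in> B y"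
  shows "observation_entropy \<nu> (itinerary (f ^^ N) D n) + real (n * N + 1) * (\<integral>x. \<psi> x \<partial>\<nu>)
    \<le> ln (partition_sum f \<psi> (n * N) e) + real n * ln 2 + real n * (\<integral>x. - ln (w (D x)) \<partial>\<nu>)
      + real (n * N + 1) * d + 1"
proof -
  interpret prob_space \<nu> by (rule invariant_measuresD(3)[OF \<nu>])
  interpret g: compact_system "f ^^ N" by (rule compact_system_funpow)
  note \<nu>N = invariant_funpow[OF \<nu>, of N]
  note space = invariant_measuresD(2)[OF \<nu>]
  define m where "m = n * N"
  define S where "S = birkhoff_sum f \<psi> m"
  define X where "X = itinerary (f ^^ N) D n"
  have S_cont: "continuous_on UNIV S"
    unfolding S_def by (rule cont_birkhoff_sum[OF \<psi>])
  have X: "simple_function \<nu> X"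
    unfolding X_def by (rule g.simple_function_itinerary[OF \<nu>N D])
  have X_apply: "X x i = D (((f ^^ N) ^^ i) x)" if "i < n" for x i
    using that by (simp add: X_def itinerary_def)
  \<comment> \<open>Every word \<open>v\<close> has a representative \<open>r v\<close> almost maximising the Birkhoff sum.\<close>
  obtain b where b: "\<And>x. \<bar>S x\<bar> \<le> b"
    using bounded_cont[OF S_cont] by metis
  have "\<exists>z. X z = v \<and> (\<forall>x. X x = v \<longrightarrow> S x \<le> S z + 1)" if "v \<in> range X" for v
  proof -
    let ?A = "S ` {x. X x = v}"
    have bdd: "bdd_above ?A"
      using order_trans[OF abs_ge_self b] by (intro bdd_aboveI2[of _ _ b])
    have "?A \<noteq> {}" using that by blast
    then obtain z where z: "X z = v" "Sup ?A - 1 < S z"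
      using less_cSupD[of ?A "Sup ?A - 1"] by auto
    have "S x \<le> S z + 1" if "X x = v" for x
      using cSup_upper[OF _ bdd, of "S x"] that z(2) by auto
    with z(1) show ?thesis by blast
  qed
  then obtain r where r: "\<And>v. v \<in> range X \<Longrightarrow> X (r v) = v" "\<And>x. S x \<le> S (r (X x)) + 1"
    by (metis rangeI)
  obtain E where E: "separated f m e E" "\<And>x. \<exists>y\<in>E. dyn_dist f m x y < e"
    using maximal_separated[OF e] by blast
  then obtain p where p: "\<And>x. p x \<in> E" "\<And>x. dyn_dist f m x (p x) < e"
    by metis
  have finE: "finite E"
    using separated_card_bound[OF e] E(1) by metis
  define Z where "Z = (\<Sum>y\<in>E. exp (S y))"
  have Z_pos: "Z > 0"
    unfolding Z_def using p(1) finE by (intro sum_pos) auto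
  have Z_le: "Z \<le> partition_sum f \<psi> m e"
    unfolding Z_def S_def by (rule partition_sum_upper[OF \<psi> e E(1)])
  define wt where "wt v = (\<Prod>i<n. w (v i))" for v
  have wt_pos: "wt v > 0" for v
    unfolding wt_def by (intro prod_pos) (use w in auto)
  define q where "q v = wt v * exp (S (p (r v))) / (2 ^ n * Z)" for v
  have q_pos: "q v > 0" for v
    unfolding q_def using wt_pos Z_pos by simp
  have words: "(\<Sum>v\<in>{v \<in> range X. p (r v) = y}. wt v) \<le> 2 ^ n" for y
    unfolding wt_def
  proof (rule weighted_word_sum[where B = "\<lambda>i. B (((f ^^ N) ^^ i) y)"])
    show "{v \<in> range X. p (r v) = y} \<subseteq> (\<Pi>\<^sub>E i\<in>{..<n}. B (((f ^^ N) ^^ i) y))"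
    proof (rule subsetI)
      fix v assume "v \<in> {v \<in> range X. p (r v) = y}"
      then obtain x where x: "v = X x" "y = p (r (X x))" by auto
      show "v \<in> (\<Pi>\<^sub>E i\<in>{..<n}. B (((f ^^ N) ^^ i) y))"
        unfolding x
      proof (rule PiE_I)
        fix i assume "i \<in> {..<n}"
        then have i: "i < n" by simp
        let ?z = "r (X x)"
        have "N * i \<le> m" unfolding m_def using i by (simp add: mult.commute mult_le_mono)
        then have "dist ((f ^^ (N * i)) ?z) ((f ^^ (N * i)) (p ?z)) < e"
          using p(2)[of ?z] le_dyn_dist_iff[of e f m ?z "p ?z"] by (meson not_le)
        then have "D (((f ^^ N) ^^ i) ?z) \<in> B (((f ^^ N) ^^ i) (p ?z))"
          by (intro B(3)) (simp add: funpow_mult)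
        moreover have "X x i = D (((f ^^ N) ^^ i) ?z)"
          using r(1)[of "X x"] X_apply[OF i, of ?z] by simp
        ultimately show "X x i \<in> B (((f ^^ N) ^^ i) (p ?z))" by simp
      qed (simp add: X_def itinerary_def)
    qed
  qed (use w B in \<open>auto intro: less_imp_le\<close>)
  have q_sum: "(\<Sum>v\<in>X ` space \<nu>. q v) \<le> 1"
  proof -
    have fin: "finite (range X)"
      using simple_functionD(1)[OF X] space by simp
    have "(\<Sum>v\<in>range X. wt v * exp (S (p (r v))))
        = (\<Sum>y\<in>E. \<Sum>v\<in>{v \<in> range X. p (r v) = y}. wt v * exp (S (p (r v))))"
      by (rule sum.group[symmetric, OF fin finE]) (use p in auto)
    also have "\<dots> = (\<Sum>y\<in>E. (\<Sum>v\<in>{v \<in> range X. p (r v) = y}. wt v) * exp (S y))"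
      unfolding sum_distrib_right by (intro sum.cong) auto
    also have "\<dots> \<le> (\<Sum>y\<in>E. 2 ^ n * exp (S y))"
      by (intro sum_mono mult_right_mono words) simp
    also have "\<dots> = 2 ^ n * Z"
      by (simp add: Z_def sum_distrib_left)
    finally have "(\<Sum>v\<in>range X. wt v * exp (S (p (r v)))) \<le> 2 ^ n * Z" .
    then have "(\<Sum>v\<in>range X. wt v * exp (S (p (r v)))) / (2 ^ n * Z) \<le> 1"
      using Z_pos by simp
    then show ?thesis
      unfolding q_def space by (simp add: sum_divide_distrib)
  qed
  define h where "h x = - ln (w (D x))" for x
  have h_int: "integrable \<nu> (\<lambda>x. h (((f ^^ N) ^^ i) x))" for i
    unfolding h_def
    by (rule simple_function_integral(1)[OF observation_entropy_invariant(1)[OF D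
          g.funpow_invariant[OF \<nu>N]], of "\<lambda>s. - ln (w s)"])
  have S_int: "integrable \<nu> S"
    by (rule integrable_invariant[OF \<nu> S_cont])
  have "observation_entropy \<nu> X \<le> (\<integral>x. - ln (q (X x)) \<partial>\<nu>)"
    by (rule gibbs_inequality[OF X less_imp_le[OF q_pos] q_pos q_sum])
  also have "\<dots> \<le> (\<integral>x. (ln (2 ^ n * Z) + 1 + real (m + 1) * d) - S x + (\<Sum>i<n. h (((f ^^ N) ^^ i) x)) \<partial>\<nu>)"
  proof (rule integral_mono)
    show "integrable \<nu> (\<lambda>x. - ln (q (X x)))"
      by (rule simple_function_integral(1)[OF X, of "\<lambda>v. - ln (q v)"])
    show "integrable \<nu> (\<lambda>x. (ln (2 ^ n * Z) + 1 + real (m + 1) * d) - S x + (\<Sum>i<n. h (((f ^^ N) ^^ i) x)))"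
      by (intro Bochner_Integration.integrable_add Bochner_Integration.integrable_diff
          Bochner_Integration.integrable_sum integrable_const S_int h_int)
    fix x
    have "S x \<le> S (r (X x)) + 1" by (rule r(2))
    also have "S (r (X x)) \<le> S (p (r (X x))) + real (m + 1) * d"
      unfolding S_def by (rule birkhoff_sum_le_of_close[OF close p(2)])
    finally have "S x \<le> S (p (r (X x))) + real (m + 1) * d + 1" by simp
    moreover have "ln (q (X x)) = ln (wt (X x)) + S (p (r (X x))) - ln (2 ^ n * Z)"
      unfolding q_def using wt_pos[of "X x"] Z_pos by (simp add: ln_div ln_mult)
    moreover have "ln (wt (X x)) = - (\<Sum>i<n. h (((f ^^ N) ^^ i) x))"
    proof -
      have "ln (wt (X x)) = (\<Sum>i<n. ln (w (X x i)))"
        unfolding wt_def by (rule ln_prod) (use w less_imp_neq in fastforce)+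
      then show ?thesis
        by (simp add: h_def X_apply sum_negf)
    qed
    ultimately show "- ln (q (X x)) \<le> (ln (2 ^ n * Z) + 1 + real (m + 1) * d) - S x + (\<Sum>i<n. h (((f ^^ N) ^^ i) x))"
      by linarith
  qed
  also have "\<dots> = (\<integral>x. (ln (2 ^ n * Z) + 1 + real (m + 1) * d) - S x \<partial>\<nu>) + (\<integral>x. (\<Sum>i<n. h (((f ^^ N) ^^ i) x)) \<partial>\<nu>)"
    by (intro Bochner_Integration.integral_add Bochner_Integration.integrable_diff
        Bochner_Integration.integrable_sum integrable_const S_int h_int)
  also have "(\<integral>x. (ln (2 ^ n * Z) + 1 + real (m + 1) * d) - S x \<partial>\<nu>)
      = (ln (2 ^ n * Z) + 1 + real (m + 1) * d) - real (m + 1) * (\<integral>x. \<psi> x \<partial>\<nu>)"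
    using S_int integral_birkhoff_sum[OF \<nu> \<psi>, of m] by (simp add: prob_space S_def)
  also have "(\<integral>x. (\<Sum>i<n. h (((f ^^ N) ^^ i) x)) \<partial>\<nu>) = (\<Sum>i<n. \<integral>x. h (((f ^^ N) ^^ i) x) \<partial>\<nu>)"
    by (intro Bochner_Integration.integral_sum h_int)
  also have "\<dots> = real n * (\<integral>x. h x \<partial>\<nu>)"
    using g.integral_funpow[OF \<nu>N borel_measurable_integrable[OF h_int[of 0, simplified]]] by simp
  also have "ln (2 ^ n * Z) = real n * ln 2 + ln Z"
    using Z_pos by (simp add: ln_mult ln_realpow)
  also have "ln Z \<le> ln (partition_sum f \<psi> m e)"
    using Z_pos Z_le by (subst ln_le_cancel_iff) auto
  finally show ?thesis
    unfolding m_def X_def h_def by simp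
qed

text \<open>
  The letters are blocks of length \<open>N\<close> together with a bit recording whether the point lies in a closed
  set \<open>K v\<close> approximating the cell \<open>v\<close> of the block. The closed sets are a positive distance apart, so
  a short ball meets one of them only, whereas the bad part of every cell may be near it. Weight 1
  for a good letter and \<open>1 / k\<close> for a bad one, with \<open>k\<close> the number of cells, keeps the
  total at 2. Apart from the oscillation \<open>d\<close> of \<open>\<psi>\<close>, the error is a constant per block.
\<close>

lemma block_entropy_estimate:
  assumes \<nu>: "\<nu> \<in> invariant_measures f" and c: "simple_function \<nu> c"
    and \<psi>: "continuous_on UNIV \<psi>" and N: "N \<ge> 1" and d: "d > 0"
  obtains e where "e > 0"
    "\<And>n. observation_entropy \<nu> (itinerary f c (n * N)) + real (n * N + 1) * (\<integral>x. \<psi> x \<partial>\<nu>)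
      \<le> ln (partition_sum f \<psi> (n * N) e) + real n * (ln 2 + 1) + real (n * N + 1) * d + 1"
proof -
  interpret prob_space \<nu> by (rule invariant_measuresD(3)[OF \<nu>])
  interpret g: compact_system "f ^^ N" by (rule compact_system_funpow)
  note \<nu>N = invariant_funpow[OF \<nu>, of N]
  note space = invariant_measuresD(2)[OF \<nu>] and sets = invariant_measuresD(1)[OF \<nu>]
  define C where "C = itinerary f c N"
  have C: "simple_function \<nu> C"
    unfolding C_def by (rule simple_function_itinerary[OF \<nu> c])
  define V where "V = range C"
  have finV: "finite V" and "V \<noteq> {}"
    using simple_functionD(1)[OF C] by (auto simp: V_def space)
  define k where "k = real (card V)"
  have k: "k \<ge> 1"
    using finV \<open>V \<noteq> {}\<close> by (simp add: k_def Suc_le_eq card_gt_0_iff)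
  \<comment> \<open>The exceptional set gets measure at most \<open>1 / (1 + ln k)\<close>, so that its cost \<open>ln k\<close> per
    visit averages to at most 1.\<close>
  define \<eta> where "\<eta> = 1 / (k * (1 + ln k))"
  have \<eta>: "\<eta> > 0"
    using k by (simp add: \<eta>_def add_pos_nonneg)
  have "\<exists>K. closed K \<and> K \<subseteq> fiber \<nu> C v \<and> prob (fiber \<nu> C v - K) < \<eta>" for v
    by (rule closed_inner_approximation[OF finite_measure_axioms sets fiber_sets[OF C] \<eta>]) blast
  then obtain K where K: "\<And>v. closed (K v)" "\<And>v. K v \<subseteq> fiber \<nu> C v" "\<And>v. prob (fiber \<nu> C v - K v) < \<eta>"
    by metis
  have K_sets: "K v \<in> events" for v
    using K(1) by (simp add: sets)
  have K_C: "C x = v" if "x \<in> K v" for x v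
    using K(2)[of v] that by (auto simp: fiber_def)
  have K_disjoint: "K v \<inter> K v' = {}" if "v \<in> V" "v' \<in> V" "v \<noteq> v'" for v v'
    using K_C that(3) by blast
  obtain e0 u where e0: "e0 > 0" "\<And>y. u y \<in> V"
    "\<And>x y v. v \<in> V \<Longrightarrow> x \<in> K v \<Longrightarrow> dist y x < e0 \<Longrightarrow> v = u y"
  proof (rule closed_family_ball[where K = K, OF compact_space finV \<open>V \<noteq> {}\<close> K(1) K_disjoint])
    fix e u
    assume "e > 0" "\<And>y. u y \<in> V" "\<And>x y v. v \<in> V \<Longrightarrow> x \<in> K v \<Longrightarrow> dist y x < e \<Longrightarrow> v = u y"
    then show thesis by (rule that)
  qed
  obtain e1 where e1: "e1 > 0" "\<And>x y. dist x y < e1 \<Longrightarrow> \<psi> x \<le> \<psi> y + d"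
    using uniformly_continuous_observable[OF \<psi> d] by blast
  define e where "e = min e0 e1"
  have e: "e > 0" using e0(1) e1(1) by (simp add: e_def)
  define D where "D x = (C x, x \<in> K (C x))" for x
  define w where "w s = (if snd s then 1 else 1 / k)" for s :: "(nat \<Rightarrow> 'b) \<times> bool"
  define B where "B y = insert (u y, True) (V \<times> {False})" for y
  have D: "simple_function \<nu> D"
    unfolding simple_function_def
  proof (intro conjI ballI)
    have "D ` space \<nu> \<subseteq> V \<times> UNIV" by (auto simp: D_def V_def)
    then show "finite (D ` space \<nu>)"
      by (rule finite_subset) (simp add: finV)
    fix s :: "(nat \<Rightarrow> 'b) \<times> bool"
    obtain v t where s: "s = (v, t)" by (cases s)
    have "D -` {s} \<inter> space \<nu> = (if t then K v else fiber \<nu> C v - K v)"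
      using K_C by (auto simp: D_def s fiber_def space)
    then show "D -` {s} \<inter> space \<nu> \<in> events"
      using K_sets fiber_sets[OF C] by simp
  qed
  have "(\<Sum>s\<in>B y. w s) = 2" for y
  proof -
    have "(\<Sum>s\<in>V \<times> {False}. w s) = (\<Sum>s\<in>V \<times> {False}. 1 / k)"
      by (intro sum.cong) (auto simp: w_def)
    also have "\<dots> = 1"
      using k by (simp add: k_def card_cartesian_product)
    finally show ?thesis
      using finV by (simp add: B_def w_def)
  qed
  moreover have "D x \<in> B y" if "dist x y < e" for x y
    using e0(3)[of "C x" x y] that by (auto simp: D_def B_def V_def e_def dist_commute)
  ultimately have main: "observation_entropy \<nu> (itinerary (f ^^ N) D n) + real (n * N + 1) * (\<integral>x. \<psi> x \<partial>\<nu>)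
      \<le> ln (partition_sum f \<psi> (n * N) e) + real n * ln 2 + real n * (\<integral>x. - ln (w (D x)) \<partial>\<nu>)
        + real (n * N + 1) * d + 1" for n
    using k finV e1(2) by (intro entropy_le_partition_sum[where B = B, OF \<nu> \<psi> D _ e]) (auto simp: w_def B_def e_def)
  have bad: "(\<integral>x. - ln (w (D x)) \<partial>\<nu>) \<le> 1"
  proof -
    let ?A = "\<Union>v\<in>V. fiber \<nu> C v - K v"
    have A_sets: "?A \<in> events"
      using finV K_sets fiber_sets[OF C] by auto
    have "- ln (w (D x)) = ln k * indicator ?A x" for x
    proof -
      have "x \<in> ?A \<longleftrightarrow> x \<notin> K (C x)"
        by (auto simp: fiber_def space V_def)
      then show ?thesis
        using k by (simp add: w_def D_def ln_div)
    qed
    then have "(\<integral>x. - ln (w (D x)) \<partial>\<nu>) = ln k * prob ?A"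
      using A_sets by simp
    also have "prob ?A \<le> (\<Sum>v\<in>V. prob (fiber \<nu> C v - K v))"
      using finV K_sets fiber_sets[OF C] by (intro finite_measure_subadditive_finite) auto
    also have "\<dots> \<le> (\<Sum>v\<in>V. \<eta>)"
      using K(3) by (intro sum_mono less_imp_le)
    also have "\<dots> = 1 / (1 + ln k)"
      using k by (simp add: \<eta>_def k_def)
    finally have "(\<integral>x. - ln (w (D x)) \<partial>\<nu>) \<le> ln k * (1 / (1 + ln k))"
      using k by (simp add: mult_left_mono)
    also have "\<dots> \<le> 1"
      using ln_ge_zero[OF k] by (simp add: divide_le_eq)
    finally show ?thesis .
  qed
  have fine: "observation_entropy \<nu> (itinerary f c (n * N)) \<le> observation_entropy \<nu> (itinerary (f ^^ N) D n)" for n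
  proof (rule observation_entropy_mono[OF g.simple_function_itinerary[OF \<nu>N D]])
    fix x y assume eq: "itinerary (f ^^ N) D n x = itinerary (f ^^ N) D n y"
    have "c ((f ^^ j) x) = c ((f ^^ j) y)" if "j < n * N" for j
    proof -
      have i: "j div N < n" and r: "j mod N < N"
        using that N by (auto simp: less_mult_imp_div_less)
      have split: "(f ^^ j) z = (f ^^ (j mod N)) (((f ^^ N) ^^ (j div N)) z)" for z
        using funpow_add[of "j mod N" "N * (j div N)" f] by (simp add: funpow_mult)
      have "C (((f ^^ N) ^^ (j div N)) x) = C (((f ^^ N) ^^ (j div N)) y)"
        using eq i by (simp add: itinerary_eq_iff D_def)
      then show ?thesis
        using r unfolding split C_def by (simp add: itinerary_eq_iff)
    qed
    then show "itinerary f c (n * N) x = itinerary f c (n * N) y"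
      by (simp add: itinerary_eq_iff)
  qed
  show thesis
  proof (rule that[OF e])
    fix n
    have "real n * (\<integral>x. - ln (w (D x)) \<partial>\<nu>) \<le> real n * 1"
      by (intro mult_left_mono bad) simp
    with main[of n] fine[of n]
    show "observation_entropy \<nu> (itinerary f c (n * N)) + real (n * N + 1) * (\<integral>x. \<psi> x \<partial>\<nu>)
      \<le> ln (partition_sum f \<psi> (n * N) e) + real n * (ln 2 + 1) + real (n * N + 1) * d + 1"
      by (simp only: distrib_left mult_1_right)
  qed
qed

text \<open>
  The error per block in \<open>block_entropy_estimate\<close> becomes \<open>(ln 2 + 1) / N\<close> per unit of time and disappears
  as the block length \<open>N\<close> grows.
\<close>

lemma entropy_wrt_le_pressure:
  assumes \<nu>: "\<nu> \<in> invariant_measures f"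
    and P: "finite P" "partition_on UNIV P" "P \<subseteq> sets \<nu>"
    and \<psi>: "continuous_on UNIV \<psi>" and p: "P_top f \<psi> \<le> ereal p"
  shows "entropy_wrt \<nu> f P + (\<integral>x. \<psi> x \<partial>\<nu>) \<le> p"
proof -
  let ?c = "cell P" and ?I = "\<integral>x. \<psi> x \<partial>\<nu>"
  define H where "H n = observation_entropy \<nu> (itinerary f ?c n)" for n
  have H: "(\<lambda>n. H n / real n) \<longlonglongrightarrow> entropy_wrt \<nu> f P"
    unfolding H_def by (rule entropy_wrt_limit[OF \<nu> P])
  have bound: "entropy_wrt \<nu> f P + ?I \<le> p + 2 * d + (ln 2 + 1) / real N" if N: "N \<ge> 1" and d: "d > 0" for N d
  proof -
    obtain e where e: "e > 0" and est: "\<And>n. H (n * N) + real (n * N + 1) * ?I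
        \<le> ln (partition_sum f \<psi> (n * N) e) + real n * (ln 2 + 1) + real (n * N + 1) * d + 1"
      by (rule block_entropy_estimate[OF \<nu> simple_function_cell[OF \<nu> P] \<psi> N d, folded H_def]) blast
    have sub: "filterlim (\<lambda>n. n * N) sequentially sequentially"
      using N by (intro filterlim_subseq strict_monoI) auto
    have "\<forall>\<^sub>F m in sequentially. ln (partition_sum f \<psi> m e) \<le> real m * (p + d)"
      using p e d unfolding P_top_le_iff[OF \<psi>] by blast
    from eventually_compose_filterlim[OF this sub]
    have "\<forall>\<^sub>F n in sequentially. H (n * N) / real (n * N) + ?I
        \<le> p + 2 * d + (ln 2 + 1) / real N + (d + 1 - ?I) / real (n * N)"
      using eventually_gt_at_top[of "0::nat"]
    proof eventually_elim
      case (elim n)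
      have pos: "real (n * N) > 0" using elim N by simp
      have "H (n * N) + real (n * N) * ?I
          \<le> real (n * N) * (p + d) + real n * (ln 2 + 1) + real (n * N) * d + (d + 1 - ?I)"
        using est[of n] elim(1) by (simp add: algebra_simps)
      then have "(H (n * N) + real (n * N) * ?I) / real (n * N)
          \<le> (real (n * N) * (p + d) + real n * (ln 2 + 1) + real (n * N) * d + (d + 1 - ?I)) / real (n * N)"
        using pos by (intro divide_right_mono) auto
      also have "\<dots> = p + 2 * d + (ln 2 + 1) / real N + (d + 1 - ?I) / real (n * N)"
        using elim(2) N by (simp add: add_divide_distrib)
      also have "(H (n * N) + real (n * N) * ?I) / real (n * N) = H (n * N) / real (n * N) + ?I"
        using elim(2) N by (simp add: add_divide_distrib)
      finally show ?case .
    qed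
    moreover have "(\<lambda>n. H (n * N) / real (n * N) + ?I) \<longlonglongrightarrow> entropy_wrt \<nu> f P + ?I"
      by (intro tendsto_intros filterlim_compose[OF H sub])
    moreover have "(\<lambda>n. p + 2 * d + (ln 2 + 1) / real N + (d + 1 - ?I) / real (n * N))
        \<longlonglongrightarrow> p + 2 * d + (ln 2 + 1) / real N + 0"
      by (intro tendsto_intros filterlim_compose[OF lim_const_over_n sub])
    ultimately show ?thesis
      using tendsto_le[OF sequentially_bot] by fastforce
  qed
  have "(\<lambda>n. p + 2 * (1 / real (Suc n)) + (ln 2 + 1) / real (Suc n)) \<longlonglongrightarrow> p + 2 * 0 + 0"
    by (intro tendsto_intros LIMSEQ_Suc[OF lim_const_over_n])
  then have "entropy_wrt \<nu> f P + ?I \<le> p + 2 * 0 + 0"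
    by (rule LIMSEQ_le_const) (intro exI allI impI bound; simp)
  then show ?thesis by simp
qed

lemma KS_entropy_le_upper_entropy:
  assumes \<nu>: "\<nu> \<in> invariant_measures f" and fin: "h_top f < \<infinity>"
  shows "KS_entropy \<nu> f \<le> upper_entropy \<nu> f"
  unfolding KS_entropy_def
proof (rule SUP_least, clarify)
  fix P assume P: "finite P" "partition_on (space \<nu>) P" "P \<subseteq> sets \<nu>"
  show "ereal (entropy_wrt \<nu> f P) \<le> upper_entropy \<nu> f"
    unfolding upper_entropy_def
  proof (rule INF_greatest, clarify)
    fix \<psi> :: "'a \<Rightarrow> real" assume \<psi>: "continuous_on UNIV \<psi>"
    obtain p where p: "P_top f \<psi> = ereal p"
      using P_top_finite[OF fin \<psi>] by (cases "P_top f \<psi>") auto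
    have "entropy_wrt \<nu> f P + (\<integral>x. \<psi> x \<partial>\<nu>) \<le> p"
      using P p by (intro entropy_wrt_le_pressure[OF \<nu> _ _ _ \<psi>]) (auto simp: invariant_measuresD(2)[OF \<nu>])
    then show "ereal (entropy_wrt \<nu> f P) \<le> P_top f \<psi> - ereal (\<integral>x. \<psi> x \<partial>\<nu>)"
      by (simp add: p)
  qed
qed

lemma KS_entropy_nonneg:
  assumes \<nu>: "\<nu> \<in> invariant_measures f"
  shows "0 \<le> KS_entropy \<nu> f"
proof -
  interpret prob_space \<nu> by (rule invariant_measuresD(3)[OF \<nu>])
  have P: "finite {UNIV :: 'a set}" "partition_on UNIV {UNIV :: 'a set}" "{UNIV} \<subseteq> sets \<nu>"
    by (auto simp: partition_on_def disjoint_def invariant_measuresD(1)[OF \<nu>])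
  have "0 \<le> entropy_wrt \<nu> f {UNIV}"
    by (rule tendsto_lowerbound[OF entropy_wrt_limit[OF \<nu> P]])
      (auto intro!: always_eventually divide_nonneg_nonneg observation_entropy_nonneg)
  then show ?thesis
    unfolding KS_entropy_def using P invariant_measuresD(2)[OF \<nu>]
    by (intro SUP_upper2[of "{UNIV}"]) auto
qed

end

section \<open>Equilibrium states and zero-temperature limits\<close>

text \<open>
  The only weak-star neighbourhoods that matter are those given by a single test function.
\<close>

lemma accumulation_pointD:
  fixes f :: "'a::metric_space \<Rightarrow> 'a" and g :: "'a \<Rightarrow> real"
  assumes "accumulation_point (weak_star f) \<nu> \<mu>"
  shows "\<mu> \<in> invariant_measures f"
    and "continuous_on UNIV g \<Longrightarrow> e > 0 \<Longrightarrow> \<exists>\<^sub>F t in at_top. \<bar>(\<integral>x. g x \<partial>\<nu> t) - (\<integral>x. g x \<partial>\<mu>)\<bar> < e"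
proof -
  let ?C = "{g :: 'a \<Rightarrow> real. continuous_on UNIV g}"
  let ?T = "product_topology (\<lambda>g. euclideanreal) ?C"
  let ?F = "\<lambda>\<mu>. \<lambda>g\<in>?C. \<integral>x. g x \<partial>\<mu>"
  have ws: "weak_star f = pullback_topology (invariant_measures f) ?F ?T"
    by (simp add: weak_star_def)
  show \<mu>: "\<mu> \<in> invariant_measures f"
    using assms by (auto simp: accumulation_point_def ws topspace_pullback_topology)
  assume g: "continuous_on UNIV g" and e: "e > 0"
  let ?U = "{\<omega> \<in> topspace ?T. \<omega> g \<in> ball (\<integral>x. g x \<partial>\<mu>) e}"
  let ?S = "?F -` ?U \<inter> invariant_measures f"
  have "openin ?T ?U"
    using g by (intro openin_continuous_map_preimage[OF continuous_map_product_projection]) auto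
  then have "openin (weak_star f) ?S"
    unfolding ws openin_pullback_topology by blast
  moreover have "\<mu> \<in> ?S"
    using \<mu> g e by simp
  ultimately have "\<exists>\<^sub>F t in at_top. \<nu> t \<in> ?S"
    using assms unfolding accumulation_point_def by blast
  then show "\<exists>\<^sub>F t in at_top. \<bar>(\<integral>x. g x \<partial>\<nu> t) - (\<integral>x. g x \<partial>\<mu>)\<bar> < e"
    by (rule frequently_elim1) (use g in \<open>auto simp: dist_real_def abs_minus_commute\<close>)
qed

context compact_system
begin

text \<open>
  A subgradient of the pressure at \<open>\<psi>\<close> is a measure at which the infimum in the definition of the
  upper entropy is attained by \<open>\<psi>\<close>.
\<close>

lemma equilibrium_state_exists:
  assumes fin: "h_top f < \<infinity>" and \<psi>: "continuous_on UNIV \<psi>"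
  obtains \<nu> where "\<nu> \<in> invariant_measures f" "P_top f \<psi> = upper_entropy \<nu> f + ereal (\<integral>x. \<psi> x \<partial>\<nu>)"
proof -
  define Q where "Q g = real_of_ereal (P_top f g)" for g
  have Q: "P_top f g = ereal (Q g)" if "continuous_on UNIV g" for g
    using P_top_finite[OF fin that] by (simp add: Q_def ereal_real)
  have Q_le: "Q g \<le> c" if "continuous_on UNIV g" "P_top f g \<le> ereal c" for g c
    using Q[OF that(1)] that(2) by simp
  obtain \<nu> where \<nu>: "\<nu> \<in> invariant_measures f"
    "\<And>g. continuous_on UNIV g \<Longrightarrow> Q \<psi> + (\<integral>x. g x \<partial>\<nu>) \<le> Q (\<lambda>x. \<psi> x + g x)"
  proof (rule invariant_subgradient[of Q \<psi>])
    fix g h :: "'a \<Rightarrow> real" assume g: "continuous_on UNIV g" and h: "continuous_on UNIV h"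
    have hf: "continuous_on UNIV (\<lambda>x. h (f x))"
      using cont_comp_iterate[OF h, of UNIV 1] by simp
    show "Q g \<le> Q h" if "\<And>x. g x \<le> h x"
      by (rule Q_le[OF g P_top_mono[OF h g that]]) (simp add: Q h)
    show "Q (\<lambda>x. u * g x + (1 - u) * h x) \<le> u * Q g + (1 - u) * Q h" if "0 \<le> u" "u \<le> 1" for u
      by (rule Q_le[OF _ P_top_convex[OF g h that]]) (auto simp: Q g h intro!: continuous_intros)
    show "Q (\<lambda>x. g x + (h (f x) - h x)) \<le> Q g"
      by (rule Q_le[OF _ P_top_coboundary[OF g h]]) (auto simp: Q g intro!: continuous_intros g h hf)
  next
    fix g :: "'a \<Rightarrow> real" and c assume g: "continuous_on UNIV g"
    show "Q (\<lambda>x. g x + c) \<le> Q g + c"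
      by (rule Q_le[OF _ P_top_add_const[OF g]]) (auto simp: Q g intro!: continuous_intros)
  next
    fix \<nu> assume "\<nu> \<in> invariant_measures f"
      "\<And>g. continuous_on UNIV g \<Longrightarrow> Q \<psi> + (\<integral>x. g x \<partial>\<nu>) \<le> Q (\<lambda>x. \<psi> x + g x)"
    then show thesis by (rule that)
  qed (rule \<psi>)
  have int: "integrable \<nu> g" if "continuous_on UNIV g" for g :: "'a \<Rightarrow> real"
    by (rule integrable_invariant[OF \<nu>(1) that])
  have "upper_entropy \<nu> f = ereal (Q \<psi> - (\<integral>x. \<psi> x \<partial>\<nu>))"
  proof (rule antisym)
    show "upper_entropy \<nu> f \<le> ereal (Q \<psi> - (\<integral>x. \<psi> x \<partial>\<nu>))"
      unfolding upper_entropy_def by (rule INF_lower2[of \<psi>]) (use \<psi> in \<open>auto simp: Q\<close>)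
    show "ereal (Q \<psi> - (\<integral>x. \<psi> x \<partial>\<nu>)) \<le> upper_entropy \<nu> f"
      unfolding upper_entropy_def
    proof (rule INF_greatest, clarify)
      fix g :: "'a \<Rightarrow> real" assume g: "continuous_on UNIV g"
      have "Q \<psi> + (\<integral>x. g x - \<psi> x \<partial>\<nu>) \<le> Q (\<lambda>x. \<psi> x + (g x - \<psi> x))"
        by (intro \<nu>(2) continuous_intros g \<psi>)
      then have "Q \<psi> - (\<integral>x. \<psi> x \<partial>\<nu>) \<le> Q g - (\<integral>x. g x \<partial>\<nu>)"
        by (simp add: int g \<psi>)
      then show "ereal (Q \<psi> - (\<integral>x. \<psi> x \<partial>\<nu>)) \<le> P_top f g - ereal (\<integral>x. g x \<partial>\<nu>)"
        by (simp add: Q g)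
    qed
  qed
  with \<nu>(1) show thesis
    by (intro that[of \<nu>]) (simp_all add: Q \<psi>)
qed

lemma upper_entropy_le:
  assumes "continuous_on UNIV \<psi>" "P_top f \<psi> = ereal p"
  shows "upper_entropy \<nu> f \<le> ereal (p - (\<integral>x. \<psi> x \<partial>\<nu>))"
  unfolding upper_entropy_def by (rule INF_lower2[of \<psi>]) (use assms in auto)

lemma upper_entropy_bounds:
  assumes fin: "h_top f < \<infinity>" and \<nu>: "\<nu> \<in> invariant_measures f"
  shows "0 \<le> upper_entropy \<nu> f" "upper_entropy \<nu> f \<le> h_top f"
proof -
  show "0 \<le> upper_entropy \<nu> f"
    using KS_entropy_nonneg[OF \<nu>] KS_entropy_le_upper_entropy[OF \<nu> fin] by (rule order_trans)
  show "upper_entropy \<nu> f \<le> h_top f"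
    unfolding upper_entropy_def h_top_def by (rule INF_lower2[of "\<lambda>x. 0"]) auto
qed

text \<open>
  For \<open>Q g = sup \<integral> g d\<nu>\<close> a subgradient at \<open>\<phi>\<close>, tested on \<open>- \<phi>\<close>, is a measure with \<open>Q \<phi> \<le> \<integral> \<phi> d\<nu>\<close>.
\<close>

lemma maximizing_measure_exists:
  fixes \<phi> :: "'a \<Rightarrow> real"
  assumes ne: "invariant_measures f \<noteq> {}" and \<phi>: "continuous_on UNIV \<phi>"
  obtains \<nu> where "\<nu> \<in> invariant_measures f"
    "\<And>\<nu>'. \<nu>' \<in> invariant_measures f \<Longrightarrow> (\<integral>x. \<phi> x \<partial>\<nu>') \<le> (\<integral>x. \<phi> x \<partial>\<nu>)"
proof -
  define Q where "Q g = (SUP \<nu>\<in>invariant_measures f. \<integral>x. g x \<partial>\<nu>)" for g :: "'a \<Rightarrow> real"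
  have int: "integrable \<nu> g" if "\<nu> \<in> invariant_measures f" "continuous_on UNIV g" for \<nu> and g :: "'a \<Rightarrow> real"
    by (rule integrable_invariant[OF that])
  have bdd: "bdd_above ((\<lambda>\<nu>. \<integral>x. g x \<partial>\<nu>) ` invariant_measures f)" if g: "continuous_on UNIV g" for g :: "'a \<Rightarrow> real"
  proof -
    obtain b where b: "\<And>x. \<bar>g x\<bar> \<le> b" using bounded_cont[OF g] by metis
    have "(\<integral>x. g x \<partial>\<nu>) \<le> b" if \<nu>: "\<nu> \<in> invariant_measures f" for \<nu>
    proof -
      interpret prob_space \<nu> by (rule invariant_measuresD(3)[OF \<nu>])
      have "(\<integral>x. g x \<partial>\<nu>) \<le> (\<integral>x. b \<partial>\<nu>)"
        using order_trans[OF abs_ge_self b] by (intro integral_mono int \<nu> g) auto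
      then show ?thesis by (simp add: prob_space)
    qed
    then show ?thesis by (rule bdd_aboveI2)
  qed
  have upper: "(\<integral>x. g x \<partial>\<nu>) \<le> Q g" if "\<nu> \<in> invariant_measures f" "continuous_on UNIV g" for \<nu> g
    unfolding Q_def by (rule cSUP_upper[OF that(1) bdd[OF that(2)]])
  have least: "Q g \<le> c" if "\<And>\<nu>. \<nu> \<in> invariant_measures f \<Longrightarrow> (\<integral>x. g x \<partial>\<nu>) \<le> c" for g c
    unfolding Q_def by (rule cSUP_least[OF ne that])
  obtain \<nu> where \<nu>: "\<nu> \<in> invariant_measures f"
    "\<And>g. continuous_on UNIV g \<Longrightarrow> Q \<phi> + (\<integral>x. g x \<partial>\<nu>) \<le> Q (\<lambda>x. \<phi> x + g x)"
  proof (rule invariant_subgradient[of Q \<phi>])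
    fix g h :: "'a \<Rightarrow> real" assume g: "continuous_on UNIV g" and h: "continuous_on UNIV h"
    have hf: "continuous_on UNIV (\<lambda>x. h (f x))"
      using cont_comp_iterate[OF h, of UNIV 1] by simp
    show "Q g \<le> Q h" if "\<And>x. g x \<le> h x"
    proof (rule least)
      fix \<nu> assume \<nu>: "\<nu> \<in> invariant_measures f"
      have "(\<integral>x. g x \<partial>\<nu>) \<le> (\<integral>x. h x \<partial>\<nu>)"
        by (intro integral_mono int \<nu> g h that)
      also have "\<dots> \<le> Q h" by (rule upper[OF \<nu> h])
      finally show "(\<integral>x. g x \<partial>\<nu>) \<le> Q h" .
    qed
    show "Q (\<lambda>x. u * g x + (1 - u) * h x) \<le> u * Q g + (1 - u) * Q h" if "0 \<le> u" "u \<le> 1" for u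
    proof (rule least)
      fix \<nu> assume \<nu>: "\<nu> \<in> invariant_measures f"
      have "(\<integral>x. u * g x + (1 - u) * h x \<partial>\<nu>) = u * (\<integral>x. g x \<partial>\<nu>) + (1 - u) * (\<integral>x. h x \<partial>\<nu>)"
        using int[OF \<nu> g] int[OF \<nu> h] by simp
      also have "\<dots> \<le> u * Q g + (1 - u) * Q h"
        using that by (intro add_mono mult_left_mono upper \<nu> g h) auto
      finally show "(\<integral>x. u * g x + (1 - u) * h x \<partial>\<nu>) \<le> u * Q g + (1 - u) * Q h" .
    qed
    show "Q (\<lambda>x. g x + (h (f x) - h x)) \<le> Q g"
    proof (rule least)
      fix \<nu> assume \<nu>: "\<nu> \<in> invariant_measures f"
      have "(\<integral>x. h (f x) \<partial>\<nu>) = (\<integral>x. h x \<partial>\<nu>)"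
        using integral_funpow[OF \<nu> borel_measurable_integrable[OF int[OF \<nu> h]], of 1] by simp
      then show "(\<integral>x. g x + (h (f x) - h x) \<partial>\<nu>) \<le> Q g"
        using upper[OF \<nu> g] int[OF \<nu> g] int[OF \<nu> h] int[OF \<nu> hf] by simp
    qed
  next
    fix g :: "'a \<Rightarrow> real" and c assume g: "continuous_on UNIV g"
    show "Q (\<lambda>x. g x + c) \<le> Q g + c"
    proof (rule least)
      fix \<nu> assume \<nu>: "\<nu> \<in> invariant_measures f"
      interpret prob_space \<nu> by (rule invariant_measuresD(3)[OF \<nu>])
      show "(\<integral>x. g x + c \<partial>\<nu>) \<le> Q g + c"
        using upper[OF \<nu> g] int[OF \<nu> g] by (simp add: prob_space)
    qed
  next
    fix \<nu> assume "\<nu> \<in> invariant_measures f"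
      "\<And>g. continuous_on UNIV g \<Longrightarrow> Q \<phi> + (\<integral>x. g x \<partial>\<nu>) \<le> Q (\<lambda>x. \<phi> x + g x)"
    then show thesis by (rule that)
  qed (rule \<phi>)
  have "Q \<phi> + (\<integral>x. - \<phi> x \<partial>\<nu>) \<le> Q (\<lambda>x. \<phi> x + - \<phi> x)"
    by (intro \<nu>(2) continuous_intros \<phi>)
  also have "\<dots> \<le> 0" by (rule least) simp
  finally have "Q \<phi> \<le> (\<integral>x. \<phi> x \<partial>\<nu>)" by simp
  with upper[OF _ \<phi>] \<nu>(1) show thesis
    by (intro that[of \<nu>]) (auto intro: order_trans)
qed

end

theorem corollary6:
  fixes f :: "'a::metric_space \<Rightarrow> 'a" and \<phi> :: "'a \<Rightarrow> real"
  assumes "compact (UNIV :: 'a set)"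
    and "continuous_on UNIV f"
    and "h_top f < \<infinity>"
    and "continuous_on UNIV \<phi>"
  shows "(\<forall>t>0. is_maximum (ereal (1 / t) * P_top f (\<lambda>x. t * \<phi> x))
            ((\<lambda>\<nu>. ereal (1 / t) * upper_entropy \<nu> f + ereal (\<integral>x. \<phi> x \<partial>\<nu>)) ` invariant_measures f))
       \<and> (\<exists>m. is_maximum m ((\<lambda>\<nu>. \<integral>x. \<phi> x \<partial>\<nu>) ` invariant_measures f)
            \<and> ((\<lambda>t. ereal (1 / t) * P_top f (\<lambda>x. t * \<phi> x)) \<longlongrightarrow> ereal m) at_top)
       \<and> (\<forall>\<nu> \<mu>. equilibrium_family f \<phi> \<nu> \<and> accumulation_point (weak_star f) \<nu> \<mu> \<longrightarrow>
            is_maximum (\<integral>x. \<phi> x \<partial>\<mu>) ((\<lambda>\<nu>. \<integral>x. \<phi> x \<partial>\<nu>) ` invariant_measures f)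
          \<and> is_maximum (upper_entropy \<mu> f)
              ((\<lambda>\<nu>. upper_entropy \<nu> f) ` zero_temperature_measures f \<phi>)
          \<and> (SUP \<nu>\<in>zero_temperature_measures f \<phi>. KS_entropy \<nu> f) \<le> upper_entropy \<mu> f
          \<and> ((\<lambda>t. upper_entropy (\<nu> t) f) \<longlongrightarrow> upper_entropy \<mu> f) at_top)"
proof -
  note fin = assms(3) and \<phi> = assms(4)
  interpret compact_system f by unfold_locales (fact assms)+
  let ?inv = "invariant_measures f"
  define I where "I \<nu> = (\<integral>x. \<phi> x \<partial>\<nu>)" for \<nu>
  define u where "u \<nu> = real_of_ereal (upper_entropy \<nu> f)" for \<nu>
  define p where "p \<psi> = real_of_ereal (P_top f \<psi>)" for \<psi>
  obtain H where H: "h_top f = ereal H"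
    using fin h_top_nonneg by (cases "h_top f") auto
  have u: "upper_entropy \<nu> f = ereal (u \<nu>)" "0 \<le> u \<nu>" "u \<nu> \<le> H" if "\<nu> \<in> ?inv" for \<nu>
    using upper_entropy_bounds[OF fin that] H by (cases "upper_entropy \<nu> f"; simp add: u_def)+
  have p: "P_top f \<psi> = ereal (p \<psi>)" if "continuous_on UNIV \<psi>" for \<psi>
    using P_top_finite[OF fin that] by (simp add: p_def ereal_real)
  have t\<phi>: "continuous_on UNIV (\<lambda>x. t * \<phi> x)" for t
    by (intro continuous_intros \<phi>)
  have variational: "u \<nu> + (\<integral>x. \<psi> x \<partial>\<nu>) \<le> p \<psi>" if "\<nu> \<in> ?inv" "continuous_on UNIV \<psi>" for \<nu> \<psi>
    using upper_entropy_le[OF that(2) p[OF that(2)], of \<nu>] u(1)[OF that(1)] by simp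
  have equilibrium: "p (\<lambda>x. t * \<phi> x) = u \<nu> + t * I \<nu>"
    if "\<nu> \<in> ?inv" "P_top f (\<lambda>x. t * \<phi> x) = upper_entropy \<nu> f + ereal (\<integral>x. t * \<phi> x \<partial>\<nu>)" for \<nu> t
    using that p[OF t\<phi>, of t] u(1)[OF that(1)] by (simp add: I_def)
  have le_p: "u \<nu> + t * I \<nu> \<le> p (\<lambda>x. t * \<phi> x)" if "\<nu> \<in> ?inv" for \<nu> t
    using variational[OF that t\<phi>, of t] by (simp add: I_def)
  have eq_exists: "\<exists>\<nu>\<in>?inv. p (\<lambda>x. t * \<phi> x) = u \<nu> + t * I \<nu>" for t
    using equilibrium_state_exists[OF fin t\<phi>, of t] equilibrium by metis
  obtain \<mu>0 where \<mu>0: "\<mu>0 \<in> ?inv" "\<And>\<nu>. \<nu> \<in> ?inv \<Longrightarrow> I \<nu> \<le> I \<mu>0"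
    using maximizing_measure_exists[OF _ \<phi>] eq_exists[of 0] unfolding I_def by blast

  have part1: "is_maximum (ereal (1 / t) * P_top f (\<lambda>x. t * \<phi> x))
      ((\<lambda>\<nu>. ereal (1 / t) * upper_entropy \<nu> f + ereal (I \<nu>)) ` ?inv)" if t: "t > 0" for t
  proof -
    have scaled: "ereal (1 / t) * upper_entropy \<nu> f + ereal (I \<nu>) = ereal (1 / t * (u \<nu> + t * I \<nu>))"
      if "\<nu> \<in> ?inv" for \<nu>
      using t by (simp add: u(1)[OF that] field_simps)
    have P: "ereal (1 / t) * P_top f (\<lambda>x. t * \<phi> x) = ereal (1 / t * p (\<lambda>x. t * \<phi> x))"
      by (simp add: p t\<phi>)
    obtain \<nu> where \<nu>: "\<nu> \<in> ?inv" "p (\<lambda>x. t * \<phi> x) = u \<nu> + t * I \<nu>"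
      using eq_exists by blast
    have "1 / t * (u \<nu>' + t * I \<nu>') \<le> 1 / t * p (\<lambda>x. t * \<phi> x)" if "\<nu>' \<in> ?inv" for \<nu>'
      using le_p[OF that, of t] t by (intro mult_left_mono) auto
    then show ?thesis
      unfolding is_maximum_def P using scaled \<nu> by (auto intro!: image_eqI[of _ _ \<nu>])
  qed

  have max_eq: "is_maximum (I \<mu>) (I ` ?inv) \<longleftrightarrow> (\<forall>\<nu>\<in>?inv. I \<nu> \<le> I \<mu>)" if "\<mu> \<in> ?inv" for \<mu>
    using that by (auto simp: is_maximum_def)

  have part2: "((\<lambda>t. ereal (1 / t) * P_top f (\<lambda>x. t * \<phi> x)) \<longlongrightarrow> ereal (I \<mu>0)) at_top"
  proof -
    have "((\<lambda>t. 1 / t * p (\<lambda>x. t * \<phi> x)) \<longlongrightarrow> I \<mu>0) at_top"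
    proof (rule tendsto_sandwich)
      show "\<forall>\<^sub>F t in at_top. I \<mu>0 \<le> 1 / t * p (\<lambda>x. t * \<phi> x)"
        using eventually_gt_at_top[of 0]
      proof eventually_elim
        case (elim t)
        have "t * I \<mu>0 \<le> p (\<lambda>x. t * \<phi> x)"
          using le_p[OF \<mu>0(1), of t] u(2)[OF \<mu>0(1)] by simp
        with elim show ?case by (simp add: field_simps)
      qed
      show "\<forall>\<^sub>F t in at_top. 1 / t * p (\<lambda>x. t * \<phi> x) \<le> H / t + I \<mu>0"
        using eventually_gt_at_top[of 0]
      proof eventually_elim
        case (elim t)
        obtain \<nu> where \<nu>: "\<nu> \<in> ?inv" "p (\<lambda>x. t * \<phi> x) = u \<nu> + t * I \<nu>"
          using eq_exists by blast
        have "p (\<lambda>x. t * \<phi> x) \<le> H + t * I \<mu>0"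
          unfolding \<nu>(2) using elim by (intro add_mono mult_left_mono u(3) \<mu>0(2) \<nu>(1)) auto
        with elim show ?case by (simp add: field_simps)
      qed
      have "((\<lambda>t. H / t + I \<mu>0) \<longlongrightarrow> 0 + I \<mu>0) at_top"
        by (intro tendsto_intros tendsto_divide_0[OF tendsto_const] filterlim_at_top_imp_at_infinity filterlim_ident)
      then show "((\<lambda>t. H / t + I \<mu>0) \<longlongrightarrow> I \<mu>0) at_top" by simp
    qed (rule tendsto_const)
    then show ?thesis by (simp add: p t\<phi>)
  qed

  have part3: "is_maximum (I \<mu>) (I ` ?inv)
      \<and> is_maximum (upper_entropy \<mu> f) ((\<lambda>\<nu>. upper_entropy \<nu> f) ` zero_temperature_measures f \<phi>)
      \<and> (SUP \<nu>\<in>zero_temperature_measures f \<phi>. KS_entropy \<nu> f) \<le> upper_entropy \<mu> f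
      \<and> ((\<lambda>t. upper_entropy (\<nu> t) f) \<longlongrightarrow> upper_entropy \<mu> f) at_top"
    if fam: "equilibrium_family f \<phi> \<nu>" and acc: "accumulation_point (weak_star f) \<nu> \<mu>" for \<nu> \<mu>
  proof -
    note \<mu> = accumulation_pointD(1)[OF acc] and freq = accumulation_pointD(2)[OF acc]
    have \<nu>: "\<nu> t \<in> ?inv" "p (\<lambda>x. t * \<phi> x) = u (\<nu> t) + t * I (\<nu> t)" if "t > 0" for t
      using fam that equilibrium[of "\<nu> t" t] by (auto simp: equilibrium_family_def)
    have optimal: "u \<nu>' + t * I \<nu>' \<le> u (\<nu> t) + t * I (\<nu> t)" if "t > 0" "\<nu>' \<in> ?inv" for t \<nu>'
      using le_p[OF that(2), of t] \<nu>(2)[OF that(1)] by simp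

    \<comment> \<open>Entropies lie in \<open>[0, H]\<close>, so an equilibrium state at \<open>t\<close> is maximizing up to \<open>H / t\<close>.\<close>
    have I_max: "I \<nu>' \<le> I \<mu>" if \<nu>': "\<nu>' \<in> ?inv" for \<nu>'
    proof (rule field_le_epsilon)
      fix e :: real assume "e > 0"
      have "\<forall>\<^sub>F t in at_top. 0 < t \<and> H / (e / 2) < t"
        using eventually_gt_at_top[of 0] eventually_gt_at_top[of "H / (e / 2)"] by eventually_elim simp
      then have "\<exists>\<^sub>F t in at_top. \<bar>I (\<nu> t) - I \<mu>\<bar> < e / 2 \<and> (0 < t \<and> H / (e / 2) < t)"
        using freq[OF \<phi>, of "e / 2"] \<open>e > 0\<close> unfolding I_def
        by (intro frequently_eventually_frequently) auto
      then obtain t where t: "\<bar>I (\<nu> t) - I \<mu>\<bar> < e / 2" "0 < t" "H / (e / 2) < t"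
        using frequently_ex by blast
      have "t * I \<nu>' \<le> H + t * I (\<nu> t)"
        using optimal[OF t(2) \<nu>'] u(2)[OF \<nu>'] u(3)[OF \<nu>(1)[OF t(2)]] by linarith
      moreover have "H < t * (e / 2)"
        using t(3) \<open>e > 0\<close> by (simp add: field_simps)
      ultimately have "t * I \<nu>' < t * (I (\<nu> t) + e / 2)"
        by (simp add: algebra_simps)
      with t(2) have "I \<nu>' < I (\<nu> t) + e / 2" by simp
      with t(1) show "I \<nu>' \<le> I \<mu> + e" by linarith
    qed

    \<comment> \<open>Adding the optimality of \<open>\<nu> s\<close> at \<open>s\<close> and of \<open>\<nu> t\<close> at \<open>t\<close> shows that \<open>I\<close> increases along the family;
      optimality at \<open>s\<close> then forces the entropy to decrease.\<close>
    have u_anti: "u (\<nu> t) \<le> u (\<nu> s)" if "0 < s" "s \<le> t" for s t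
    proof -
      have t: "t > 0" using that by simp
      note st = optimal[OF that(1) \<nu>(1)[OF t]] and ts = optimal[OF t \<nu>(1)[OF that(1)]]
      have "0 \<le> (t - s) * (I (\<nu> t) - I (\<nu> s))"
        using st ts by (simp add: algebra_simps)
      show ?thesis
      proof (cases "s = t")
        case False
        then have "I (\<nu> s) \<le> I (\<nu> t)"
          using \<open>0 \<le> (t - s) * (I (\<nu> t) - I (\<nu> s))\<close> that by (simp add: zero_le_mult_iff)
        then have "s * I (\<nu> s) \<le> s * I (\<nu> t)"
          using that(1) by simp
        with st show ?thesis by linarith
      qed simp
    qed

    \<comment> \<open>A maximizing measure has the larger integral, so by optimality of \<open>\<nu> t\<close> it has the smaller entropy.\<close>
    have maximizing_le: "u \<nu>' \<le> u (\<nu> t)" if "t > 0" "maximizing f \<phi> \<nu>'" for \<nu>' t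
    proof -
      have \<nu>': "\<nu>' \<in> ?inv" "I (\<nu> t) \<le> I \<nu>'"
        using that(2) \<nu>(1)[OF that(1)] by (auto simp: maximizing_def is_maximum_def I_def)
      have "t * I (\<nu> t) \<le> t * I \<nu>'"
        using \<nu>'(2) that(1) by simp
      with optimal[OF that(1) \<nu>'(1)] show ?thesis by linarith
    qed

    define L where "L = (INF t\<in>{0<..}. u (\<nu> t))"
    have bdd: "bdd_below ((\<lambda>t. u (\<nu> t)) ` {0<..})"
      using u(2) \<nu>(1) by (intro bdd_belowI2[of _ 0]) auto
    have L_le: "L \<le> u (\<nu> t)" if "t > 0" for t
      unfolding L_def using that by (intro cINF_lower[OF bdd]) auto
    have L_greatest: "c \<le> L" if "\<And>t. t > 0 \<Longrightarrow> c \<le> u (\<nu> t)" for c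
      unfolding L_def using that by (intro cINF_greatest) auto

    \<comment> \<open>Upper semicontinuity: each \<open>\<psi>\<close> bounds \<open>u (\<nu> t) \<ge> L\<close> by a quantity continuous in the measure.\<close>
    have "ereal L \<le> upper_entropy \<mu> f"
      unfolding upper_entropy_def
    proof (rule INF_greatest, clarify)
      fix \<psi> :: "'a \<Rightarrow> real" assume \<psi>: "continuous_on UNIV \<psi>"
      have "L \<le> p \<psi> - (\<integral>x. \<psi> x \<partial>\<mu>)"
      proof (rule field_le_epsilon)
        fix e :: real assume "e > 0"
        have "\<exists>\<^sub>F t in at_top. \<bar>(\<integral>x. \<psi> x \<partial>\<nu> t) - (\<integral>x. \<psi> x \<partial>\<mu>)\<bar> < e \<and> 0 < t"
          by (intro frequently_eventually_frequently freq \<psi> \<open>e > 0\<close> eventually_gt_at_top)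
        then obtain t where t: "\<bar>(\<integral>x. \<psi> x \<partial>\<nu> t) - (\<integral>x. \<psi> x \<partial>\<mu>)\<bar> < e" "0 < t"
          using frequently_ex by blast
        with L_le[OF t(2)] variational[OF \<nu>(1)[OF t(2)] \<psi>]
        show "L \<le> p \<psi> - (\<integral>x. \<psi> x \<partial>\<mu>) + e" by linarith
      qed
      then show "ereal L \<le> P_top f \<psi> - ereal (\<integral>x. \<psi> x \<partial>\<mu>)"
        by (simp add: p \<psi>)
    qed
    then have "L \<le> u \<mu>" by (simp add: u(1)[OF \<mu>])
    have max\<mu>: "maximizing f \<phi> \<mu>"
      using \<mu> I_max max_eq[OF \<mu>] unfolding maximizing_def I_def by blast
    have "u \<mu> \<le> L"
      by (intro L_greatest maximizing_le max\<mu>)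
    with \<open>L \<le> u \<mu>\<close> have u\<mu>: "u \<mu> = L" by simp

    have zero: "\<mu> \<in> zero_temperature_measures f \<phi>"
      using max\<mu> fam acc by (auto simp: zero_temperature_measures_def)
    have zero_le: "upper_entropy \<nu>' f \<le> upper_entropy \<mu> f" "\<nu>' \<in> ?inv"
      if "\<nu>' \<in> zero_temperature_measures f \<phi>" for \<nu>'
    proof -
      have max: "maximizing f \<phi> \<nu>'" using that by (simp add: zero_temperature_measures_def)
      then show inv: "\<nu>' \<in> ?inv" by (simp add: maximizing_def)
      have "u \<nu>' \<le> L" by (intro L_greatest maximizing_le max)
      then show "upper_entropy \<nu>' f \<le> upper_entropy \<mu> f"
        by (simp add: u(1) inv \<mu> u\<mu>)
    qed

    have "((\<lambda>t. u (\<nu> t)) \<longlongrightarrow> L) at_top"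
    proof (rule order_tendstoI)
      fix y assume "y < L"
      from eventually_gt_at_top[of 0] show "\<forall>\<^sub>F t in at_top. y < u (\<nu> t)"
        by eventually_elim (rule less_le_trans[OF \<open>y < L\<close> L_le])
    next
      fix y assume "L < y"
      then obtain s where s: "s > 0" "u (\<nu> s) < y"
        unfolding L_def using bdd by (auto simp: cINF_less_iff)
      from eventually_ge_at_top[of s] show "\<forall>\<^sub>F t in at_top. u (\<nu> t) < y"
        by eventually_elim (rule le_less_trans[OF u_anti s(2)], use s in auto)
    qed
    then have "((\<lambda>t. ereal (u (\<nu> t))) \<longlongrightarrow> ereal L) at_top" by simp
    moreover have "\<forall>\<^sub>F t in at_top. ereal (u (\<nu> t)) = upper_entropy (\<nu> t) f"
      using eventually_gt_at_top[of 0] by eventually_elim (simp add: u(1) \<nu>(1))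
    ultimately have "((\<lambda>t. upper_entropy (\<nu> t) f) \<longlongrightarrow> ereal L) at_top"
      by (rule Lim_transform_eventually)
    then have lim: "((\<lambda>t. upper_entropy (\<nu> t) f) \<longlongrightarrow> upper_entropy \<mu> f) at_top"
      by (simp add: u(1)[OF \<mu>] u\<mu>)
    have "KS_entropy \<nu>' f \<le> upper_entropy \<mu> f" if "\<nu>' \<in> zero_temperature_measures f \<phi>" for \<nu>'
      using KS_entropy_le_upper_entropy[OF zero_le(2)[OF that] fin] zero_le(1)[OF that] by (rule order_trans)
    then have "(SUP \<nu>\<in>zero_temperature_measures f \<phi>. KS_entropy \<nu> f) \<le> upper_entropy \<mu> f"
      by (rule SUP_least)
    with lim zero zero_le(1) I_max \<mu> show ?thesis
      by (auto simp: is_maximum_def)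
  qed
  show ?thesis
    using part1 part2 part3 max_eq[OF \<mu>0(1)] \<mu>0(2) unfolding I_def by blast
qed

end
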